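(* Let $q$ be a prime power and $M\geq 2$ an integer. Let $S_U^M(n,q)$ denote the number of separable matrices in $\mathrm{U}(n,\mathbb{F}_{q^2})$ which are $M$-th powers in $\mathrm{U}(n,\mathbb{F}_{q^2})$. Then \[ 1+\sum_{n\geq 1}\frac{S_U^M(n,q)}{|\mathrm{U}(n,\mathbb{F}_{q^2})|}z^n=\prod_{d\ \text{odd}}\left(1+\frac{z^d}{q^d+1}\right)^{\widetilde{N}_M(q,d)}\prod_{d\geq 1}\left(1+\frac{z^{2d}}{q^{2d}-1}\right)^{\widetilde{R}_M(q,d)}, \] where the first product is over odd positive integers $d$.
   Context: For $a\in\mathbb{F}_{q^2}$ write $\bar a=a^q$, extended coefficientwise to matrices and polynomials. Let $\Lambda_n$ be the $n\times n$ antidiagonal matrix with $1$'s on the antidiagonal; $\mathrm{U}(n,\mathbb{F}_{q^2})=\{A\in \mathrm{GL}(n,\mathbb{F}_{q^2}) : A\Lambda_n\bar A^{t}=\Lambda_n\}$. An element $A$ is an $M$-th power in $\mathrm{U}(n,\mathbb{F}_{q^2})$ if $A=\alpha^M$ for some $\alpha\in\mathrm{U}(n,\mathbb{F}_{q^2})$. A matrix is separable if its characteristic polynomial has no repeated roots. For monic $f$ of degree $d$ with $f(0)\ne0$, $\widetilde{f}(t)=\overline{f(0)}^{-1}t^d\bar f(t^{-1})$. A SCIM polynomial is a monic $f\in\mathbb{F}_{q^2}[t]$, $f(0)\neq 0$, irreducible over $\mathbb{F}_{q^2}$, with $\widetilde f=f$. A SCIM polynomial $f$ of degree $d$ is $\widetilde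 M$-power if $f(x^M)$ has a SCIM factor of degree $d$; $\widetilde N_M(q,d)$ is the number of $\widetilde M$-power SCIM polynomials of degree $d$. A monic irreducible $g\in\mathbb{F}_{q^2}[t]$ of degree $d$ with $g(0)\ne 0$ is an $M$-power polynomial if $g(x^M)$ has an irreducible factor of degree $d$ over $\mathbb{F}_{q^2}$. $\widetilde R_M(q,d)$ is the number of unordered pairs $\{g,\widetilde g\}$ where $g$ is monic irreducible of degree $d$ over $\mathbb{F}_{q^2}$ with $g(0)\neq0$, $g\neq\widetilde g$, and $g$ an $M$-power polynomial. *)

theory Defs
  imports "Jordan_Normal_Form.Char_Poly" "HOL-Computational_Algebra.Formal_Power_Series"
begin

text \<open>Throughout, 'a is a finite field with CARD('a) = q^2 playing the role of F_{q^2}.\<close>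

definition frob :: "nat \<Rightarrow> 'a::field \<Rightarrow> 'a" where
  "frob q a = a ^ q"

definition conj_mat :: "nat \<Rightarrow> 'a::field mat \<Rightarrow> 'a mat" where
  "conj_mat q A = map_mat (frob q) A"

definition conj_poly :: "nat \<Rightarrow> 'a::field poly \<Rightarrow> 'a poly" where
  "conj_poly q f = map_poly (frob q) f"

definition antidiag :: "nat \<Rightarrow> 'a::field mat" where
  "antidiag n = mat n n (\<lambda>(i,j). if i + j = n - 1 then 1 else 0)"

definition unitary_group :: "nat \<Rightarrow> nat \<Rightarrow> 'a::field mat set" where
  "unitary_group q n = {A \<in> carrier_mat n n. invertible_mat A \<and>
      A * antidiag n * transpose_mat (conj_mat q A) = antidiag n}"

definition is_Mth_power_U :: "nat \<Rightarrow> nat \<Rightarrow> nat \<Rightarrow> 'a::field mat \<Rightarrow> bool" where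
  "is_Mth_power_U q n M A \<longleftrightarrow> (\<exists>\<alpha> \<in> unitary_group q n. A = \<alpha> ^\<^sub>m M)"

text \<open>Separable: the characteristic polynomial has no repeated roots (in an algebraic
  closure), i.e. it is coprime to its formal derivative.\<close>
definition separable_mat :: "'a::field mat \<Rightarrow> bool" where
  "separable_mat A \<longleftrightarrow> coprime (char_poly A) (pderiv (char_poly A))"

definition S_U :: "nat \<Rightarrow> nat \<Rightarrow> nat \<Rightarrow> 'a::{field,finite} itself \<Rightarrow> nat" where
  "S_U M n q _ = card {A :: 'a mat. A \<in> unitary_group q n \<and> separable_mat A \<and> is_Mth_power_U q n M A}"

text \<open>f-tilde(t) = conj(f(0))^{-1} t^d conj(f)(t^{-1}), d = deg f.\<close>
definition tilde :: "nat \<Rightarrow> 'a::field poly \<Rightarrow> 'a poly" where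
  "tilde q f = Polynomial.smult (inverse (frob q (poly f 0))) (\<Sum>i\<le>degree f. monom (frob q (coeff f i)) (degree f - i))"

definition SCIM :: "nat \<Rightarrow> 'a::field poly \<Rightarrow> bool" where
  "SCIM q f \<longleftrightarrow> monic f \<and> poly f 0 \<noteq> 0 \<and> irreducible f \<and> tilde q f = f"

definition tilde_M_power :: "nat \<Rightarrow> nat \<Rightarrow> 'a::field poly \<Rightarrow> bool" where
  "tilde_M_power q M f \<longleftrightarrow>
     (\<exists>g. g dvd pcompose f (monom 1 M) \<and> SCIM q g \<and> degree g = degree f)"

definition M_power_poly :: "nat \<Rightarrow> 'a::field poly \<Rightarrow> bool" where
  "M_power_poly M g \<longleftrightarrow>
     (\<exists>h. h dvd pcompose g (monom 1 M) \<and> irreducible h \<and> degree h = degree g)"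

definition N_tilde :: "nat \<Rightarrow> nat \<Rightarrow> nat \<Rightarrow> 'a::{field,finite} itself \<Rightarrow> nat" where
  "N_tilde M q d _ = card {f :: 'a poly. SCIM q f \<and> degree f = d \<and> tilde_M_power q M f}"

definition R_tilde :: "nat \<Rightarrow> nat \<Rightarrow> nat \<Rightarrow> 'a::{field,finite} itself \<Rightarrow> nat" where
  "R_tilde M q d _ = card {{g, tilde q g} | g :: 'a poly.
      monic g \<and> irreducible g \<and> degree g = d \<and> poly g 0 \<noteq> 0 \<and> g \<noteq> tilde q g \<and> M_power_poly M g}"

text \<open>The right-hand side truncated to factors with d \<le> n (factors with d > n are
  1 + O(z^(n+1)) and do not affect the coefficient of z^n).\<close>
definition rhs_trunc :: "nat \<Rightarrow> nat \<Rightarrow> 'a::{field,finite} itself \<Rightarrow> nat \<Rightarrow> real fps" where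
  "rhs_trunc M q T n =
     (\<Prod>d\<in>{d \<in> {1..n}. odd d}.
        (1 + fps_const (1 / (real q ^ d + 1)) * fps_X ^ d) ^ N_tilde M q d T) *
     (\<Prod>d\<in>{1..n}.
        (1 + fps_const (1 / (real q ^ (2*d) - 1)) * fps_X ^ (2*d)) ^ R_tilde M q d T)"

end

theory Submission
  imports Defs "HOL-Algebra.Algebraic_Closure_Type"
begin

text \<open>
  Work over the algebraic closure with the map \<open>\<tau> x = x\<^sup>-\<^sup>q\<close>, whose square is the Frobenius map of
  the field \<open>F\<close> with \<open>q\<^sup>2\<close> elements, and write \<open>S*\<close> for the transpose of \<open>S\<close> with entries raised to
  the power \<open>q\<close>. The root set \<open>R\<close> of a separable unitary matrix is a finite \<open>\<tau>\<close>-stable set.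
  Let \<open>D\<close> be the diagonal matrix of \<open>R\<close> and \<open>\<Gamma>\<close> the permutation matrix of \<open>\<tau>\<close> on \<open>R\<close>. The
  solutions \<open>S\<close> of \<open>S J S* = \<Gamma>\<close> form a torsor under the unitary group, the matrices
  \<open>S\<^sup>-\<^sup>1 D S\<close> are precisely the unitary matrices with root set \<open>R\<close>, and \<open>S\<close> is unique up to
  the finite torus of \<open>\<tau>\<close>-equivariant functions \<open>R \<rightarrow> K\<^sup>*\<close>. So the proportion of
  elements with root set \<open>R\<close> is the reciprocal of the order of that torus, which is multiplicative
  over the \<open>\<tau>\<close>-orbits, an orbit of size \<open>m\<close> contributing \<open>q\<^sup>m + 1\<close> for \<open>m\<close> odd and \<open>q\<^sup>m - 1\<close> for
  \<open>m\<close> even; and such an element is an \<open>M\<close>-th power if and only if the inclusion of \<open>R\<close> is an \<open>M\<close>-th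
  power in the torus. Orbits of odd size are root sets of SCIM polynomials, and orbits of
  even size those of products \<open>g g~\<close>.
\<close>

text \<open>Two existence statements carry the proof. The torsor has to be nonempty: this comes from
  the fact that Hermitian matrices over \<open>F\<close> of any rank have the form Q times
  \<open>star Q\<close>. And every separable unitary matrix needs a diagonalizing \<open>S\<close>
  inside the torsor: an arbitrary eigenbasis is rescaled by Lang's theorem for the torus, which
  comes down to extracting roots in \<open>K\<close>. No conjugacy classes are counted. The torsor
  is counted twice, as a translate of the unitary group and as the set of pairs of a matrix with
  root set \<open>R\<close> and an element of the torus. The orders of the tori come from
  \<open>tau\<close> being the power map with exponent -q: after m steps the exponent is (-q)^m, and
  a fixed value satisfies x^((-q)^m - 1) = 1. The power condition descends to the torus because an
  M-th root of a matrix commutes with it, and the commutant of a matrix with distinct eigenvalues is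
  diagonal in the same frame. Parity decides the type of polynomial: the square of
  \<open>tau\<close> is still transitive on an orbit of odd size, while an orbit of even size falls
  into two halves that \<open>tau\<close> exchanges.\<close>

hide_const (open) Module.smult Polynomials.lead_coeff Divisibility.irreducible Divisibility.prime Coset.order Polynomials.degree
  UnivPoly.monom UnivPoly.coeff

section \<open>Roots of polynomials over an algebraically closed field\<close>

lemma order_ge_2_iff_common_root:
  fixes p :: "'k::field poly"
  assumes "p \<noteq> 0"
  shows "2 \<le> order x p \<longleftrightarrow> poly p x = 0 \<and> poly (pderiv p) x = 0"
proof (cases "poly p x = 0")
  case True
  then obtain r where r: "p = [:-x, 1:] * r"
    by (auto simp: poly_eq_0_iff_dvd)
  have "2 \<le> order x p \<longleftrightarrow> [:-x, 1:] ^ 2 dvd p"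
    using assms by (simp add: order_divides)
  also have "\<dots> \<longleftrightarrow> [:-x, 1:] dvd r"
    unfolding r power2_eq_square by (subst dvd_times_left_cancel_iff) auto
  also have "\<dots> \<longleftrightarrow> poly (pderiv p) x = 0"
    by (simp add: r pderiv_mult pderiv_pCons poly_eq_0_iff_dvd[symmetric] del: mult_pCons_left)
  finally show ?thesis using True by simp
next
  case False
  then show ?thesis by (simp add: order_0I)
qed

text \<open>Over an algebraically closed field the multiplicities add up to the degree and each is
  at least 1, so the number of distinct roots reaches the degree only if all roots are
  simple.\<close>

lemma card_roots_eq_degree_iff:
  fixes p :: "'k::alg_closed_field poly"
  assumes p: "p \<noteq> 0"
  shows "card {x. poly p x = 0} = degree p \<longleftrightarrow>
    (\<forall>x. poly p x = 0 \<longrightarrow> poly (pderiv p) x \<noteq> 0)"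
proof -
  obtain A where A: "size A = degree p" "p = smult (lead_coeff p) (\<Prod>x\<in>#A. [:-x, 1:])"
    using alg_closed_imp_factorization[OF p] by blast
  have "proots (\<Prod>x\<in>#A. [:-x, 1:]) = A"
  proof (induction A)
    case (add x A)
    then show ?case by (subst image_mset_add_mset, subst prod_mset.add_mset, subst proots_mult) (auto simp: prod_mset_zero_iff)
  qed simp
  then have "proots p = A"
    using A(2) p by (metis leading_coeff_0_iff proots_smult)
  then have size: "size (proots p) = degree p" using A by simp
  have set: "set_mset (proots p) = {x. poly p x = 0}" using p by simp
  have sum: "size (proots p) = (\<Sum>x\<in>set_mset (proots p). count (proots p) x)"
    by (simp add: size_multiset_overloaded_eq)
  have pos: "1 \<le> count (proots p) x" if "x \<in># proots p" for x
    using that by (simp add: Suc_le_eq)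
  have "card {x. poly p x = 0} = degree p \<longleftrightarrow>
      (\<Sum>x\<in>set_mset (proots p). 1) = (\<Sum>x\<in>set_mset (proots p). count (proots p) x)"
    using set size sum by simp
  also have "\<dots> \<longleftrightarrow> (\<forall>x\<in>#proots p. count (proots p) x = 1)"
  proof
    assume eq: "(\<Sum>x\<in>set_mset (proots p). 1) = (\<Sum>x\<in>set_mset (proots p). count (proots p) x)"
    show "\<forall>x\<in>#proots p. count (proots p) x = 1"
    proof (rule ccontr)
      assume "\<not> ?thesis"
      then obtain x where x: "x \<in># proots p" "1 < count (proots p) x"
        using pos by (metis le_neq_implies_less)
      have "(\<Sum>x\<in>set_mset (proots p). 1) < (\<Sum>x\<in>set_mset (proots p). count (proots p) x)"
        by (rule sum_strict_mono_ex1) (use x pos in auto)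
      then show False using eq by simp
    qed
  qed simp
  also have "\<dots> \<longleftrightarrow> (\<forall>x. poly p x = 0 \<longrightarrow> poly (pderiv p) x \<noteq> 0)"
  proof -
    have "count (proots p) x = 1 \<longleftrightarrow> poly (pderiv p) x \<noteq> 0" if "poly p x = 0" for x
    proof -
      have "count (proots p) x = order x p" using p by simp
      moreover have "order x p \<noteq> 0" using that p by (simp add: order_root)
      ultimately show ?thesis using order_ge_2_iff_common_root[OF p, of x] that by auto
    qed
    then show ?thesis using set by auto
  qed
  finally show ?thesis .
qed

text \<open>The derivative of X^N - 1 is N X^(N-1), which vanishes at most at 0 since N is nonzero
  in the field; hence all N roots are simple.\<close>

lemma card_roots_of_unity:
  fixes N :: nat
  assumes "of_nat N \<noteq> (0::'k::alg_closed_field)"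
  shows "finite {x::'k. x ^ N = 1}" "card {x::'k. x ^ N = 1} = N"
proof -
  have N: "N > 0" using assms by (cases N) auto
  define p :: "'k poly" where "p = Polynomial.monom 1 N + [:-1:]"
  have deg: "degree p = N"
    unfolding p_def using N by (subst degree_add_eq_left) (auto simp: degree_monom_eq)
  then have p: "p \<noteq> 0" using N by auto
  have roots: "{x. poly p x = 0} = {x::'k. x ^ N = 1}"
    by (auto simp: p_def poly_monom)
  have "poly (pderiv p) x \<noteq> 0" if "poly p x = 0" for x
  proof -
    have "x ^ N = 1" using that by (simp add: p_def poly_monom)
    then have "x \<noteq> 0" using N by (auto simp: zero_power)
    then show ?thesis using assms by (simp add: p_def pderiv_add pderiv_pCons pderiv_monom poly_monom)
  qed
  then have "card {x. poly p x = 0} = degree p"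
    using card_roots_eq_degree_iff[OF p] by blast
  then show "card {x::'k. x ^ N = 1} = N" using roots deg by simp
  show "finite {x::'k. x ^ N = 1}" using poly_roots_finite[OF p] roots by simp
qed

section \<open>The twisted Frobenius map\<close>

text \<open>The field \<open>F\<close> is not a parameter. It reappears as the set of fixed points
  of the q^2-th power map, that is 0 together with \<open>tau_fix 2\<close>, so the counting takes
  place in \<open>K\<close> alone and the given finite field enters only in the final
  translation.\<close>

locale twisted_frobenius =
  fixes q :: nat and K :: "'k::alg_closed_field itself"
  assumes q_ge_2: "2 \<le> q"
    and power_q_add: "\<And>x y :: 'k. (x + y) ^ q = x ^ q + y ^ q"
    and of_nat_q: "of_nat q = (0::'k)"
begin

lemma q_pos: "0 < q" using q_ge_2 by simp

lemma power_q_0 [simp]: "(0::'k) ^ q = 0" using q_pos by simp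

lemma power_q_minus: "(- x :: 'k) ^ q = - (x ^ q)"
  using power_q_add[of x "-x"] by (simp add: eq_neg_iff_add_eq_0 add.commute)

lemma power_q_diff: "(x - y :: 'k) ^ q = x ^ q - y ^ q"
  using power_q_add[of x "-y"] by (simp add: power_q_minus)

lemma power_q_sum: "(\<Sum>i\<in>A. f i :: 'k) ^ q = (\<Sum>i\<in>A. f i ^ q)"
  by (induction A rule: infinite_finite_induct) (auto simp: power_q_add)

lemma power_q_inj: "(x :: 'k) ^ q = y ^ q \<longleftrightarrow> x = y"
  using power_q_diff[of x y] q_pos by auto

lemma power_q_sum_funpow: "(\<Sum>i\<in>A. f i :: 'k) ^ (q ^ m) = (\<Sum>i\<in>A. f i ^ (q ^ m))"
  by (induction m) (auto simp: power_mult power_q_sum mult.commute[of q])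

definition tau :: "'k \<Rightarrow> 'k" where "tau x = inverse (x ^ q)"

lemma tau_0 [simp]: "tau 0 = 0" by (simp add: tau_def)

lemma tau_eq_0_iff [simp]: "tau x = 0 \<longleftrightarrow> x = 0"
  using q_pos by (simp add: tau_def)

lemma tau_mult: "tau (x * y) = tau x * tau y"
  by (simp add: tau_def power_mult_distrib)

lemma tau_power: "tau (x ^ m) = tau x ^ m"
  by (simp add: tau_def power_inverse power_mult[symmetric] mult.commute)

lemma tau_inj: "tau x = tau y \<longleftrightarrow> x = y"
  by (simp add: tau_def power_q_inj)

lemma inj_tau: "inj_on tau A"
  by (auto simp: inj_on_def tau_inj)

lemma tau_tau: "tau (tau x) = x ^ (q ^ 2)"
  by (simp add: tau_def power_inverse power2_eq_square power_mult)

lemma tau_funpow: "(tau ^^ m) x = (if even m then x ^ (q ^ m) else inverse (x ^ (q ^ m)))"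
  by (induction m) (auto simp: tau_def power_inverse power_mult[symmetric] mult.commute)

lemma tau_funpow_power: "(tau ^^ m) (x ^ k) = (tau ^^ m) x ^ k"
  by (induction m) (auto simp: tau_power)

lemma tau_funpow_inj: "(tau ^^ m) x = (tau ^^ m) y \<longleftrightarrow> x = y"
  by (induction m) (auto simp: tau_inj)

lemma tau_funpow_eq_0_iff [simp]: "(tau ^^ m) x = 0 \<longleftrightarrow> x = 0"
  by (induction m) auto

definition tau_fix :: "nat \<Rightarrow> 'k set" where
  "tau_fix m = {x. x \<noteq> 0 \<and> (tau ^^ m) x = x}"

text \<open>This is the absolute value of (-q)^m - 1.\<close>

definition tau_fix_card :: "nat \<Rightarrow> nat" where
  "tau_fix_card m = (if even m then q ^ m - 1 else q ^ m + 1)"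

lemma of_nat_q_power: "m > 0 \<Longrightarrow> of_nat (q ^ m) = (0::'k)"
  by (simp add: of_nat_q zero_power)

lemma tau_fix_eq:
  assumes "m > 0"
  shows "tau_fix m = {x. x ^ tau_fix_card m = 1}"
proof -
  have q1: "1 < q ^ m" using assms q_ge_2 by (intro one_less_power) auto
  have e: "x ^ (q ^ m) = x \<longleftrightarrow> x ^ (q ^ m - 1) = 1" if "x \<noteq> 0" for x :: 'k
  proof -
    have "x ^ (q ^ m) = x ^ (q ^ m - 1) * x"
      using power_minus_mult[of "q ^ m" x] q1 q_pos by simp
    then show ?thesis using that by simp
  qed
  have o: "inverse (x ^ (q ^ m)) = x \<longleftrightarrow> x ^ (q ^ m + 1) = 1" if "x \<noteq> 0" for x :: 'k
    using that by (auto simp: field_simps)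
  have nz: "x \<noteq> 0" if "x ^ tau_fix_card m = 1" for x :: 'k
    using that q1 by (auto simp: tau_fix_card_def zero_power split: if_splits)
  show ?thesis
  proof (rule Set.set_eqI)
    fix x
    show "x \<in> tau_fix m \<longleftrightarrow> x \<in> {x. x ^ tau_fix_card m = 1}"
      using e[of x] o[of x] nz[of x]
      by (cases "x = 0") (auto simp: tau_fix_def tau_funpow tau_fix_card_def)
  qed
qed

text \<open>As q^m vanishes in \<open>K\<close>, the number is 1 or -1 there, so the count of roots
  of unity applies to it.\<close>

lemma of_nat_tau_fix_card: "m > 0 \<Longrightarrow> of_nat (tau_fix_card m) \<noteq> (0::'k)"
  using of_nat_q_power[of m] q_pos
  by (auto simp: tau_fix_card_def of_nat_diff zero_power)

lemma finite_tau_fix: "m > 0 \<Longrightarrow> finite (tau_fix m)"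
  and card_tau_fix: "m > 0 \<Longrightarrow> card (tau_fix m) = tau_fix_card m"
  using card_roots_of_unity[OF of_nat_tau_fix_card] by (simp_all add: tau_fix_eq)

end

context twisted_frobenius begin

section \<open>Orbits of the twisted Frobenius map\<close>

text \<open>Only forward iterates are taken, and a general \<open>K\<close> may have infinite
  orbits. A finite one is a full cycle because \<open>tau\<close> is injective.\<close>

definition orb :: "'k \<Rightarrow> 'k set" where
  "orb w = range (\<lambda>k. (tau ^^ k) w)"

lemma orb_refl [simp]: "w \<in> orb w"
  unfolding orb_def by (rule range_eqI[of _ _ 0]) simp

lemma funpow_in_orb [simp]: "(tau ^^ k) w \<in> orb w"
  by (simp add: orb_def)

lemma tau_in_orb: "v \<in> orb w \<Longrightarrow> tau v \<in> orb w"
  unfolding orb_def by (metis (mono_tags, lifting) funpow.simps(2) o_apply rangeE rangeI)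

text \<open>Injectivity shifts any repetition back to \<open>w\<close>, so a finite orbit is a pure
  cycle and its least return time is its cardinality.\<close>

lemma orb_period:
  assumes "finite (orb w)"
  shows "0 < card (orb w)" "(tau ^^ k) w = (tau ^^ l) w \<longleftrightarrow> k mod card (orb w) = l mod card (orb w)"
proof -
  show pos: "0 < card (orb w)"
    using assms orb_refl[of w] by (metis card_gt_0_iff empty_iff)
  have "\<not> inj (\<lambda>k. (tau ^^ k) w)"
    using assms finite_imageD[of "\<lambda>k. (tau ^^ k) w" UNIV] by (auto simp: orb_def)
  then obtain i j where ij: "i < j" "(tau ^^ i) w = (tau ^^ j) w"
    unfolding inj_def by (metis linorder_neqE_nat)
  have "(tau ^^ i) ((tau ^^ (j - i)) w) = (tau ^^ i) w"
    using ij by (metis (no_types, lifting) add_diff_inverse_nat funpow_add less_imp_le not_less o_apply)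
  then have ex: "\<exists>m. 0 < m \<and> (tau ^^ m) w = w"
    using ij(1) tau_funpow_inj[of i] by (intro exI[of _ "j - i"]) simp
  define m where "m = (LEAST m. 0 < m \<and> (tau ^^ m) w = w)"
  have m: "0 < m" "(tau ^^ m) w = w"
    using LeastI_ex[OF ex] by (auto simp: m_def)
  have min: "k = 0" if "k < m" "(tau ^^ k) w = w" for k
    using that not_less_Least[of k "\<lambda>m. 0 < m \<and> (tau ^^ m) w = w"] by (auto simp: m_def)
  have modm: "(tau ^^ (k mod m)) w = (tau ^^ k) w" for k
    using funpow_mod_eq[OF m(2)] .
  have iff: "(tau ^^ k) w = (tau ^^ l) w \<longleftrightarrow> k mod m = l mod m" for k l
  proof -
    have aux: "k = l" if "k \<le> l" "l < m" "(tau ^^ k) w = (tau ^^ l) w" for k l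
    proof -
      have "(tau ^^ k) ((tau ^^ (l - k)) w) = (tau ^^ k) w"
        using that by (metis (no_types, lifting) funpow_add le_add_diff_inverse o_apply)
      then have "(tau ^^ (l - k)) w = w" using tau_funpow_inj by blast
      moreover have "l - k < m" using that by simp
      ultimately have "l - k = 0" using min by blast
      then show ?thesis using that by simp
    qed
    have "(tau ^^ (k mod m)) w = (tau ^^ (l mod m)) w \<longleftrightarrow> k mod m = l mod m"
      using aux[of "k mod m" "l mod m"] aux[of "l mod m" "k mod m"] m(1)
      by (metis mod_less_divisor nle_le)
    then show ?thesis by (simp add: modm)
  qed
  have "orb w = (\<lambda>k. (tau ^^ k) w) ` {..<m}"
  proof (intro equalityI subsetI)
    fix v assume "v \<in> orb w"
    then obtain k where "v = (tau ^^ (k mod m)) w" unfolding orb_def by (auto simp: modm)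
    then show "v \<in> (\<lambda>k. (tau ^^ k) w) ` {..<m}" using m(1) by (intro image_eqI[of _ _ "k mod m"]) auto
  qed auto
  moreover have "inj_on (\<lambda>k. (tau ^^ k) w) {..<m}"
    by (auto simp: inj_on_def iff)
  ultimately have "card (orb w) = m" by (simp add: card_image)
  then show "(tau ^^ k) w = (tau ^^ l) w \<longleftrightarrow> k mod card (orb w) = l mod card (orb w)"
    using iff by simp
qed

lemma funpow_card_orb: "finite (orb w) \<Longrightarrow> (tau ^^ card (orb w)) w = w"
  using orb_period(2)[of w "card (orb w)" 0] by simp

lemma funpow_eq_self_iff:
  "finite (orb w) \<Longrightarrow> (tau ^^ k) w = w \<longleftrightarrow> card (orb w) dvd k"
  using orb_period(2)[of w k 0] by (auto simp: dvd_eq_mod_eq_0)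

lemma finite_orbI:
  assumes "0 < m" "(tau ^^ m) w = w" shows "finite (orb w)"
proof -
  have "orb w \<subseteq> (\<lambda>k. (tau ^^ k) w) ` {..<m}"
  proof
    fix v assume "v \<in> orb w"
    then obtain k where "v = (tau ^^ (k mod m)) w"
      unfolding orb_def using funpow_mod_eq[OF assms(2)] by auto
    then show "v \<in> (\<lambda>k. (tau ^^ k) w) ` {..<m}" using assms(1) by (intro image_eqI[of _ _ "k mod m"]) auto
  qed
  then show ?thesis by (rule finite_subset) simp
qed

lemma orb_eqI:
  assumes "finite (orb w)" "v \<in> orb w"
  shows "orb v = orb w"
proof -
  have sub: "orb y \<subseteq> orb x" if yx: "y \<in> orb x" for x y
  proof
    fix v assume "v \<in> orb y"
    then obtain j where j: "v = (tau ^^ j) y" by (auto simp: orb_def)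
    obtain k where "y = (tau ^^ k) x" using yx by (auto simp: orb_def)
    then have "v = (tau ^^ (j + k)) x" using j by (simp add: funpow_add)
    then show "v \<in> orb x" by simp
  qed
  obtain k where k: "v = (tau ^^ k) w" using assms by (auto simp: orb_def)
  let ?m = "card (orb w)"
  \<comment> \<open>Continuing from k to the multiple \<open>k * ?m\<close> of the period leads back
    to \<open>w\<close>; this replaces the inverse of \<open>tau ^^ k\<close>.\<close>
  have "(tau ^^ (k * ?m - k)) v = (tau ^^ (k * ?m)) w"
  proof -
    have "k \<le> k * ?m" using orb_period(1)[OF assms(1)] by simp
    then show ?thesis unfolding k by (metis (no_types, lifting) funpow_add le_add_diff_inverse2 o_apply)
  qed
  also have "\<dots> = w" using funpow_eq_self_iff[OF assms(1), of "k * ?m"] by simp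
  finally have "w \<in> orb v" by (metis funpow_in_orb)
  then show ?thesis using sub[of w v] sub[of v w] assms by blast
qed

text \<open>Functions on a finite orbit are built from periodic sequences. The value is read off at
  the least index that reaches the point, and periodicity makes any other index agree.\<close>

lemma function_on_orb:
  assumes "finite (orb w)" "\<And>k. x (k + card (orb w)) = x k"
  obtains e where "\<And>k. e ((tau ^^ k) w) = x k"
proof
  let ?m = "card (orb w)"
  define e where "e v = x (LEAST k. (tau ^^ k) w = v)" for v
  have per: "x (k + j * ?m) = x k" for k j
  proof (induction j)
    case (Suc j)
    then show ?case using assms(2)[of "k + j * ?m"] by (simp add: ac_simps)
  qed simp
  have modx: "x k = x (k mod ?m)" for k
    using per[of "k mod ?m" "k div ?m"] by simp
  show "e ((tau ^^ k) w) = x k" for k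
  proof -
    let ?l = "LEAST l. (tau ^^ l) w = (tau ^^ k) w"
    have "(tau ^^ ?l) w = (tau ^^ k) w" by (rule LeastI[of _ k]) simp
    then have "?l mod ?m = k mod ?m" using orb_period(2)[OF assms(1)] by blast
    then show ?thesis unfolding e_def using modx[of ?l] modx[of k] by simp
  qed
qed

definition tau_stable :: "'k set \<Rightarrow> bool" where
  "tau_stable R \<longleftrightarrow> finite R \<and> 0 \<notin> R \<and> tau ` R = R"

lemma tau_stableI:
  assumes "finite R" "0 \<notin> R" "\<And>w. w \<in> R \<Longrightarrow> tau w \<in> R"
  shows "tau_stable R"
  using assms endo_inj_surj[of R tau] inj_tau by (auto simp: tau_stable_def)

lemma tau_stable_funpow: "tau_stable R \<Longrightarrow> w \<in> R \<Longrightarrow> (tau ^^ k) w \<in> R"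
  by (induction k) (auto simp: tau_stable_def)

lemma tau_stable_orb_subset: "tau_stable R \<Longrightarrow> w \<in> R \<Longrightarrow> orb w \<subseteq> R"
  using tau_stable_funpow by (auto simp: orb_def)

lemma tau_stable_finite_orb: "tau_stable R \<Longrightarrow> w \<in> R \<Longrightarrow> finite (orb w)"
  using tau_stable_orb_subset finite_subset by (fastforce simp: tau_stable_def)

lemma tau_stable_orb:
  assumes "finite (orb w)" "w \<noteq> 0" shows "tau_stable (orb w)"
proof (rule tau_stableI)
  show "0 \<notin> orb w" using assms(2) by (auto simp: orb_def)
qed (use assms tau_in_orb in auto)

text \<open>The finite torus of the overview. Functions are taken in \<open>extensional R\<close> so
  that each counts once and the cardinality is the order of the torus.\<close>

definition equivariant :: "'k set \<Rightarrow> ('k \<Rightarrow> 'k) set" where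
  "equivariant R = {e \<in> extensional R. \<forall>w\<in>R. e w \<noteq> 0 \<and> e (tau w) = tau (e w)}"

lemma equivariant_funpow:
  assumes "e \<in> equivariant R" "tau_stable R" "w \<in> R"
  shows "e ((tau ^^ k) w) = (tau ^^ k) (e w)"
  using assms(1) tau_stable_funpow[OF assms(2,3)]
  by (induction k) (auto simp: equivariant_def)

text \<open>The value at \<open>w\<close> determines the function along the whole orbit; the only
  constraint is that it returns to itself after one full turn.\<close>

lemma bij_equivariant_orb:
  assumes "finite (orb w)" "w \<noteq> 0"
  shows "bij_betw (\<lambda>e. e w) (equivariant (orb w)) (tau_fix (card (orb w)))"
proof (rule bij_betwI')
  note st = tau_stable_orb[OF assms]
  fix e e' assume e: "e \<in> equivariant (orb w)" "e' \<in> equivariant (orb w)"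
  show "e w = e' w \<longleftrightarrow> e = e'"
  proof
    assume "e w = e' w"
    then have "e ((tau ^^ k) w) = e' ((tau ^^ k) w)" for k
      using equivariant_funpow[OF e(1) st orb_refl] equivariant_funpow[OF e(2) st orb_refl] by simp
    then have "e v = e' v" if "v \<in> orb w" for v
      using that by (auto simp: orb_def)
    then show "e = e'" using e by (intro extensionalityI[of _ "orb w"]) (auto simp: equivariant_def)
  qed simp
next
  note st = tau_stable_orb[OF assms]
  fix e assume e: "e \<in> equivariant (orb w)"
  show "e w \<in> tau_fix (card (orb w))"
    using equivariant_funpow[OF e st orb_refl, of "card (orb w)"] funpow_card_orb[OF assms(1)] e
    by (auto simp: tau_fix_def equivariant_def)
next
  fix x assume x: "x \<in> tau_fix (card (orb w))"
  have "(tau ^^ (k + card (orb w))) x = (tau ^^ k) x" for k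
    using x by (simp add: funpow_add tau_fix_def)
  then obtain e where e: "\<And>k. e ((tau ^^ k) w) = (tau ^^ k) x"
    by (rule function_on_orb[OF assms(1), where x = "\<lambda>k. (tau ^^ k) x"]) (rule that)
  have "e (tau v) = tau (e v)" "e v \<noteq> 0" if v: "v \<in> orb w" for v
  proof -
    obtain k where v: "v = (tau ^^ k) w" using v by (auto simp: orb_def)
    show "e (tau v) = tau (e v)" using e[of k] e[of "Suc k"] by (simp add: v)
    show "e v \<noteq> 0" using x by (simp add: v e tau_fix_def)
  qed
  then have "restrict e (orb w) \<in> equivariant (orb w)"
    using tau_in_orb by (auto simp: equivariant_def)
  moreover have "x = restrict e (orb w) w" using e[of 0] by simp
  ultimately show "\<exists>e\<in>equivariant (orb w). x = e w" by blast
qed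

lemma card_equivariant_orb:
  assumes "finite (orb w)" "w \<noteq> 0"
  shows "card (equivariant (orb w)) = tau_fix_card (card (orb w))"
  using bij_betw_same_card[OF bij_equivariant_orb[OF assms]] card_tau_fix orb_period(1)[OF assms(1)]
  by simp

text \<open>The recursion x(k+1) = tau(x k) / c(k+1) is solved by a k times
  \<open>(tau ^^ k) y\<close>, where \<open>a\<close> is the solution starting at 1. Periodicity is
  the single equation a m times \<open>(tau ^^ m) y\<close> = y, which is y^(q^m - 1) = 1 / a m for
  even m and y^(q^m + 1) = a m for odd m.\<close>

lemma lang_funpow:
  assumes "0 < m" "\<And>k. c k \<noteq> 0" "\<And>k. c (k + m) = c k"
  obtains x :: "nat \<Rightarrow> 'k" where "\<And>k. x k \<noteq> 0" "\<And>k. x (Suc k) * c (Suc k) * x k ^ q = 1" "\<And>k. x (k + m) = x k"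
proof -
  define a where "a = rec_nat 1 (\<lambda>k y. tau y / c (Suc k))"
  have a: "a 0 = 1" "\<And>k. a (Suc k) = tau (a k) / c (Suc k)" by (auto simp: a_def)
  have a0: "a k \<noteq> 0" for k using assms(2) by (induction k) (auto simp: a)
  have "\<exists>y. y \<noteq> 0 \<and> a m * (tau ^^ m) y = y"
  proof (cases "even m")
    case True
    have pos: "0 < q ^ m - 1" using assms(1) q_ge_2 one_less_power[of q m] by simp
    then obtain y :: 'k where y: "y ^ (q ^ m - 1) = inverse (a m)" using nth_root_exists by blast
    then have "y \<noteq> 0" using a0[of m] pos by (auto simp: zero_power)
    moreover have "(tau ^^ m) y = y ^ (q ^ m - 1) * y"
      using True pos q_pos power_minus_mult[of "q ^ m" y] by (simp add: tau_funpow)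
    ultimately show ?thesis using y a0[of m] by (intro exI[of _ y]) auto
  next
    case False
    obtain y :: 'k where y: "y ^ (q ^ m + 1) = a m" using nth_root_exists[of "q ^ m + 1"] by auto
    then have "y \<noteq> 0" using a0[of m] by auto
    then show ?thesis using y False by (intro exI[of _ y]) (auto simp: tau_funpow field_simps)
  qed
  then obtain y where y: "y \<noteq> 0" "a m * (tau ^^ m) y = y" by blast
  define x where "x k = a k * (tau ^^ k) y" for k
  have x0: "x k \<noteq> 0" for k using a0 y by (simp add: x_def)
  have step: "x (Suc k) = tau (x k) / c (Suc k)" for k by (simp add: x_def a tau_mult)
  have "x (Suc k) * c (Suc k) * x k ^ q = 1" for k
    using assms(2)[of "Suc k"] x0[of k] by (simp add: step tau_def)
  moreover have "x (k + m) = x k" for k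
  proof (induction k)
    case 0 then show ?case using y by (simp add: x_def a)
  next
    case (Suc k) then show ?case using assms(3)[of "Suc k"] by (simp add: step)
  qed
  ultimately show ?thesis using that x0 by blast
qed

text \<open>Lang's theorem for the torus of nowhere vanishing functions on a stable set.\<close>
lemma lang_torus:
  assumes R: "tau_stable R" and c: "\<And>w. w \<in> R \<Longrightarrow> c w \<noteq> 0"
  obtains e :: "'k \<Rightarrow> 'k" where "\<And>w. w \<in> R \<Longrightarrow> e w \<noteq> 0" "\<And>w. w \<in> R \<Longrightarrow> e (tau w) * c (tau w) * e w ^ q = 1"
proof -
  have ex: "\<exists>e. \<forall>v\<in>orb w. e v \<noteq> 0 \<and> e (tau v) * c (tau v) * e v ^ q = 1" if w: "w \<in> R" for w
  proof -
    note fin = tau_stable_finite_orb[OF R w]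
    have per: "c ((tau ^^ (k + card (orb w))) w) = c ((tau ^^ k) w)" for k
      by (simp add: funpow_add funpow_card_orb[OF fin])
    have nz: "c ((tau ^^ k) w) \<noteq> 0" for k
      by (rule c[OF tau_stable_funpow[OF R w]])
    obtain x where x: "\<And>k. x k \<noteq> 0" "\<And>k. x (Suc k) * c ((tau ^^ Suc k) w) * x k ^ q = 1"
      "\<And>k. x (k + card (orb w)) = x k"
      by (rule lang_funpow[of "card (orb w)" "\<lambda>k. c ((tau ^^ k) w)", OF orb_period(1)[OF fin] nz per]) (rule that)
    obtain e where e: "\<And>k. e ((tau ^^ k) w) = x k"
      by (rule function_on_orb[where x = x, OF fin x(3)]) (rule that)
    have "e v \<noteq> 0 \<and> e (tau v) * c (tau v) * e v ^ q = 1" if v: "v \<in> orb w" for v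
    proof -
      obtain k where v: "v = (tau ^^ k) w" using v by (auto simp: orb_def)
      show ?thesis using e[of k] e[of "Suc k"] x(1)[of k] x(2)[of k] by (simp add: v)
    qed
    then show ?thesis by blast
  qed
  \<comment> \<open>The choice depends on the orbit as a set, so \<open>w\<close> and
    \<open>tau w\<close> consult the same function.\<close>
  define E where "E Q = (SOME e. \<forall>v\<in>Q. e v \<noteq> 0 \<and> e (tau v) * c (tau v) * e v ^ q = 1)" for Q
  have E: "\<forall>v\<in>orb w. E (orb w) v \<noteq> 0 \<and> E (orb w) (tau v) * c (tau v) * E (orb w) v ^ q = 1" if "w \<in> R" for w
    unfolding E_def by (rule someI_ex[OF ex[OF that]])
  define e where "e w = E (orb w) w" for w
  have orbt: "orb (tau w) = orb w" if "w \<in> R" for w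
    by (rule orb_eqI[OF tau_stable_finite_orb[OF R that] tau_in_orb[OF orb_refl]])
  show ?thesis
  proof (rule that[of e])
    fix w assume w: "w \<in> R"
    have "w \<in> orb w" by simp
    then have "E (orb w) w \<noteq> 0 \<and> E (orb w) (tau w) * c (tau w) * E (orb w) w ^ q = 1"
      using E[OF w] by blast
    then show "e w \<noteq> 0" "e (tau w) * c (tau w) * e w ^ q = 1"
      by (simp_all add: e_def orbt[OF w])
  qed
qed

end

section \<open>Hermitian matrices and the unitary group over the algebraic closure\<close>

lemma mult_mat_index:
  assumes "A \<in> carrier_mat n m" "B \<in> carrier_mat m k" "i < n" "j < k"
  shows "(A * B) $$ (i, j) = (\<Sum>l<m. A $$ (i, l) * B $$ (l, j))"
  using assms by (auto simp: scalar_prod_def lessThan_atLeast0 intro!: sum.cong)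

lemma mult_mat_cancel:
  fixes A :: "'a::semiring_1 mat"
  assumes "A * B = 1\<^sub>m n" "A \<in> carrier_mat n n" "B \<in> carrier_mat n n" "Y \<in> carrier_mat n n"
  shows "A * (B * Y) = Y"
  using assoc_mult_mat[OF assms(2,3,4)] left_mult_one_mat[OF assms(4)] assms(1) by simp

lemma mult_carrier_sq:
  "A \<in> carrier_mat n n \<Longrightarrow> B \<in> carrier_mat n n \<Longrightarrow> A * B \<in> carrier_mat n n"
  by simp

text \<open>The library rule leaves the inner dimension open, which defeats conditional rewriting.\<close>
declare mult_carrier_mat [simp del] mult_carrier_sq [simp]

lemma antidiag_carrier [simp]: "antidiag n \<in> carrier_mat n n"
  by (simp add: antidiag_def)

lemma antidiag_dim [simp]: "dim_row (antidiag n) = n" "dim_col (antidiag n) = n"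
  by (simp_all add: antidiag_def)

lemma antidiag_square: "antidiag n * antidiag n = (1\<^sub>m n :: 'a::field mat)"
proof (rule eq_matI)
  fix i j assume "i < dim_row (1\<^sub>m n :: 'a mat)" "j < dim_col (1\<^sub>m n :: 'a mat)"
  then have ij: "i < n" "j < n" by auto
  have "(antidiag n * antidiag n) $$ (i, j) = (\<Sum>l<n. (if l = n - 1 - i then if l + j = n - 1 then 1 else 0 else (0::'a)))"
    unfolding mult_mat_index[OF antidiag_carrier antidiag_carrier ij]
    by (rule sum.cong[OF refl]) (use ij in \<open>auto simp: antidiag_def\<close>)
  also have "\<dots> = 1\<^sub>m n $$ (i, j)" using ij by auto
  finally show "(antidiag n * antidiag n) $$ (i, j) = (1\<^sub>m n :: 'a mat) $$ (i, j)" .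
qed (auto simp: antidiag_def)

section \<open>Diagonal matrices and roots of characteristic polynomials\<close>

definition diagm :: "nat \<Rightarrow> (nat \<Rightarrow> 'a::zero) \<Rightarrow> 'a mat" where
  "diagm n f = mat n n (\<lambda>(i, j). if i = j then f i else 0)"

lemma diagm_carrier [simp]: "diagm n f \<in> carrier_mat n n"
  by (simp add: diagm_def)

lemma diagm_mult_index:
  fixes Y :: "'a::semiring_1 mat"
  assumes "Y \<in> carrier_mat n n" "i < n" "j < n"
  shows "(diagm n f * Y) $$ (i, j) = f i * Y $$ (i, j)" "(Y * diagm n f) $$ (i, j) = Y $$ (i, j) * f j"
proof -
  have "(diagm n f * Y) $$ (i, j) = (\<Sum>l<n. if l = i then f i * Y $$ (i, j) else 0)"
    unfolding mult_mat_index[OF diagm_carrier assms]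
    by (rule sum.cong[OF refl]) (use assms in \<open>auto simp: diagm_def\<close>)
  then show "(diagm n f * Y) $$ (i, j) = f i * Y $$ (i, j)" using assms by simp
  have "(Y * diagm n f) $$ (i, j) = (\<Sum>l<n. if l = j then Y $$ (i, j) * f j else 0)"
    unfolding mult_mat_index[OF assms(1) diagm_carrier assms(2,3)]
    by (rule sum.cong[OF refl]) (use assms in \<open>auto simp: diagm_def\<close>)
  then show "(Y * diagm n f) $$ (i, j) = Y $$ (i, j) * f j" using assms by simp
qed

lemma diagm_mult:
  fixes f g :: "nat \<Rightarrow> 'a::semiring_1"
  shows "diagm n f * diagm n g = diagm n (\<lambda>i. f i * g i)"
proof (rule eq_matI)
  fix i j assume "i < dim_row (diagm n (\<lambda>i. f i * g i))" "j < dim_col (diagm n (\<lambda>i. f i * g i))"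
  then have ij: "i < n" "j < n" by (auto simp: diagm_def)
  show "(diagm n f * diagm n g) $$ (i, j) = diagm n (\<lambda>i. f i * g i) $$ (i, j)"
    unfolding diagm_mult_index(1)[OF diagm_carrier ij] using ij by (auto simp: diagm_def)
qed (auto simp: diagm_def)

lemma diagm_cong: "(\<And>i. i < n \<Longrightarrow> f i = g i) \<Longrightarrow> diagm n f = diagm n g"
  by (auto simp: diagm_def)

lemma diagm_eq_iff: "diagm n f = diagm n g \<longleftrightarrow> (\<forall>i<n. f i = g i)"
proof
  assume eq: "diagm n f = diagm n g"
  show "\<forall>i<n. f i = g i"
  proof (intro allI impI)
    fix i assume "i < n"
    then show "f i = g i" using arg_cong[OF eq, of "\<lambda>Y. Y $$ (i, i)"] by (simp add: diagm_def)
  qed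
qed (rule diagm_cong, simp)

lemma diagm_pow:
  fixes f :: "nat \<Rightarrow> 'a::semiring_1"
  shows "diagm n f ^\<^sub>m m = diagm n (\<lambda>i. f i ^ m)"
proof (induction m)
  case 0
  show ?case by (rule eq_matI) (auto simp: diagm_def)
next
  case (Suc m)
  then show ?case by (simp add: diagm_mult power_commutes)
qed

text \<open>Comparing the (i, j) entries gives (z j - z i) times the entry of \<open>C\<close> equal
  to 0.\<close>

lemma commutes_diagm:
  fixes z :: "nat \<Rightarrow> 'a::field"
  assumes "inj_on z {..<n}" "C \<in> carrier_mat n n" "C * diagm n z = diagm n z * C"
  shows "C = diagm n (\<lambda>i. C $$ (i, i))"
proof (rule eq_matI)
  fix i j assume "i < dim_row (diagm n (\<lambda>i. C $$ (i, i)))" "j < dim_col (diagm n (\<lambda>i. C $$ (i, i)))"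
  then have ij: "i < n" "j < n" by (auto simp: diagm_def)
  have "C $$ (i, j) * z j = z i * C $$ (i, j)"
    using arg_cong[OF assms(3), of "\<lambda>Y. Y $$ (i, j)"] diagm_mult_index[OF assms(2) ij, of z] by simp
  then have "C $$ (i, j) = 0 \<or> z i = z j" by (auto simp: mult.commute)
  then show "C $$ (i, j) = diagm n (\<lambda>i. C $$ (i, i)) $$ (i, j)"
    using ij assms(1) by (auto simp: diagm_def inj_on_def)
qed (use assms in \<open>auto simp: diagm_def\<close>)

definition mat_roots :: "'a::field mat \<Rightarrow> 'a set" where
  "mat_roots g = {x. poly (char_poly g) x = 0}"

lemma mat_roots_diagm:
  fixes z :: "nat \<Rightarrow> 'a::field"
  shows "mat_roots (diagm n z) = z ` {..<n}"
proof -
  have "upper_triangular (diagm n z)" by (auto simp: diagm_def)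
  moreover have "diag_mat (diagm n z) = map z [0..<n]"
    by (auto simp: diag_mat_def diagm_def)
  ultimately have "char_poly (diagm n z) = (\<Prod>a\<leftarrow>map z [0..<n]. [:- a, 1:])"
    using char_poly_upper_triangular[of "diagm n z" n] by simp
  then have "poly (char_poly (diagm n z)) x = 0 \<longleftrightarrow> x \<in> z ` {..<n}" for x
    by (auto simp: poly_prod_list prod_list_zero_iff)
  then show ?thesis by (auto simp: mat_roots_def)
qed

lemma mat_roots_conj:
  fixes g D :: "'a::field mat"
  assumes "S * g = D * S" "T * S = 1\<^sub>m n" "S * T = 1\<^sub>m n"
    "S \<in> carrier_mat n n" "T \<in> carrier_mat n n" "g \<in> carrier_mat n n" "D \<in> carrier_mat n n"
  shows "mat_roots g = mat_roots D"
proof -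
  have "g = T * (S * g)" by (rule mult_mat_cancel[symmetric, OF assms(2,5,4,6)])
  also have "\<dots> = T * D * S" using assms by (simp add: assms(1))
  finally have "similar_mat g D"
    unfolding similar_mat_def similar_mat_wit_def using assms by (intro exI[of _ T] exI[of _ S]) (auto simp: Let_def)
  then show ?thesis by (simp add: mat_roots_def char_poly_similar)
qed

section \<open>The operation \<open>star\<close> and the unitary group\<close>

context twisted_frobenius begin

sublocale frq: field_hom "\<lambda>x::'k. x ^ q"
  by unfold_locales (auto simp: power_mult_distrib power_q_add)

text \<open>Over \<open>K\<close> this is not an involution: applied twice it raises every entry to
  the power q^2, so it is involutive exactly on matrices with entries in \<open>F\<close>.\<close>

definition star :: "'k mat \<Rightarrow> 'k mat" where
  "star Y = transpose_mat (map_mat (\<lambda>x. x ^ q) Y)"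

lemma star_carrier [simp]: "Y \<in> carrier_mat m n \<Longrightarrow> star Y \<in> carrier_mat n m"
  by (auto simp: star_def)

lemma star_index [simp]: "Y \<in> carrier_mat m n \<Longrightarrow> i < n \<Longrightarrow> j < m \<Longrightarrow> star Y $$ (i, j) = Y $$ (j, i) ^ q"
  by (auto simp: star_def)

lemma star_mult:
  "A \<in> carrier_mat m k \<Longrightarrow> B \<in> carrier_mat k n \<Longrightarrow> star (A * B) = star B * star A"
  by (simp add: star_def frq.mat_hom_mult transpose_mult[of _ m k _ n])

lemma star_mult_sq:
  "A \<in> carrier_mat n n \<Longrightarrow> B \<in> carrier_mat n n \<Longrightarrow> star (A * B) = star B * star A"
  by (rule star_mult)

lemma star_one [simp]: "star (1\<^sub>m n) = 1\<^sub>m n"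
  by (rule eq_matI) (auto simp: star_def)

lemma star_antidiag [simp]: "star (antidiag n) = antidiag n"
  by (rule eq_matI) (auto simp: star_def antidiag_def add.commute)

lemma star_star_index:
  assumes "Y \<in> carrier_mat m n" "i < m" "j < n"
  shows "star (star Y) $$ (i, j) = Y $$ (i, j) ^ (q ^ 2)"
  using assms star_index[OF star_carrier[OF assms(1)]]
  by (simp add: power2_eq_square power_mult)

text \<open>The entries are arbitrary elements of \<open>K\<close>; the equation itself confines
  them to \<open>F\<close>, see \<open>unit_grp_entry\<close>.\<close>

definition unit_grp :: "nat \<Rightarrow> 'k mat set" where
  "unit_grp n = {g \<in> carrier_mat n n. g * antidiag n * star g = antidiag n}"

lemma unit_grp_carrier: "g \<in> unit_grp n \<Longrightarrow> g \<in> carrier_mat n n"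
  by (simp add: unit_grp_def)

lemma unit_grp_one: "1\<^sub>m n \<in> unit_grp n"
  by (simp add: unit_grp_def right_mult_one_mat[of _ n n] left_mult_one_mat[of _ n n])

lemma unit_grp_inverse:
  assumes "g \<in> unit_grp n"
  shows "g * (antidiag n * star g * antidiag n) = 1\<^sub>m n" "antidiag n * star g * antidiag n * g = 1\<^sub>m n"
proof -
  have g: "g \<in> carrier_mat n n" using assms by (rule unit_grp_carrier)
  have "g * (antidiag n * star g * antidiag n) = (g * antidiag n * star g) * antidiag n"
    using g by (simp add: assoc_mult_mat[of _ n n _ n _ n])
  then show *: "g * (antidiag n * star g * antidiag n) = 1\<^sub>m n"
    using assms by (simp add: unit_grp_def antidiag_square)
  show "antidiag n * star g * antidiag n * g = 1\<^sub>m n"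
    by (rule mat_mult_left_right_inverse[OF g _ *]) (use g in simp)
qed

text \<open>Applying \<open>star\<close> to \<open>g J g* = J\<close> and comparing shows that the entries of \<open>g\<close> lie in the field with \<open>q\<^sup>2\<close> elements.\<close>
lemma unit_grp_star_star:
  assumes "g \<in> unit_grp n" shows "star (star g) = g"
proof -
  note inv = unit_grp_inverse[OF assms]
  have g: "g \<in> carrier_mat n n" using assms by (rule unit_grp_carrier)
  let ?J = "antidiag n" and ?h = "antidiag n * star g * antidiag n"
  have h: "?h \<in> carrier_mat n n" using g by simp
  have hs: "star ?h = ?J * star (star g) * ?J"
    using g by (simp add: star_mult_sq[of _ n] assoc_mult_mat[of _ n n _ n _ n])
  have "g * ?J * star g = ?J" using assms by (simp add: unit_grp_def)
  from arg_cong[OF this, of star] have e: "star (star g) * (?J * star g) = ?J"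
    using g by (simp add: star_mult_sq[of _ n] assoc_mult_mat[of _ n n _ n _ n])
  have "star (star g) * ?h = (star (star g) * (?J * star g)) * ?J"
    using g by (simp add: assoc_mult_mat[of _ n n _ n _ n])
  then have e': "star (star g) * ?h = 1\<^sub>m n" by (simp only: e antidiag_square)
  have "star (star g) * (?h * g) = (star (star g) * ?h) * g"
    using g h by (simp add: assoc_mult_mat[of _ n n _ n _ n] del: mult_carrier_mat)
  then show ?thesis unfolding e' inv using g by (simp add: right_mult_one_mat[of _ n n])
qed

lemma unit_grp_entry:
  "g \<in> unit_grp n \<Longrightarrow> i < n \<Longrightarrow> j < n \<Longrightarrow> (g $$ (i, j)) ^ (q ^ 2) = g $$ (i, j)"
  using star_star_index[of g n n i j] unit_grp_star_star[of g n] unit_grp_carrier[of g n] by simp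

text \<open>The inverse of \<open>g\<close> is conjugate under \<open>antidiag n\<close> to
  \<open>star g\<close>, so 1/x is an eigenvalue of the matrix of q-th powers of the entries of
  \<open>g\<close>. Raising to the q-th power once more gives \<open>tau x\<close> as a root of the
  characteristic polynomial of \<open>star (star g)\<close>, which is that of
  \<open>g\<close>.\<close>

lemma mat_roots_unit_grp_tau:
  assumes g: "g \<in> unit_grp n" and x: "x \<in> mat_roots g"
  shows "x \<noteq> 0" "tau x \<in> mat_roots g"
proof -
  have gc: "g \<in> carrier_mat n n" using g by (rule unit_grp_carrier)
  let ?J = "antidiag n :: 'k mat" and ?h = "antidiag n * star g * antidiag n"
  obtain v where v: "v \<in> carrier_vec n" "v \<noteq> 0\<^sub>v n" "g *\<^sub>v v = x \<cdot>\<^sub>v v"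
    using x gc eigenvalue_root_char_poly[OF gc, of x] by (auto simp: mat_roots_def eigenvalue_def eigenvector_def)
  have hv: "v = x \<cdot>\<^sub>v (?h *\<^sub>v v)"
  proof -
    have "v = (?h * g) *\<^sub>v v" using unit_grp_inverse[OF g] v by simp
    also have "\<dots> = ?h *\<^sub>v (g *\<^sub>v v)" using gc v by (intro assoc_mult_mat_vec[of _ n n _ n]) auto
    also have "\<dots> = x \<cdot>\<^sub>v (?h *\<^sub>v v)" using v gc by (simp add: mult_mat_vec[of _ n n])
    finally show ?thesis .
  qed
  show x0: "x \<noteq> 0"
  proof
    assume "x = 0"
    define w where "w = ?h *\<^sub>v v"
    have w: "w \<in> carrier_vec n" using gc v(1) by (auto simp: w_def intro!: mult_mat_vec_carrier[of _ n n])
    have vw: "v = 0 \<cdot>\<^sub>v w" using hv \<open>x = 0\<close> by (simp add: w_def)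
    have "v = 0\<^sub>v n" unfolding vw using w by (intro eq_vecI) auto
    then show False using v by simp
  qed
  have "eigenvalue ?h (inverse x)"
  proof -
    have "inverse x \<cdot>\<^sub>v v = inverse x \<cdot>\<^sub>v (x \<cdot>\<^sub>v (?h *\<^sub>v v))" using hv by simp
    also have "\<dots> = ?h *\<^sub>v v" using x0 gc v by (simp add: smult_smult_assoc)
    finally show ?thesis using v gc unfolding eigenvalue_def eigenvector_def by (intro exI[of _ v]) auto
  qed
  then have "inverse x \<in> mat_roots ?h"
    using eigenvalue_root_char_poly[of ?h n] gc by (simp add: mat_roots_def)
  moreover have "mat_roots ?h = mat_roots (star g)"
    using antidiag_square[where 'a='k, of n] gc
    by (intro mat_roots_conj[of ?J _ _ ?J n]) (auto simp: assoc_mult_mat[of _ n n _ n _ n] mult_mat_cancel)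
  moreover have "mat_roots (star g) = mat_roots (map_mat (\<lambda>x. x ^ q) g)"
    using gc by (simp add: mat_roots_def star_def)
  ultimately have "inverse x \<in> mat_roots (map_mat (\<lambda>x. x ^ q) g)" by simp
  then have ix: "poly (map_poly (\<lambda>x. x ^ q) (char_poly g)) (inverse x) = 0"
    using gc by (simp add: mat_roots_def frq.char_poly_hom)
  have "(inverse x) ^ (q ^ 2) \<noteq> 0" using x0 by simp
  \<comment> \<open>The entries of \<open>g\<close> are fixed by the q^2-th power map, hence so are
    the coefficients of its characteristic polynomial.\<close>
  have gq: "map_poly (\<lambda>x. x ^ q) (map_poly (\<lambda>x. x ^ q) (char_poly g)) = char_poly g"
  proof -
    have "char_poly g = char_poly (transpose_mat (star (star g)))" using unit_grp_star_star[OF g] gc by simp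
    also have "transpose_mat (star (star g)) = map_mat (\<lambda>x. x ^ q) (transpose_mat (map_mat (\<lambda>x. x ^ q) g))"
      by (rule eq_matI) (auto simp: star_def)
    also have "char_poly \<dots> = map_poly (\<lambda>x. x ^ q) (char_poly (transpose_mat (map_mat (\<lambda>x. x ^ q) g)))"
      using gc by (intro frq.char_poly_hom[of _ n]) auto
    also have "char_poly (transpose_mat (map_mat (\<lambda>x. x ^ q) g)) = map_poly (\<lambda>x. x ^ q) (char_poly g)"
      using gc frq.char_poly_hom[of g n] by (simp add: char_poly_transpose_mat[of _ n])
    finally show ?thesis by simp
  qed
  have "poly (map_poly (\<lambda>x. x ^ q) (map_poly (\<lambda>x. x ^ q) (char_poly g))) ((inverse x) ^ q) = 0"
    using ix by simp
  then show "tau x \<in> mat_roots g" unfolding gq by (simp add: mat_roots_def tau_def power_inverse)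
qed

lemma finite_mat_roots: "g \<in> carrier_mat n n \<Longrightarrow> finite (mat_roots (g :: 'k mat))"
  unfolding mat_roots_def using degree_monic_char_poly[of g n]
  by (intro poly_roots_finite) auto

lemma tau_stable_mat_roots:
  assumes "g \<in> unit_grp n" shows "tau_stable (mat_roots g)"
  using mat_roots_unit_grp_tau[OF assms] finite_mat_roots[OF unit_grp_carrier[OF assms]]
  by (intro tau_stableI) auto

end

section \<open>Frames attached to an enumerated root set\<close>

locale root_frame = twisted_frobenius q K for q :: nat and K :: "'k::alg_closed_field itself" +
  fixes n :: nat and z :: "nat \<Rightarrow> 'k"
  assumes inj_z: "inj_on z {..<n}" and stable_z: "tau_stable (z ` {..<n})"
begin

abbreviation "J \<equiv> antidiag n :: 'k mat"

definition "D = diagm n z"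

text \<open>The form of a unitary matrix pairs the eigenspace of x only with that of
  \<open>tau x\<close>; \<open>Gam\<close> is the normal form of the resulting Gram matrix of an
  eigenbasis.\<close>

definition "Gam = mat n n (\<lambda>(i, j). if z i = tau (z j) then 1 else (0::'k))"

lemma D_carrier [simp]: "D \<in> carrier_mat n n" by (simp add: D_def)

lemma Gam_carrier [simp]: "Gam \<in> carrier_mat n n" "transpose_mat Gam \<in> carrier_mat n n"
  by (simp_all add: Gam_def)

lemma z_nonzero: "i < n \<Longrightarrow> z i \<noteq> 0"
  using stable_z by (auto simp: tau_stable_def)

lemma z_eq_iff: "i < n \<Longrightarrow> j < n \<Longrightarrow> z i = z j \<longleftrightarrow> i = j"
  using inj_z by (auto simp: inj_on_def)

lemma ex_tau_preimage: "i < n \<Longrightarrow> \<exists>j<n. z i = tau (z j)"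
proof -
  assume "i < n"
  moreover have "z ` {..<n} = tau ` z ` {..<n}" using stable_z by (simp add: tau_stable_def)
  ultimately show ?thesis by blast
qed

lemma ex_tau_image: "j < n \<Longrightarrow> \<exists>i<n. z i = tau (z j)"
proof -
  assume "j < n"
  moreover have "tau ` z ` {..<n} = z ` {..<n}" using stable_z by (simp add: tau_stable_def)
  ultimately show ?thesis by force
qed

lemma Gam_mult_transpose: "Gam * transpose_mat Gam = 1\<^sub>m n"
proof (rule eq_matI)
  fix i j assume "i < dim_row (1\<^sub>m n :: 'k mat)" "j < dim_col (1\<^sub>m n :: 'k mat)"
  then have ij: "i < n" "j < n" by auto
  obtain l where l: "l < n" "z i = tau (z l)" using ex_tau_preimage[OF ij(1)] by blast
  have "(Gam * transpose_mat Gam) $$ (i, j) = (\<Sum>m<n. if m = l then (if z j = z i then 1 else 0) else 0)"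
    unfolding mult_mat_index[OF Gam_carrier ij]
    by (rule sum.cong[OF refl]) (use ij l z_eq_iff in \<open>auto simp: Gam_def tau_inj\<close>)
  also have "\<dots> = (if i = j then 1 else 0)" using l(1) z_eq_iff[OF ij(2,1)] by auto
  finally show "(Gam * transpose_mat Gam) $$ (i, j) = 1\<^sub>m n $$ (i, j)" using ij by simp
qed (auto simp: Gam_def)

lemma transpose_mult_Gam: "transpose_mat Gam * Gam = 1\<^sub>m n"
  by (rule mat_mult_left_right_inverse[OF _ _ Gam_mult_transpose]) auto

lemma star_Gam: "star Gam = transpose_mat Gam"
  by (rule eq_matI) (auto simp: star_def Gam_def)

text \<open>\<open>SS\<close> is a torsor under the unitary group on the right and under \<open>GU\<close> on the left; the
  diagonal part of \<open>GU\<close> is the torus of equivariant functions on the root set.\<close>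

definition "SS = {S \<in> carrier_mat n n. S * J * star S = Gam}"

definition "GU = {C \<in> carrier_mat n n. C * Gam * star C = Gam}"

definition sinv :: "'k mat \<Rightarrow> 'k mat" where "sinv S = J * star S * transpose_mat Gam"

lemma SS_carrier: "S \<in> SS \<Longrightarrow> S \<in> carrier_mat n n" by (simp add: SS_def)

lemma GU_carrier: "C \<in> GU \<Longrightarrow> C \<in> carrier_mat n n" by (simp add: GU_def)

lemma sinv_carrier: "S \<in> SS \<Longrightarrow> sinv S \<in> carrier_mat n n"
  by (simp add: sinv_def SS_carrier)

lemmas assoc = assoc_mult_mat[of _ n n _ n _ n]

lemma sinv:
  assumes "S \<in> SS"
  shows "S * sinv S = 1\<^sub>m n" "sinv S * S = 1\<^sub>m n"
proof -
  have S: "S \<in> carrier_mat n n" using assms by (rule SS_carrier)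
  have "S * sinv S = S * J * star S * transpose_mat Gam"
    using S by (simp add: sinv_def assoc)
  then show *: "S * sinv S = 1\<^sub>m n" using assms by (simp add: SS_def Gam_mult_transpose)
  show "sinv S * S = 1\<^sub>m n"
    by (rule mat_mult_left_right_inverse[OF S sinv_carrier[OF assms] *])
qed

lemma sinv_Gam:
  assumes "S \<in> SS" shows "sinv S * Gam * star (sinv S) = J"
proof -
  have S: "S \<in> carrier_mat n n" "sinv S \<in> carrier_mat n n" using assms by (simp_all add: SS_carrier sinv_carrier)
  have "star S * star (sinv S) = 1\<^sub>m n"
    using sinv[OF assms] S by (simp flip: star_mult_sq)
  moreover have "sinv S * Gam * star (sinv S) = (sinv S * S) * J * (star S * star (sinv S))"
  proof -
    have "Gam = S * J * star S" using assms by (simp add: SS_def)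
    then show ?thesis using S by (simp add: assoc)
  qed
  ultimately show ?thesis using sinv[OF assms] by (simp add: left_mult_one_mat[of _ n n] right_mult_one_mat[of _ n n])
qed

lemma SS_mult_unit:
  assumes "S \<in> SS" "g \<in> unit_grp n" shows "S * g \<in> SS"
proof -
  have c: "S \<in> carrier_mat n n" "g \<in> carrier_mat n n" using assms by (simp_all add: SS_carrier unit_grp_carrier)
  have "S * g * J * star (S * g) = S * (g * J * star g) * star S"
    using c by (simp add: star_mult_sq[OF c] assoc)
  then show ?thesis using assms c by (simp add: SS_def unit_grp_def)
qed

lemma GU_mult_SS:
  assumes "C \<in> GU" "S \<in> SS" shows "C * S \<in> SS"
proof -
  have c: "C \<in> carrier_mat n n" "S \<in> carrier_mat n n" using assms by (simp_all add: SS_carrier GU_carrier)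
  have "C * S * J * star (C * S) = C * (S * J * star S) * star C"
    using c by (simp add: star_mult_sq[OF c] assoc)
  then show ?thesis using assms c by (simp add: SS_def GU_def)
qed

lemma sinv_mult_SS:
  assumes "S \<in> SS" "T \<in> SS" shows "sinv S * T \<in> unit_grp n"
proof -
  have c: "sinv S \<in> carrier_mat n n" "T \<in> carrier_mat n n" using assms by (simp_all add: SS_carrier sinv_carrier)
  have "sinv S * T * J * star (sinv S * T) = sinv S * (T * J * star T) * star (sinv S)"
    using c by (simp add: star_mult_sq[OF c] assoc)
  then show ?thesis using assms c sinv_Gam[OF assms(1)] by (simp add: SS_def unit_grp_def)
qed

lemma SS_mult_sinv:
  assumes "S \<in> SS" "T \<in> SS" shows "T * sinv S \<in> GU"
proof -
  have c: "T \<in> carrier_mat n n" "sinv S \<in> carrier_mat n n" using assms by (simp_all add: SS_carrier sinv_carrier)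
  have "T * sinv S * Gam * star (T * sinv S) = T * (sinv S * Gam * star (sinv S)) * star T"
    using c by (simp add: star_mult_sq[OF c] assoc)
  then show ?thesis using assms c sinv_Gam[OF assms(1)] by (simp add: SS_def GU_def)
qed

text \<open>The (i, j) entry of \<open>Gam\<close> gets multiplied by \<open>c i * c j ^ q\<close>,
  so each pair with \<open>z i = tau (z j)\<close> demands that this factor be 1, which is
  equivariance at \<open>z j\<close>.\<close>

lemma diagm_in_GU_iff:
  "diagm n c \<in> GU \<longleftrightarrow> (\<forall>i<n. \<forall>j<n. z i = tau (z j) \<longrightarrow> c j \<noteq> 0 \<and> c i = tau (c j))"
proof -
  have idx: "(diagm n c * Gam * star (diagm n c)) $$ (i, j) = c i * c j ^ q * Gam $$ (i, j)" if "i < n" "j < n" for i j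
  proof -
    have "star (diagm n c) = diagm n (\<lambda>i. c i ^ q)"
      by (rule eq_matI) (auto simp: star_def diagm_def)
    then show ?thesis
      using that diagm_mult_index(2)[of "diagm n c * Gam" n i j "\<lambda>i. c i ^ q"] diagm_mult_index(1)[of Gam n i j c]
      by simp
  qed
  have "diagm n c \<in> GU \<longleftrightarrow> (\<forall>i<n. \<forall>j<n. c i * c j ^ q * Gam $$ (i, j) = Gam $$ (i, j))"
  proof
    assume "diagm n c \<in> GU"
    then have "diagm n c * Gam * star (diagm n c) = Gam" by (simp add: GU_def)
    then show "\<forall>i<n. \<forall>j<n. c i * c j ^ q * Gam $$ (i, j) = Gam $$ (i, j)" using idx by metis
  next
    assume *: "\<forall>i<n. \<forall>j<n. c i * c j ^ q * Gam $$ (i, j) = Gam $$ (i, j)"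
    have "diagm n c * Gam * star (diagm n c) = Gam"
    proof (rule eq_matI)
      fix i j assume "i < dim_row Gam" "j < dim_col Gam"
      then have "i < n" "j < n" by (auto simp: Gam_def)
      then show "(diagm n c * Gam * star (diagm n c)) $$ (i, j) = Gam $$ (i, j)" using idx * by simp
    qed (auto simp: Gam_def diagm_def star_def)
    then show "diagm n c \<in> GU" by (simp add: GU_def)
  qed
  also have "\<dots> \<longleftrightarrow> (\<forall>i<n. \<forall>j<n. z i = tau (z j) \<longrightarrow> c i * c j ^ q = 1)"
    by (auto simp: Gam_def)
  also have "\<dots> \<longleftrightarrow> (\<forall>i<n. \<forall>j<n. z i = tau (z j) \<longrightarrow> c j \<noteq> 0 \<and> c i = tau (c j))"
  proof -
    have "x * y ^ q = 1 \<longleftrightarrow> y \<noteq> 0 \<and> x = tau y" for x y :: 'k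
      using q_pos by (cases "y = 0") (auto simp: tau_def field_simps)
    then show ?thesis by simp
  qed
  finally show ?thesis .
qed

lemma D_in_GU: "D \<in> GU"
  unfolding D_def diagm_in_GU_iff using z_nonzero by auto

lemma equivariant_diagm:
  assumes "e \<in> equivariant (z ` {..<n})" shows "diagm n (\<lambda>i. e (z i)) \<in> GU"
  using assms by (auto simp: diagm_in_GU_iff equivariant_def)

text \<open>Distinct diagonal entries make the commutant of \<open>D\<close> diagonal, so the
  centralizer of \<open>D\<close> in \<open>GU\<close> is the torus of equivariant
  functions.\<close>

lemma commuting_GU_equivariant:
  assumes "C \<in> GU" "C * D = D * C"
  obtains e where "e \<in> equivariant (z ` {..<n})" "C = diagm n (\<lambda>i. e (z i))"
proof -
  define c where "c i = C $$ (i, i)" for i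
  have C: "C = diagm n c"
    unfolding c_def by (rule commutes_diagm[OF inj_z GU_carrier[OF assms(1)] assms(2)[unfolded D_def]])
  have c: "c j \<noteq> 0 \<and> c i = tau (c j)" if "i < n" "j < n" "z i = tau (z j)" for i j
    using assms(1) that unfolding C diagm_in_GU_iff by blast
  define e where "e = restrict (\<lambda>w. c (the_inv_into {..<n} z w)) (z ` {..<n})"
  have e: "e (z i) = c i" if "i < n" for i
    using that inj_z by (simp add: e_def the_inv_into_f_f)
  have "e \<in> equivariant (z ` {..<n})"
    unfolding equivariant_def
  proof (intro CollectI conjI ballI)
    show "e \<in> extensional (z ` {..<n})" by (simp add: e_def)
    fix w assume "w \<in> z ` {..<n}"
    then obtain j where j: "j < n" "w = z j" by auto
    obtain i where i: "i < n" "z i = tau (z j)" using ex_tau_image[OF j(1)] by blast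
    show "e w \<noteq> 0" using c[OF i(1) j(1) i(2)] e j by simp
    show "e (tau w) = tau (e w)" using c[OF i(1) j(1) i(2)] e[OF i(1)] e[OF j(1)] i j by simp
  qed
  moreover have "C = diagm n (\<lambda>i. e (z i))"
    unfolding C by (rule diagm_cong) (simp add: e)
  ultimately show ?thesis by (rule that)
qed

definition "UR = {g \<in> unit_grp n. mat_roots g = z ` {..<n}}"

text \<open>Since \<open>D\<close> lies in \<open>GU\<close>, both \<open>S\<close> and
  \<open>D * S\<close> lie in \<open>SS\<close>, and the quotient of two elements of
  \<open>SS\<close> is unitary.\<close>

lemma SS_conj_D:
  assumes "S \<in> SS"
  shows "sinv S * (D * S) \<in> UR" "S * (sinv S * (D * S)) = D * S"
proof -
  have c: "S \<in> carrier_mat n n" "sinv S \<in> carrier_mat n n" using assms by (simp_all add: SS_carrier sinv_carrier)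
  show eq: "S * (sinv S * (D * S)) = D * S"
    by (rule mult_mat_cancel[OF sinv(1)[OF assms] c]) (use c in simp)
  have "mat_roots (sinv S * (D * S)) = mat_roots D"
    by (rule mat_roots_conj[OF eq sinv(2)[OF assms] sinv(1)[OF assms] c]) (use c in auto)
  then show "sinv S * (D * S) \<in> UR"
    using sinv_mult_SS[OF assms GU_mult_SS[OF D_in_GU assms]] by (simp add: UR_def D_def mat_roots_diagm)
qed

end

section \<open>Existence of frames\<close>

lemma det_nonzero_inverse:
  fixes A :: "'a::field mat"
  assumes "A \<in> carrier_mat n n" "det A \<noteq> 0"
  obtains B where "B \<in> carrier_mat n n" "A * B = 1\<^sub>m n" "B * A = 1\<^sub>m n"
proof -
  have "A \<in> Units (ring_mat TYPE('a) n ())" using det_non_zero_imp_unit[OF assms] .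
  then show ?thesis using that by (auto simp: Units_def ring_mat_simps)
qed

lemma inverse_if_trivial_kernel:
  fixes A :: "'a::field mat"
  assumes A: "A \<in> carrier_mat n n"
    and ker: "\<And>c. (\<And>r. r < n \<Longrightarrow> (\<Sum>j<n. A $$ (r, j) * c j) = 0) \<Longrightarrow> (\<And>j. j < n \<Longrightarrow> c j = 0)"
  obtains B where "B \<in> carrier_mat n n" "A * B = 1\<^sub>m n" "B * A = 1\<^sub>m n"
proof -
  have "det A \<noteq> 0"
  proof
    assume "det A = 0"
    then obtain v where v: "v \<in> carrier_vec n" "v \<noteq> 0\<^sub>v n" "A *\<^sub>v v = 0\<^sub>v n"
      using det_0_iff_vec_prod_zero_field[OF A] by blast
    have "(\<Sum>j<n. A $$ (r, j) * v $ j) = 0" if "r < n" for r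
    proof -
      have "(A *\<^sub>v v) $ r = (\<Sum>j<n. A $$ (r, j) * v $ j)"
        using A v(1) that by (auto simp: scalar_prod_def lessThan_atLeast0 intro!: sum.cong)
      then show ?thesis using v(3) that by simp
    qed
    then have "v $ j = 0" if "j < n" for j using ker[of "\<lambda>j. v $ j"] that by blast
    then have "v = 0\<^sub>v n" using v(1) by (intro eq_vecI) auto
    then show False using v(2) by simp
  qed
  then show ?thesis using det_nonzero_inverse[OF A] that by blast
qed

lemma diagonalizable_if_distinct_eigenvalues:
  fixes g :: "'a::field mat"
  assumes g: "g \<in> carrier_mat n n" and inj: "inj_on z {..<n}" and z: "\<And>i. i < n \<Longrightarrow> z i \<in> mat_roots g"
  obtains S T where "S \<in> carrier_mat n n" "T \<in> carrier_mat n n" "S * T = 1\<^sub>m n" "T * S = 1\<^sub>m n"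
    "S * g = diagm n z * S"
proof -
  have "\<forall>i. \<exists>v. i < n \<longrightarrow> v \<in> carrier_vec n \<and> v \<noteq> 0\<^sub>v n \<and> g *\<^sub>v v = z i \<cdot>\<^sub>v v"
    using z eigenvalue_root_char_poly[OF g] g
    by (force simp: mat_roots_def eigenvalue_def eigenvector_def)
  then obtain v where v: "\<And>i. i < n \<Longrightarrow> v i \<in> carrier_vec n" "\<And>i. i < n \<Longrightarrow> v i \<noteq> 0\<^sub>v n"
    "\<And>i. i < n \<Longrightarrow> g *\<^sub>v v i = z i \<cdot>\<^sub>v v i" by metis
  have gv: "(\<Sum>l<n. g $$ (r, l) * v j $ l) = z j * v j $ r" if "r < n" "j < n" for r j
  proof -
    have "(g *\<^sub>v v j) $ r = (\<Sum>l<n. g $$ (r, l) * v j $ l)"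
      using g v(1)[OF that(2)] that by (auto simp: scalar_prod_def lessThan_atLeast0 intro!: sum.cong)
    moreover have "(z j \<cdot>\<^sub>v v j) $ r = z j * v j $ r" using v(1)[OF that(2)] that by simp
    ultimately show ?thesis using v(3)[OF that(2)] by simp
  qed
  define V where "V = mat n n (\<lambda>(r, j). v j $ r)"
  have V: "V \<in> carrier_mat n n" by (simp add: V_def)
  have gV: "g * V = V * diagm n z"
  proof (rule eq_matI)
    fix r j assume "r < dim_row (V * diagm n z)" "j < dim_col (V * diagm n z)"
    then have rj: "r < n" "j < n" by (auto simp: V_def diagm_def)
    show "(g * V) $$ (r, j) = (V * diagm n z) $$ (r, j)"
      unfolding mult_mat_index[OF g V rj] diagm_mult_index(2)[OF V rj]
      using gv[OF rj] rj by (simp add: V_def mult.commute)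
  qed (use g in \<open>auto simp: V_def diagm_def\<close>)
  text \<open>A vanishing combination \<open>c\<close> of eigenvectors yields the shorter one \<open>(z j - z i) * c j\<close>.\<close>
  have ker: "\<forall>j<n. c j = 0" if "\<And>r. r < n \<Longrightarrow> (\<Sum>j<n. v j $ r * c j) = 0" for c
    using that
  proof (induction "card {j. j < n \<and> c j \<noteq> 0}" arbitrary: c rule: less_induct)
    case less
    show ?case
    proof (rule ccontr)
      assume "\<not> (\<forall>j<n. c j = 0)"
      then obtain i where i: "i < n" "c i \<noteq> 0" by blast
      define c' where "c' j = (z j - z i) * c j" for j
      have "(\<Sum>j<n. v j $ r * c' j) = 0" if r: "r < n" for r
      proof -
        have "(\<Sum>j<n. v j $ r * c' j) = (\<Sum>j<n. z j * v j $ r * c j) - z i * (\<Sum>j<n. v j $ r * c j)"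
          by (simp add: c'_def algebra_simps sum_subtractf sum_distrib_left)
        also have "(\<Sum>j<n. z j * v j $ r * c j) = (\<Sum>j<n. (\<Sum>l<n. g $$ (r, l) * v j $ l) * c j)"
          using gv[OF r] by simp
        also have "\<dots> = (\<Sum>j<n. \<Sum>l<n. g $$ (r, l) * (v j $ l * c j))"
          by (simp add: sum_distrib_right mult.assoc)
        also have "\<dots> = (\<Sum>l<n. g $$ (r, l) * (\<Sum>j<n. v j $ l * c j))"
          by (subst sum.swap) (simp add: sum_distrib_left)
        also have "\<dots> = 0" using less.prems by simp
        finally show ?thesis using less.prems[OF r] by simp
      qed
      moreover have "{j. j < n \<and> c' j \<noteq> 0} \<subset> {j. j < n \<and> c j \<noteq> 0}"
        using i by (auto simp: c'_def)
      then have "card {j. j < n \<and> c' j \<noteq> 0} < card {j. j < n \<and> c j \<noteq> 0}"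
        by (intro psubset_card_mono) auto
      ultimately have c': "\<forall>j<n. c' j = 0" using less.hyps by blast
      have cj: "c j = 0" if "j < n" "j \<noteq> i" for j
        using c' that i inj by (auto simp: c'_def inj_on_def)
      have "v i $ r = 0" if r: "r < n" for r
      proof -
        have "(\<Sum>j<n. v j $ r * c j) = (\<Sum>j<n. if j = i then v i $ r * c i else 0)"
          by (rule sum.cong[OF refl]) (use cj in auto)
        then show ?thesis using less.prems[OF r] i by simp
      qed
      then have "v i = 0\<^sub>v n" using v(1)[OF i(1)] by (intro eq_vecI) auto
      then show False using v(2)[OF i(1)] by simp
    qed
  qed
  obtain S where S: "S \<in> carrier_mat n n" "V * S = 1\<^sub>m n" "S * V = 1\<^sub>m n"
  proof (rule inverse_if_trivial_kernel[OF V])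
    fix c j assume c: "\<And>r. r < n \<Longrightarrow> (\<Sum>j<n. V $$ (r, j) * c j) = 0" and j: "j < n"
    have "(\<Sum>j<n. v j $ r * c j) = 0" if "r < n" for r using c[OF that] that by (simp add: V_def)
    then show "c j = 0" using ker[of c] j by blast
  qed (rule that)
  have "S * g = S * (g * V) * S"
    using S V g by (simp add: assoc_mult_mat[of _ n n _ n _ n] right_mult_one_mat[of _ n n])
  also have "\<dots> = diagm n z * S"
    unfolding gV using S V mult_mat_cancel[OF S(3) S(1) V, of "diagm n z * S"]
    by (simp add: assoc_mult_mat[of _ n n _ n _ n])
  finally show ?thesis by (rule that[OF S(1) V S(3) S(2)])
qed

text \<open>A kernel vector lists the coefficients of a polynomial of degree below n that vanishes
  at n distinct points.\<close>

lemma vandermonde_inverse: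
  fixes z :: "nat \<Rightarrow> 'a::field"
  assumes "inj_on z {..<n}"
  obtains B where "B \<in> carrier_mat n n" "mat n n (\<lambda>(i, j). z i ^ j) * B = 1\<^sub>m n" "B * mat n n (\<lambda>(i, j). z i ^ j) = 1\<^sub>m n"
proof (rule inverse_if_trivial_kernel[of "mat n n (\<lambda>(i, j). z i ^ j)" n])
  fix c j assume c: "\<And>r. r < n \<Longrightarrow> (\<Sum>j<n. mat n n (\<lambda>(i, j). z i ^ j) $$ (r, j) * c j) = 0" and j: "j < n"
  define p where "p = (\<Sum>j<n. Polynomial.monom (c j) j)"
  have coeff: "coeff p j = (if j < n then c j else 0)" for j
    by (simp add: p_def coeff_sum)
  have root: "poly p (z i) = 0" if "i < n" for i
    using c[OF that] that by (simp add: p_def poly_sum poly_monom mult.commute)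
  have "p = 0"
  proof (rule ccontr)
    assume p: "p \<noteq> 0"
    have "degree p < n" using p coeff by (metis leading_coeff_0_iff)
    moreover have "n \<le> card {x. poly p x = 0}"
    proof -
      have "card (z ` {..<n}) \<le> card {x. poly p x = 0}"
        by (rule card_mono[OF poly_roots_finite[OF p]]) (use root in auto)
      then show ?thesis using assms by (simp add: card_image)
    qed
    ultimately show False using card_poly_roots_bound[OF p] by simp
  qed
  then show "c j = 0" using coeff[of j] j by simp
qed (auto intro: that)

section \<open>Splitting Hermitian matrices\<close>

context twisted_frobenius begin

text \<open>The polynomial X^q + X has at most q roots, whereas \<open>F\<close> has q^2 elements. A
  count is used because the candidate t = 1 fails in characteristic 2.\<close>

lemma exists_nonzero_trace:
  obtains t :: 'k where "t ^ (q ^ 2) = t" "t + t ^ q \<noteq> 0"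
proof -
  define p :: "'k poly" where "p = Polynomial.monom 1 q + [:0, 1:]"
  have deg: "degree p = q"
    unfolding p_def using q_ge_2 by (subst degree_add_eq_left) (auto simp: degree_monom_eq)
  then have p: "p \<noteq> 0" using q_pos by auto
  have "card {t. poly p t = 0} \<le> q" using card_poly_roots_bound[OF p] deg by simp
  moreover have "card (insert 0 (tau_fix 2)) = q ^ 2"
  proof -
    have "card (tau_fix 2) = q ^ 2 - 1" using card_tau_fix[of 2] by (simp add: tau_fix_card_def)
    moreover have "0 \<notin> tau_fix 2" by (simp add: tau_fix_def)
    ultimately show ?thesis using finite_tau_fix[of 2] q_pos by simp
  qed
  moreover have "q < q ^ 2" using q_ge_2 by (simp add: power2_eq_square)
  ultimately have "\<not> insert 0 (tau_fix 2) \<subseteq> {t. poly p t = 0}"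
    using card_mono[OF poly_roots_finite[OF p], of "insert 0 (tau_fix 2)"] by auto
  then obtain t where t: "t \<in> insert 0 (tau_fix 2)" "poly p t \<noteq> 0" by blast
  have "t ^ (q ^ 2) = t" using t(1) q_pos by (auto simp: tau_fix_def tau_funpow zero_power)
  moreover have "t + t ^ q \<noteq> 0" using t(2) by (simp add: p_def poly_monom add.commute)
  ultimately show ?thesis by (rule that)
qed

text \<open>Index functions instead of matrices: restriction to a leading block leaves the function
  as it is, and a permutation of the indices is a composition.\<close>

definition hermitian :: "nat \<Rightarrow> (nat \<Rightarrow> nat \<Rightarrow> 'k) \<Rightarrow> bool" where
  "hermitian n H \<longleftrightarrow> (\<forall>i<n. \<forall>j<n. H j i = H i j ^ q)"

text \<open>\<open>Q\<close> may be singular, since the smaller forms met in the induction can be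
  degenerate even if the original one is not.\<close>

definition splits_hermitian :: "nat \<Rightarrow> (nat \<Rightarrow> nat \<Rightarrow> 'k) \<Rightarrow> bool" where
  "splits_hermitian n H \<longleftrightarrow> (\<exists>Q. \<forall>i<n. \<forall>j<n. H i j = (\<Sum>k<n. Q i k * Q j k ^ q))"

lemma hermitianD: "hermitian n H \<Longrightarrow> i < n \<Longrightarrow> j < n \<Longrightarrow> H j i = H i j ^ q"
  unfolding hermitian_def by blast

lemma hermitian_rational: "hermitian n H \<Longrightarrow> i < n \<Longrightarrow> j < n \<Longrightarrow> H i j ^ (q * q) = H i j"
proof -
  assume *: "hermitian n H" "i < n" "j < n"
  have "H i j = H j i ^ q" by (rule hermitianD[OF *(1,3,2)])
  also have "H j i = H i j ^ q" by (rule hermitianD[OF *])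
  finally show ?thesis unfolding power_mult by (rule sym)
qed

text \<open>One Cholesky step: a (q+1)-th root \<open>y\<close> of the pivot plays the part of its
  square root, and subtracting the rank-one form of \<open>c\<close> leaves a Hermitian form on the
  first m indices.\<close>

lemma splits_hermitian_Suc:
  assumes IH: "\<And>H. hermitian m H \<Longrightarrow> splits_hermitian m H"
    and H: "hermitian (Suc m) H" and pivot: "H m m \<noteq> 0"
  shows "splits_hermitian (Suc m) H"
proof -
  obtain y where y: "y ^ (q + 1) = H m m" using nth_root_exists[of "q + 1" "H m m"] by auto
  have y0: "y \<noteq> 0" using y pivot by auto
  \<comment> \<open>The pivot is its own conjugate, so it is fixed by the q-th power map; it follows
    that \<open>y\<close> lies in \<open>F\<close>, which the Hermitian symmetry of the remainder
    requires.\<close>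
  have "y ^ (q * q) * y ^ q = (y ^ (q + 1)) ^ q"
    by (simp add: power_add power_mult_distrib power_mult mult.commute)
  also have "\<dots> = y ^ (q + 1)" unfolding y by (rule hermitianD[OF H, symmetric]) simp_all
  also have "\<dots> = y * y ^ q" by simp
  finally have yq: "y ^ (q * q) = y" using y0 by simp
  define c where "c i = H i m / y ^ q" for i
  have cq: "c i ^ (q * q) = c i" if "i < m" for i
  proof -
    have "(y ^ q) ^ (q * q) = (y ^ (q * q)) ^ q" by (simp only: power_mult[symmetric] mult.commute mult.left_commute)
    then show ?thesis using hermitian_rational[OF H, of i m] that yq by (simp add: c_def power_divide)
  qed
  have "hermitian m (\<lambda>i j. H i j - c i * c j ^ q)"
    unfolding hermitian_def
  proof (intro allI impI)
    fix i j assume "i < m" "j < m"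
    then show "H j i - c j * c i ^ q = (H i j - c i * c j ^ q) ^ q"
      using hermitianD[OF H, of i j] cq[of j]
      by (simp add: power_q_diff power_mult_distrib power_mult mult.commute)
  qed
  from IH[OF this, unfolded splits_hermitian_def] obtain Q where
    "\<forall>i<m. \<forall>j<m. H i j - c i * c j ^ q = (\<Sum>k<m. Q i k * Q j k ^ q)" ..
  then have Q: "H i j - c i * c j ^ q = (\<Sum>k<m. Q i k * Q j k ^ q)" if "i < m" "j < m" for i j
    using that by blast
  define P where "P i k = (if i = m then if k = m then y else 0 else if k = m then c i else Q i k)" for i k
  have "H i j = (\<Sum>k<Suc m. P i k * P j k ^ q)" if ij: "i < Suc m" "j < Suc m" for i j
  proof -
    consider "i < m" "j < m" | "i = m" "j < m" | "i < m" "j = m" | "i = m" "j = m" using ij by (auto simp: less_Suc_eq)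
    then show ?thesis
    proof cases
      case 1
      then show ?thesis using Q[OF 1] by (simp add: P_def algebra_simps)
    next
      case 2
      then have "y * c j ^ q = H m j"
        using hermitianD[OF H, of j m] yq y0 by (simp add: c_def power_divide power_mult)
      then show ?thesis using 2 by (simp add: P_def)
    next
      case 3
      then show ?thesis using y0 by (simp add: P_def c_def)
    next
      case 4
      then show ?thesis using y by (simp add: P_def)
    qed
  qed
  then show ?thesis unfolding splits_hermitian_def by blast
qed

text \<open>A nonzero diagonal entry, transposed to the last place, serves as pivot. If the diagonal
  vanishes but some \<open>H i j\<close> does not, a row operation, matched by the conjugate column
  operation, first creates a nonzero diagonal entry.\<close>

lemma hermitian_splits: "hermitian n H \<Longrightarrow> splits_hermitian n H"
proof (induction n arbitrary: H)
  case 0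
  then show ?case by (simp add: splits_hermitian_def)
next
  case (Suc m)
  have diag: "splits_hermitian (Suc m) H" if H: "hermitian (Suc m) H" and i: "i < Suc m" "H i i \<noteq> 0" for H i
  proof -
    define s where "s j = (if j = i then m else if j = m then i else j)" for j
    have s: "s (s j) = j" "s m = i" "j < Suc m \<Longrightarrow> s j < Suc m" for j using i by (auto simp: s_def)
    have "hermitian (Suc m) (\<lambda>a b. H (s a) (s b))"
      using hermitianD[OF H] s(3) unfolding hermitian_def by blast
    then have "splits_hermitian (Suc m) (\<lambda>a b. H (s a) (s b))"
      using i s(2) by (intro splits_hermitian_Suc[OF Suc.IH]) simp_all
    then obtain Q where "\<forall>a<Suc m. \<forall>b<Suc m. H (s a) (s b) = (\<Sum>k<Suc m. Q a k * Q b k ^ q)"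
      unfolding splits_hermitian_def ..
    then have Q: "H (s a) (s b) = (\<Sum>k<Suc m. Q a k * Q b k ^ q)" if "a < Suc m" "b < Suc m" for a b
      using that by blast
    have "H a b = (\<Sum>k<Suc m. Q (s a) k * Q (s b) k ^ q)" if "a < Suc m" "b < Suc m" for a b
      using Q[of "s a" "s b"] s that by simp
    then show ?thesis unfolding splits_hermitian_def by (intro exI[of _ "\<lambda>a. Q (s a)"]) blast
  qed
  consider "\<forall>i<Suc m. \<forall>j<Suc m. H i j = 0" | i where "i < Suc m" "H i i \<noteq> 0"
    | i j where "i < Suc m" "j < Suc m" "H i j \<noteq> 0" "H i i = 0" "H j j = 0" by blast
  then show ?case
  proof cases
    case 1
    then show ?thesis unfolding splits_hermitian_def by (intro exI[of _ "\<lambda>_ _. 0"]) simp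
  next
    case 2
    then show ?thesis using diag Suc.prems by blast
  next
    case (3 i j)
    note H = Suc.prems
    have ij: "i \<noteq> j" using 3 by auto
    obtain t :: 'k where t: "t ^ (q ^ 2) = t" "t + t ^ q \<noteq> 0" by (rule exists_nonzero_trace)
    \<comment> \<open>With this multiplier the new diagonal entry at i is
      \<open>H i j ^ (q + 1)\<close> times the trace of \<open>t\<close>, hence nonzero.\<close>
    define c where "c = H i j * t"
    have cq: "c ^ (q * q) = c"
      using t(1) hermitian_rational[OF H 3(1,2)] by (simp add: c_def power_mult_distrib power2_eq_square)
    define f where "f a = (if a = i then c else 0)" for a
    have fq: "f a ^ (q * q) = f a" for a using cq q_pos by (simp add: f_def zero_power)
    \<comment> \<open>The congruence adding \<open>c\<close> times row j to row i. Its fourth term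
      would carry the factor \<open>H j j\<close>, which is 0 in this case.\<close>
    define H' where "H' a b = H a b + f a * H j b + f b ^ q * H a j" for a b
    have "hermitian (Suc m) H'"
      unfolding hermitian_def
    proof (intro allI impI)
      fix a b assume ab: "a < Suc m" "b < Suc m"
      have "H' a b ^ q = H a b ^ q + f a ^ q * H j b ^ q + f b ^ (q * q) * H a j ^ q"
        by (simp add: H'_def power_q_add power_mult_distrib power_mult)
      then show "H' b a = H' a b ^ q"
        using hermitianD[OF H ab] hermitianD[OF H 3(2) ab(2)] hermitianD[OF H ab(1) 3(2)]
        by (simp add: H'_def fq)
    qed
    moreover have "H' i i \<noteq> 0"
    proof -
      have "H' i i = H i j ^ (q + 1) * (t + t ^ q)"
        using 3 hermitianD[OF H 3(1,2)]
        by (simp add: H'_def f_def c_def algebra_simps power_mult_distrib)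
      then show ?thesis using t 3 by simp
    qed
    ultimately have "splits_hermitian (Suc m) H'" using diag[of H' i] 3(1) by blast
    then obtain Q where "\<forall>a<Suc m. \<forall>b<Suc m. H' a b = (\<Sum>k<Suc m. Q a k * Q b k ^ q)"
      unfolding splits_hermitian_def ..
    then have Q: "H' a b = (\<Sum>k<Suc m. Q a k * Q b k ^ q)" if "a < Suc m" "b < Suc m" for a b
      using that by blast
    \<comment> \<open>The inverse row operation applied to \<open>Q\<close>; row j itself is
      unchanged because \<open>f j = 0\<close>.\<close>
    define P where "P a k = Q a k - f a * Q j k" for a k
    have fj: "f j = 0" using ij by (simp add: f_def)
    have "H a b = (\<Sum>k<Suc m. P a k * P b k ^ q)" if ab: "a < Suc m" "b < Suc m" for a b
    proof -
      have "(\<Sum>k<Suc m. P a k * P b k ^ q) = (\<Sum>k<Suc m. Q a k * Q b k ^ q - f a * (Q j k * Q b k ^ q)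
          - f b ^ q * (Q a k * Q j k ^ q) + f a * f b ^ q * (Q j k * Q j k ^ q))"
        by (rule sum.cong[OF refl]) (simp add: P_def power_q_diff power_mult_distrib algebra_simps)
      also have "\<dots> = H' a b - f a * H' j b - f b ^ q * H' a j + f a * f b ^ q * H' j j"
        using Q[OF ab] Q[OF 3(2) ab(2)] Q[OF ab(1) 3(2)] Q[OF 3(2,2)]
        by (simp only: sum.distrib sum_subtractf sum_distrib_left[symmetric])
      also have "\<dots> = H a b"
        using 3 q_pos by (simp add: H'_def fj algebra_simps)
      finally show ?thesis by simp
    qed
    then show ?thesis unfolding splits_hermitian_def by blast
  qed
qed

lemma hermitian_mat_factor:
  assumes H: "H \<in> carrier_mat n n" "star H = H"
  obtains Q where "Q \<in> carrier_mat n n" "Q * star Q = H"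
proof -
  have "hermitian n (\<lambda>i j. H $$ (i, j))"
    unfolding hermitian_def
  proof (intro allI impI)
    fix i j assume "i < n" "j < n"
    then have "star H $$ (j, i) = H $$ (i, j) ^ q" by (rule star_index[OF H(1), rotated])
    then show "H $$ (j, i) = H $$ (i, j) ^ q" using H(2) by simp
  qed
  from hermitian_splits[OF this, unfolded splits_hermitian_def] obtain Q where
    "\<forall>i<n. \<forall>j<n. H $$ (i, j) = (\<Sum>k<n. Q i k * Q j k ^ q)" ..
  then have Q: "H $$ (i, j) = (\<Sum>k<n. Q i k * Q j k ^ q)" if "i < n" "j < n" for i j
    using that by blast
  define P where "P = mat n n (\<lambda>(i, j). Q i j)"
  have P: "P \<in> carrier_mat n n" by (simp add: P_def)
  have "P * star P = H"
  proof (rule eq_matI)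
    fix i j assume "i < dim_row H" "j < dim_col H"
    then have ij: "i < n" "j < n" using H by auto
    show "(P * star P) $$ (i, j) = H $$ (i, j)"
      unfolding mult_mat_index[OF P star_carrier[OF P] ij] Q[OF ij]
      by (rule sum.cong[OF refl]) (use ij in \<open>simp add: star_index[OF P], simp add: P_def\<close>)
  qed (use H P in \<open>auto simp: star_def\<close>)
  with P show ?thesis by (rule that)
qed

end

section \<open>Existence of frames in normal form, and their count\<close>

context root_frame begin

lemma transpose_Gam_mult_index:
  assumes "Y \<in> carrier_mat n n" "i < n" "k < n" "j < n" "z k = tau (z i)"
  shows "(transpose_mat Gam * Y) $$ (i, j) = Y $$ (k, j)"
proof -
  have "(transpose_mat Gam * Y) $$ (i, j) = (\<Sum>l<n. if l = k then Y $$ (k, j) else 0)"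
    unfolding mult_mat_index[OF Gam_carrier(2) assms(1,2,4)]
    by (rule sum.cong[OF refl]) (use assms z_eq_iff[of _ k] in \<open>auto simp: Gam_def\<close>)
  then show ?thesis using assms(3) by simp
qed

text \<open>The Vandermonde matrix \<open>W\<close> of the \<open>z i\<close> conjugates its double star into a permutation
  matrix; hence \<open>W\<^sup>-\<^sup>1 \<Gamma> W\<^sup>-\<^sup>*\<close> is Hermitian, and so congruent to \<open>J\<close>.\<close>
lemma SS_nonempty: "\<exists>S. S \<in> SS"
proof -
  define W where "W = mat n n (\<lambda>(i, j). z i ^ j)"
  have W: "W \<in> carrier_mat n n" by (simp add: W_def)
  obtain B where B: "B \<in> carrier_mat n n" "W * B = 1\<^sub>m n" "B * W = 1\<^sub>m n"
    using vandermonde_inverse[OF inj_z] unfolding W_def by blast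
  \<comment> \<open>Applying \<open>star\<close> twice raises the nodes \<open>z i\<close> to the
    power q^2, that is applies \<open>tau\<close> twice; this permutes the rows of
    \<open>W\<close>.\<close>
  have WW: "star (star W) = transpose_mat Gam * (transpose_mat Gam * W)"
  proof (rule eq_matI)
    fix i j assume "i < dim_row (transpose_mat Gam * (transpose_mat Gam * W))" "j < dim_col (transpose_mat Gam * (transpose_mat Gam * W))"
    then have ij: "i < n" "j < n" using W by (auto simp: Gam_def)
    obtain k where k: "k < n" "z k = tau (z i)" using ex_tau_image[OF ij(1)] by blast
    obtain l where l: "l < n" "z l = tau (z k)" using ex_tau_image[OF k(1)] by blast
    have "star (star W) $$ (i, j) = (z i ^ j) ^ (q ^ 2)"
      using star_star_index[OF W ij] ij by (simp add: W_def)
    also have "\<dots> = z l ^ j"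
      by (simp add: l k tau_tau power_mult[symmetric] mult.commute)
    also have "\<dots> = W $$ (l, j)" using l ij by (simp add: W_def)
    also have "\<dots> = (transpose_mat Gam * W) $$ (k, j)"
      by (rule transpose_Gam_mult_index[OF W k(1) l(1) ij(2) l(2), symmetric])
    also have "\<dots> = (transpose_mat Gam * (transpose_mat Gam * W)) $$ (i, j)"
      by (rule transpose_Gam_mult_index[symmetric]) (use W ij k in simp_all)
    finally show "star (star W) $$ (i, j) = (transpose_mat Gam * (transpose_mat Gam * W)) $$ (i, j)" .
  qed (use W in \<open>auto simp: star_def Gam_def\<close>)
  \<comment> \<open>The same relation for the inverse of \<open>W\<close>. It supplies the two
    factors \<open>Gam\<close> that make \<open>H\<close> below equal to its own
    \<open>star\<close>.\<close>
  have BB: "star (star B) = B * (Gam * Gam)"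
  proof -
    have "star (star B) * star (star W) = star (star W * star B)"
      using W B by (simp add: star_mult_sq[of _ n])
    also have "star W * star B = star (B * W)" by (rule star_mult_sq[OF B(1) W, symmetric])
    finally have one: "star (star B) * (transpose_mat Gam * (transpose_mat Gam * W)) = 1\<^sub>m n"
      using B(3) by (simp add: WW)
    have tG: "transpose_mat Gam * (transpose_mat Gam * (Gam * Gam)) = 1\<^sub>m n"
      using mult_mat_cancel[OF transpose_mult_Gam Gam_carrier(2,1,1)] transpose_mult_Gam by simp
    have "star (star B) = star (star B) * (transpose_mat Gam * (transpose_mat Gam * (W * (B * (Gam * Gam)))))"
      using B tG mult_mat_cancel[OF B(2) W B(1), of "Gam * Gam"] by (simp add: right_mult_one_mat[of _ n n])
    also have "\<dots> = star (star B) * (transpose_mat Gam * (transpose_mat Gam * W)) * (B * (Gam * Gam))"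
      using W B by (simp add: assoc)
    finally show ?thesis unfolding one using B by (simp add: left_mult_one_mat[of _ n n])
  qed
  define H where "H = B * (Gam * star B)"
  have H: "H \<in> carrier_mat n n" using B by (simp add: H_def)
  have "star H = star (star B) * (transpose_mat Gam * star B)"
    using B by (simp add: H_def star_mult_sq[of _ n] star_Gam assoc)
  also have "\<dots> = B * (Gam * (Gam * (transpose_mat Gam * star B)))"
    unfolding BB using B by (simp add: assoc)
  also have "Gam * (transpose_mat Gam * star B) = star B"
    by (rule mult_mat_cancel[OF Gam_mult_transpose Gam_carrier]) (use B in simp)
  finally have starH: "star H = H" by (simp add: H_def)
  obtain Q where Q: "Q \<in> carrier_mat n n" "Q * star Q = H"
    by (rule hermitian_mat_factor[OF H starH])
  obtain P where P: "P \<in> carrier_mat n n" "P * star P = J"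
    by (rule hermitian_mat_factor[of J n]) simp_all
  \<comment> \<open>The inverse of \<open>P\<close>, because \<open>P * star P = J\<close> and
    \<open>J\<close> squares to the identity.\<close>
  define P' where "P' = star P * J"
  have P': "P' \<in> carrier_mat n n" using P by (simp add: P'_def)
  have "P * P' = P * star P * J" using P(1) by (simp add: P'_def assoc)
  then have "P * P' = 1\<^sub>m n" unfolding P(2) antidiag_square .
  then have P'P: "P' * P = 1\<^sub>m n" by (rule mat_mult_left_right_inverse[OF P(1) P'])
  have P'J: "P' * J * star P' = 1\<^sub>m n"
  proof -
    have "P' * J * star P' = P' * P * (star P * star P')"
      unfolding P(2)[symmetric] using P(1) P' by (simp add: assoc)
    also have "star P * star P' = 1\<^sub>m n" using P P' P'P by (simp flip: star_mult_sq[of _ n])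
    finally show ?thesis by (simp add: P'P)
  qed
  \<comment> \<open>\<open>P'\<close> transports \<open>J\<close> to the identity, \<open>Q\<close>
    the identity to \<open>H\<close>, and \<open>W\<close> carries \<open>H\<close> to
    \<open>Gam\<close>.\<close>
  define S where "S = W * (Q * P')"
  have S: "S \<in> carrier_mat n n" using W Q P' by (simp add: S_def)
  have "S * J * star S = W * (Q * (P' * J * star P') * star Q) * star W"
    using W Q P' by (simp add: S_def star_mult_sq[of _ n] assoc)
  also have "\<dots> = W * H * star W"
    unfolding P'J using Q by (simp add: right_mult_one_mat[of _ n n])
  also have "\<dots> = W * (B * (Gam * (star B * star W)))"
    using W B by (simp add: H_def assoc)
  also have "star B * star W = 1\<^sub>m n" using W B by (simp flip: star_mult_sq[of _ n])
  also have "W * (B * (Gam * 1\<^sub>m n)) = Gam"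
    using mult_mat_cancel[OF B(2) W B(1), of Gam] by (simp add: right_mult_one_mat[of _ n n])
  finally have "S \<in> SS" using S by (simp add: SS_def)
  then show ?thesis by blast
qed

text \<open>The Gram matrix of a basis of eigenvectors is monomial with the shape of \<open>\<Gamma>\<close>; Lang's
  theorem rescales the basis so that it becomes \<open>\<Gamma>\<close>.\<close>
lemma SS_diagonalizing:
  assumes g: "g \<in> UR" obtains S where "S \<in> SS" "S * g = D * S"
proof -
  have gU: "g \<in> unit_grp n" using g by (simp add: UR_def)
  have gc: "g \<in> carrier_mat n n" using gU by (rule unit_grp_carrier)
  have roots: "z i \<in> mat_roots g" if "i < n" for i using g that by (simp add: UR_def)
  obtain S T where S: "S \<in> carrier_mat n n" "T \<in> carrier_mat n n" "S * T = 1\<^sub>m n" "T * S = 1\<^sub>m n"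
    "S * g = D * S"
    using diagonalizable_if_distinct_eigenvalues[OF gc inj_z roots] unfolding D_def by blast
  define Y where "Y = S * J * star S"
  have Y: "Y \<in> carrier_mat n n" using S by (simp add: Y_def)
  have "D * Y * star D = (D * S) * J * star (D * S)"
    using S by (simp add: Y_def star_mult_sq[of _ n] assoc)
  also have "\<dots> = S * (g * J * star g) * star S"
    unfolding S(5)[symmetric] star_mult_sq[OF S(1) gc] using S(1) gc by (simp add: assoc)
  also have "\<dots> = Y" using gU by (simp add: unit_grp_def Y_def)
  finally have DYD: "D * Y * star D = Y" .
  have starD: "star D = diagm n (\<lambda>i. z i ^ q)"
    by (rule eq_matI) (auto simp: star_def diagm_def D_def)
  \<comment> \<open>Unitarity of \<open>g\<close> makes the Gram matrix \<open>Y\<close> invariant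
    under \<open>D\<close>, which multiplies its (i, j) entry by \<open>z i * z j ^ q\<close>; a
    nonzero entry forces this factor to be 1.\<close>
  have Y_zero: "z i = tau (z j)" if "i < n" "j < n" "Y $$ (i, j) \<noteq> 0" for i j
  proof -
    have "(D * Y * star D) $$ (i, j) = z i * Y $$ (i, j) * z j ^ q"
      unfolding starD using that Y diagm_mult_index(2)[of "D * Y" n i j] diagm_mult_index(1)[of Y n i j z]
      by (simp add: D_def)
    then have "z i * z j ^ q = 1" using that unfolding DYD by simp
    then show ?thesis using z_nonzero[OF that(2)] by (simp add: tau_def field_simps)
  qed
  have "Y * (star T * J * T) = 1\<^sub>m n"
  proof -
    have "star S * star T = 1\<^sub>m n" using S by (simp flip: star_mult_sq[of _ n])
    then have c: "star S * (star T * (J * T)) = J * T"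
      using S by (intro mult_mat_cancel[of _ _ n]) simp_all
    have "Y * (star T * J * T) = S * (J * (star S * (star T * (J * T))))"
      using S by (simp add: Y_def assoc)
    also have "\<dots> = S * T"
      unfolding c using S mult_mat_cancel[OF antidiag_square antidiag_carrier antidiag_carrier S(2)] by simp
    finally show ?thesis by (simp add: S)
  qed
  \<comment> \<open>\<open>Y\<close> is invertible, so no row vanishes; together with
    \<open>Y_zero\<close> each row has exactly one nonzero entry.\<close>
  then have ex: "\<exists>j<n. Y $$ (i, j) \<noteq> 0" if i: "i < n" for i
  proof (rule contrapos_pp)
    assume "\<not> (\<exists>j<n. Y $$ (i, j) \<noteq> 0)"
    then have "(Y * (star T * J * T)) $$ (i, i) = 0"
      using S mult_mat_index[OF Y, of "star T * J * T" n i i] i by simp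
    then show "Y * (star T * J * T) \<noteq> 1\<^sub>m n" using i by auto
  qed
  define p where "p i = (SOME j. j < n \<and> Y $$ (i, j) \<noteq> 0)" for i
  have p: "p i < n" "Y $$ (i, p i) \<noteq> 0" if "i < n" for i
    using someI_ex[OF ex[OF that]] unfolding p_def by auto
  \<comment> \<open>The nonzero entry in the row of \<open>Y\<close> that belongs to the root
    \<open>w\<close>. Its column is that of the preimage of \<open>w\<close> under
    \<open>tau\<close>, so the equation of \<open>lang_torus\<close> turns this entry into the 1 of
    \<open>Gam\<close>.\<close>
  define c where "c w = (let i = the_inv_into {..<n} z w in Y $$ (i, p i))" for w
  have c: "c (z i) = Y $$ (i, p i)" if "i < n" for i
    using that inj_z by (simp add: c_def the_inv_into_f_f)
  have c0: "c w \<noteq> 0" if "w \<in> z ` {..<n}" for w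
    using that c p by auto
  obtain e where e: "\<And>w. w \<in> z ` {..<n} \<Longrightarrow> e w \<noteq> 0"
    "\<And>w. w \<in> z ` {..<n} \<Longrightarrow> e (tau w) * c (tau w) * e w ^ q = 1"
  proof (rule lang_torus[OF stable_z c0])
    fix e assume "\<And>w. w \<in> z ` {..<n} \<Longrightarrow> e w \<noteq> 0"
      "\<And>w. w \<in> z ` {..<n} \<Longrightarrow> e (tau w) * c (tau w) * e w ^ q = 1"
    then show thesis by (rule that)
  qed
  define E where "E = diagm n (\<lambda>i. e (z i))"
  have E: "E \<in> carrier_mat n n" by (simp add: E_def)
  have starE: "star E = diagm n (\<lambda>i. e (z i) ^ q)"
    by (rule eq_matI) (auto simp: star_def diagm_def E_def)
  have EYE: "E * Y * star E = Gam"
  proof (rule eq_matI)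
    fix i j assume "i < dim_row Gam" "j < dim_col Gam"
    then have ij: "i < n" "j < n" by (auto simp: Gam_def)
    have eq: "(E * Y * star E) $$ (i, j) = e (z i) * Y $$ (i, j) * e (z j) ^ q"
      unfolding starE using ij Y E diagm_mult_index(2)[of "E * Y" n i j] diagm_mult_index(1)[of Y n i j "\<lambda>i. e (z i)"]
      by (simp add: E_def)
    show "(E * Y * star E) $$ (i, j) = Gam $$ (i, j)"
    proof (cases "z i = tau (z j)")
      case True
      have "z i = tau (z (p i))" by (rule Y_zero[OF ij(1) p[OF ij(1)]])
      then have "tau (z j) = tau (z (p i))" using True by simp
      then have "p i = j" using z_eq_iff[OF ij(2) p(1)[OF ij(1)]] tau_inj by simp
      then have "c (tau (z j)) = Y $$ (i, j)" using c[OF ij(1)] True by simp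
      moreover have "z j \<in> z ` {..<n}" using ij by simp
      ultimately show ?thesis unfolding eq using e(2)[of "z j"] True ij by (simp add: Gam_def)
    next
      case False
      then have "Y $$ (i, j) = 0" using Y_zero[OF ij] by blast
      then show ?thesis unfolding eq using False ij by (simp add: Gam_def)
    qed
  qed (use E in \<open>auto simp: star_def Gam_def\<close>)
  have "E * S * J * star (E * S) = E * Y * star E"
    using E S by (simp add: Y_def star_mult_sq[of _ n] assoc)
  then have "E * S \<in> SS" using E S EYE by (simp add: SS_def)
  moreover have "E * S * g = D * (E * S)"
  proof -
    have ED: "E * D = D * E" by (simp add: E_def D_def diagm_mult mult.commute)
    have "E * S * g = E * D * S" using E S gc by (simp add: assoc)
    also have "\<dots> = D * (E * S)" unfolding ED using E S by (simp add: assoc)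
    finally show ?thesis .
  qed
  ultimately show ?thesis by (rule that)
qed

text \<open>\<open>SS\<close> is counted twice: as the translate of the unitary group by a fixed
  \<open>S0\<close>, and by sending \<open>S\<close> to the matrix \<open>sinv S * (D * S)\<close>,
  whose fibres are copies of the torus.\<close>

lemma card_unit_grp: "card (unit_grp n) = card UR * card (equivariant (z ` {..<n}))"
proof -
  obtain S0 where S0: "S0 \<in> SS" using SS_nonempty by blast
  have S0c: "S0 \<in> carrier_mat n n" "sinv S0 \<in> carrier_mat n n" using S0 by (simp_all add: SS_carrier sinv_carrier)
  have "bij_betw (\<lambda>g. S0 * g) (unit_grp n) SS"
  proof (rule bij_betw_byWitness[where f' = "\<lambda>S. sinv S0 * S"])
    show "\<forall>g\<in>unit_grp n. sinv S0 * (S0 * g) = g"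
      using mult_mat_cancel[OF sinv(2)[OF S0] S0c(2,1)] unit_grp_carrier by blast
    show "\<forall>S\<in>SS. S0 * (sinv S0 * S) = S"
      using mult_mat_cancel[OF sinv(1)[OF S0] S0c] SS_carrier by blast
  qed (use S0 SS_mult_unit sinv_mult_SS in auto)
  then have 1: "card (unit_grp n) = card SS" by (rule bij_betw_same_card)
  \<comment> \<open>A base point in the fibre over each \<open>g\<close>; the torus acts on the
    fibre from the left.\<close>
  define F where "F g = (SOME S. S \<in> SS \<and> S * g = D * S)" for g
  have F: "F g \<in> SS" "F g * g = D * F g" if "g \<in> UR" for g
  proof -
    have "\<exists>S. S \<in> SS \<and> S * g = D * S" using SS_diagonalizing[OF that] by blast
    from someI_ex[OF this] show "F g \<in> SS" "F g * g = D * F g" by (simp_all add: F_def)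
  qed
  have URc: "g \<in> carrier_mat n n" if "g \<in> UR" for g using that by (simp add: UR_def unit_grp_carrier)
  let ?E = "equivariant (z ` {..<n})"
  define h where "h e = diagm n (\<lambda>i. e (z i))" for e :: "'k \<Rightarrow> 'k"
  have hc: "h e \<in> carrier_mat n n" for e by (simp add: h_def)
  have h_inj: "e = e'" if "h e = h e'" "e \<in> ?E" "e' \<in> ?E" for e e'
  proof (rule extensionalityI[of _ "z ` {..<n}"])
    fix w assume "w \<in> z ` {..<n}"
    then show "e w = e' w" using that(1) by (auto simp: h_def diagm_eq_iff)
  qed (use that in \<open>auto simp: equivariant_def\<close>)
  have hD: "h e * D = D * h e" for e
    by (simp add: h_def D_def diagm_mult mult.commute)
  have hF: "h e * F g \<in> SS" "h e * F g * g = D * (h e * F g)" if "g \<in> UR" "e \<in> ?E" for g e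
  proof -
    note c = hc[of e] SS_carrier[OF F(1)[OF that(1)]] URc[OF that(1)]
    show "h e * F g \<in> SS" using GU_mult_SS equivariant_diagm[OF that(2)] F(1)[OF that(1)] by (simp add: h_def)
    have "h e * F g * g = h e * D * F g" using c F(2)[OF that(1)] by (simp add: assoc)
    also have "\<dots> = D * (h e * F g)" unfolding hD using c by (simp add: assoc)
    finally show "h e * F g * g = D * (h e * F g)" .
  qed
  have unique: "g = sinv S * (D * S)" if "S \<in> SS" "S * g = D * S" "g \<in> carrier_mat n n" for S g
    using mult_mat_cancel[OF sinv(2)[OF that(1)] sinv_carrier[OF that(1)] SS_carrier[OF that(1)] that(3)] that(2)
    by simp
  have "bij_betw (\<lambda>(g, e). h e * F g) (UR \<times> ?E) SS"
    unfolding bij_betw_def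
  proof (intro conjI inj_onI equalityI subsetI)
    fix x y assume x: "x \<in> UR \<times> ?E" and y: "y \<in> UR \<times> ?E"
      and eq: "(\<lambda>(g, e). h e * F g) x = (\<lambda>(g, e). h e * F g) y"
    obtain g e where xe: "x = (g, e)" "g \<in> UR" "e \<in> ?E" using x by auto
    obtain g' e' where ye: "y = (g', e')" "g' \<in> UR" "e' \<in> ?E" using y by auto
    have eq: "h e * F g = h e' * F g'" using eq xe ye by simp
    have "g = g'"
      using unique[OF hF[OF xe(2,3)] URc[OF xe(2)]] unique[OF hF[OF ye(2,3)] URc[OF ye(2)]] eq by simp
    moreover have "h e = h e'"
    proof -
      have FS: "F g \<in> SS" by (rule F[OF xe(2)])
      have "h e * F g * sinv (F g) = h e' * F g * sinv (F g)" using eq \<open>g = g'\<close> by simp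
      then show ?thesis using SS_carrier[OF FS] sinv_carrier[OF FS] hc sinv(1)[OF FS]
        by (simp add: assoc right_mult_one_mat[of _ n n])
    qed
    ultimately show "x = y" using h_inj xe ye by simp
  next
    fix S assume "S \<in> (\<lambda>(g, e). h e * F g) ` (UR \<times> ?E)"
    then show "S \<in> SS" using hF(1) by auto
  next
    fix S assume S: "S \<in> SS"
    define g where "g = sinv S * (D * S)"
    have g: "g \<in> UR" "S * g = D * S" using SS_conj_D[OF S] by (simp_all add: g_def)
    note FS = F[OF g(1)]
    note c = SS_carrier[OF S] SS_carrier[OF FS(1)] sinv_carrier[OF FS(1)] URc[OF g(1)]
    have Fg: "g * sinv (F g) = sinv (F g) * D"
    proof -
      have "g * sinv (F g) = sinv (F g) * (F g * (g * sinv (F g)))"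
        by (rule mult_mat_cancel[symmetric, OF sinv(2)[OF FS(1)] c(3,2)]) (use c in simp)
      also have "\<dots> = sinv (F g) * (F g * g * sinv (F g))" using c by (simp add: assoc)
      also have "\<dots> = sinv (F g) * (D * (F g * sinv (F g)))" unfolding FS(2) using c by (simp add: assoc)
      finally show ?thesis unfolding sinv(1)[OF FS(1)] by (simp add: right_mult_one_mat[of _ n n])
    qed
    \<comment> \<open>Both \<open>S\<close> and \<open>F g\<close> diagonalize \<open>g\<close>, so
      their quotient commutes with \<open>D\<close> and therefore comes from the torus.\<close>
    have "S * sinv (F g) * D = S * (g * sinv (F g))" unfolding Fg using c by (simp add: assoc)
    also have "\<dots> = D * S * sinv (F g)" using c g(2) by (simp flip: assoc)
    also have "\<dots> = D * (S * sinv (F g))" using c by (simp add: assoc)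
    finally obtain e where e: "e \<in> ?E" "S * sinv (F g) = h e"
      using commuting_GU_equivariant[OF SS_mult_sinv[OF FS(1) S]] unfolding h_def by blast
    have "S = h e * F g"
      unfolding e(2)[symmetric] using c sinv(2)[OF FS(1)] by (simp add: assoc right_mult_one_mat[of _ n n])
    then show "S \<in> (\<lambda>(g, e). h e * F g) ` (UR \<times> ?E)" using g e by force
  qed
  then have "card SS = card (UR \<times> ?E)" using bij_betw_same_card by fastforce
  then show ?thesis using 1 by (simp add: card_cartesian_product)
qed

lemma pow_mat_commute: "C \<in> carrier_mat n n \<Longrightarrow> C * C ^\<^sub>m m = C ^\<^sub>m m * C"
proof (induction m)
  case (Suc m)
  have "C * C ^\<^sub>m Suc m = C * C ^\<^sub>m m * C" using Suc.prems by (simp add: assoc)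
  also have "\<dots> = C ^\<^sub>m Suc m * C" unfolding Suc.IH[OF Suc.prems] by simp
  finally show ?case .
qed (simp add: left_mult_one_mat[of _ n n] right_mult_one_mat[of _ n n])

lemma conj_pow:
  assumes "S \<in> carrier_mat n n" "T \<in> carrier_mat n n" "T * S = 1\<^sub>m n" "S * T = 1\<^sub>m n" "a \<in> carrier_mat n n"
  shows "(S * (a * T)) ^\<^sub>m m = S * (a ^\<^sub>m m * T)"
proof (induction m)
  case 0
  then show ?case using assms by simp
next
  case (Suc m)
  have "a ^\<^sub>m m \<in> carrier_mat n n" using assms by simp
  moreover have "T * (S * (a * T)) = a * T"
    by (rule mult_mat_cancel[OF assms(3,2,1)]) (use assms in simp)
  ultimately show ?case using assms Suc by (simp add: assoc)
qed

text \<open>An M-th root of \<open>g\<close>, written in a frame of \<open>g\<close>, commutes with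
  its own M-th power \<open>D\<close>. It is thus an element of the torus whose M-th power is the
  inclusion of the root set, and conversely such an element conjugates back to a unitary
  root.\<close>

lemma unit_power_iff:
  assumes g: "g \<in> UR"
  shows "(\<exists>a\<in>unit_grp n. a ^\<^sub>m M = g) \<longleftrightarrow> (\<exists>e\<in>equivariant (z ` {..<n}). \<forall>w\<in>z ` {..<n}. e w ^ M = w)"
proof -
  obtain S where S: "S \<in> SS" "S * g = D * S" by (rule SS_diagonalizing[OF g])
  have gc: "g \<in> carrier_mat n n" using g by (simp add: UR_def unit_grp_carrier)
  note c = SS_carrier[OF S(1)] sinv_carrier[OF S(1)] gc
  note inv = sinv[OF S(1)]
  show ?thesis
  proof
    assume "\<exists>a\<in>unit_grp n. a ^\<^sub>m M = g"
    then obtain a where a: "a \<in> unit_grp n" "a ^\<^sub>m M = g" by blast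
    have ac: "a \<in> carrier_mat n n" using a(1) by (rule unit_grp_carrier)
    define C where "C = S * (a * sinv S)"
    have C: "C \<in> carrier_mat n n" using c ac by (simp add: C_def)
    have "C = S * a * sinv S" using c ac by (simp add: C_def assoc)
    then have CGU: "C \<in> GU" using SS_mult_sinv[OF S(1) SS_mult_unit[OF S(1) a(1)]] by simp
    have CM: "C ^\<^sub>m M = D"
    proof -
      have "C ^\<^sub>m M = S * (g * sinv S)" unfolding C_def conj_pow[OF c(1,2) inv(2,1) ac] a(2) ..
      also have "\<dots> = D * S * sinv S" using c S(2) by (simp flip: assoc)
      finally show ?thesis using c inv by (simp add: assoc right_mult_one_mat[of _ n n])
    qed
    have "C * C ^\<^sub>m M = C ^\<^sub>m M * C" by (rule pow_mat_commute[OF C])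
    then have "C * D = D * C" by (simp add: CM)
    then obtain e where e: "e \<in> equivariant (z ` {..<n})" "C = diagm n (\<lambda>i. e (z i))"
      using commuting_GU_equivariant[OF CGU] by blast
    have "diagm n (\<lambda>i. e (z i) ^ M) = diagm n z" using CM by (simp add: e(2) diagm_pow D_def)
    then have "\<forall>i<n. e (z i) ^ M = z i" by (simp add: diagm_eq_iff)
    then show "\<exists>e\<in>equivariant (z ` {..<n}). \<forall>w\<in>z ` {..<n}. e w ^ M = w" using e(1) by auto
  next
    assume "\<exists>e\<in>equivariant (z ` {..<n}). \<forall>w\<in>z ` {..<n}. e w ^ M = w"
    then obtain e where e: "e \<in> equivariant (z ` {..<n})" "\<And>i. i < n \<Longrightarrow> e (z i) ^ M = z i" by auto
    define E where "E = diagm n (\<lambda>i. e (z i))"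
    have E: "E \<in> carrier_mat n n" by (simp add: E_def)
    have EM: "E ^\<^sub>m M = D" unfolding E_def D_def diagm_pow by (rule diagm_cong) (rule e(2))
    have "sinv S * (E * S) \<in> unit_grp n"
      using sinv_mult_SS[OF S(1) GU_mult_SS[OF equivariant_diagm[OF e(1)] S(1)]] by (simp add: E_def)
    moreover have "(sinv S * (E * S)) ^\<^sub>m M = g"
    proof -
      have "(sinv S * (E * S)) ^\<^sub>m M = sinv S * (S * g)"
        unfolding conj_pow[OF c(2,1) inv E] EM S(2) ..
      then show ?thesis using mult_mat_cancel[OF inv(2) c(2,1,3)] by simp
    qed
    ultimately show "\<exists>a\<in>unit_grp n. a ^\<^sub>m M = g" by blast
  qed
qed

end

section \<open>The generating function over stable sets\<close>

lemma prod_const_mult_fps_X_power: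
  "(\<Prod>i\<in>B. fps_const (a i) * fps_X ^ d i) = fps_const (\<Prod>i\<in>B. a i :: 'b::comm_semiring_1) * fps_X ^ (\<Sum>i\<in>B. d i)"
proof (induction B rule: infinite_finite_induct)
  case (insert x B)
  have "(\<Prod>i\<in>insert x B. fps_const (a i) * fps_X ^ d i)
      = (fps_const (a x) * fps_X ^ d x) * (fps_const (\<Prod>i\<in>B. a i) * fps_X ^ (\<Sum>i\<in>B. d i))"
    using insert by simp
  also have "\<dots> = (fps_const (a x) * fps_const (\<Prod>i\<in>B. a i)) * (fps_X ^ d x * fps_X ^ (\<Sum>i\<in>B. d i))"
    by (simp only: ac_simps)
  also have "\<dots> = fps_const (\<Prod>i\<in>insert x B. a i) * fps_X ^ (\<Sum>i\<in>insert x B. d i)"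
    using insert by (simp add: power_add)
  finally show ?case .
qed auto

text \<open>Multiplying out selects a subset \<open>B\<close> of the factors, which contributes in
  degree the sum of \<open>d\<close> over \<open>B\<close>.\<close>

lemma fps_nth_prod_one_plus:
  assumes "finite I"
  shows "fps_nth (\<Prod>i\<in>I. 1 + fps_const (a i :: 'b::comm_ring_1) * fps_X ^ d i) n =
    (\<Sum>B\<in>{B. B \<subseteq> I \<and> (\<Sum>i\<in>B. d i) = n}. \<Prod>i\<in>B. a i)"
proof -
  have "(\<Prod>i\<in>I. 1 + fps_const (a i) * fps_X ^ d i) = (\<Prod>i\<in>I. fps_const (a i) * fps_X ^ d i + 1)"
    by (simp add: add.commute)
  also have "\<dots> = (\<Sum>B\<in>Pow I. fps_const (\<Prod>i\<in>B. a i) * fps_X ^ (\<Sum>i\<in>B. d i))"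
    by (simp add: prod_add[OF assms] prod_const_mult_fps_X_power)
  finally have "fps_nth (\<Prod>i\<in>I. 1 + fps_const (a i) * fps_X ^ d i) n =
      (\<Sum>B\<in>Pow I. if (\<Sum>i\<in>B. d i) = n then \<Prod>i\<in>B. a i else 0)"
    by (simp add: fps_sum_nth if_distrib eq_commute cong: if_cong)
  also have "\<dots> = (\<Sum>B\<in>{B \<in> Pow I. (\<Sum>i\<in>B. d i) = n}. \<Prod>i\<in>B. a i)"
    using assms by (intro sum.inter_filter[symmetric]) simp
  finally show ?thesis by simp
qed

section \<open>Weights of stable sets\<close>

context twisted_frobenius begin

definition power_good :: "nat \<Rightarrow> 'k set \<Rightarrow> bool" where
  "power_good M R \<longleftrightarrow> (\<exists>e\<in>equivariant R. \<forall>w\<in>R. e w ^ M = w)"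

text \<open>For a stable set \<open>R\<close> of size n this is the proportion of
  \<open>unit_grp n\<close> formed by the M-th powers with root set \<open>R\<close>: of the
  elements with these roots, all or none are M-th powers.\<close>

definition weight :: "nat \<Rightarrow> 'k set \<Rightarrow> real" where
  "weight M R = (if power_good M R then 1 / real (card (equivariant R)) else 0)"

definition stable_sets :: "nat \<Rightarrow> 'k set set" where
  "stable_sets n = {R. tau_stable R \<and> card R = n}"

lemma frame_of_stable_set:
  assumes "tau_stable R" "card R = n"
  obtains z where "root_frame q n z" "z ` {..<n} = R"
proof -
  have "finite R" using assms by (simp add: tau_stable_def)
  then obtain z where "bij_betw z {..<n} R"
    using ex_bij_betw_nat_finite[of R] assms(2) by (auto simp: lessThan_atLeast0)
  then have z: "inj_on z {..<n}" "z ` {..<n} = R" by (auto simp: bij_betw_def)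
  have "root_frame q n z" by unfold_locales (use z assms in auto)
  then show ?thesis using z(2) by (rule that)
qed

lemma card_unit_grp_roots:
  assumes "tau_stable R" "card R = n"
  shows "card (unit_grp n) = card {g \<in> unit_grp n. mat_roots g = R} * card (equivariant R)"
proof -
  obtain z where z: "root_frame q n z" "z ` {..<n} = R" by (rule frame_of_stable_set[OF assms])
  interpret root_frame q K n z by (rule z(1))
  show ?thesis using card_unit_grp by (simp add: UR_def z(2))
qed

lemma power_iff_good:
  assumes "g \<in> unit_grp n" "card (mat_roots g) = n"
  shows "(\<exists>a\<in>unit_grp n. a ^\<^sub>m M = g) \<longleftrightarrow> power_good M (mat_roots g)"
proof -
  obtain z where z: "root_frame q n z" "z ` {..<n} = mat_roots g"
    by (rule frame_of_stable_set[OF tau_stable_mat_roots[OF assms(1)] assms(2)])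
  interpret root_frame q K n z by (rule z(1))
  show ?thesis using unit_power_iff[of g M] assms z(2) by (simp add: UR_def power_good_def)
qed

lemma finite_unit_grp: "finite (unit_grp n)"
proof -
  define A where "A = insert 0 (tau_fix 2)"
  let ?I = "{..<n} \<times> {..<n}" and ?A = A
  have mem: "g $$ (i, j) \<in> ?A" if "g \<in> unit_grp n" "i < n" "j < n" for g i j
    using unit_grp_entry[OF that] by (auto simp: A_def tau_fix_def tau_funpow)
  have "inj_on (\<lambda>g. restrict (\<lambda>p. g $$ p) ?I) (unit_grp n)"
  proof (rule inj_onI)
    fix g h assume gh: "g \<in> unit_grp n" "h \<in> unit_grp n" "restrict (\<lambda>p. g $$ p) ?I = restrict (\<lambda>p. h $$ p) ?I"
    have c: "g \<in> carrier_mat n n" "h \<in> carrier_mat n n" using gh by (simp_all add: unit_grp_carrier)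
    show "g = h"
    proof (rule eq_matI)
      fix i j assume "i < dim_row h" "j < dim_col h"
      then have "(i, j) \<in> ?I" using c by auto
      then show "g $$ (i, j) = h $$ (i, j)" using fun_cong[OF gh(3), of "(i, j)"] by simp
    qed (use c in auto)
  qed
  moreover have "(\<lambda>g. restrict (\<lambda>p. g $$ p) ?I) ` unit_grp n \<subseteq> (\<Pi>\<^sub>E p\<in>?I. ?A)"
    by (intro image_subsetI, unfold restrict_PiE_iff) (auto simp: mem)
  moreover have "finite (\<Pi>\<^sub>E p\<in>?I. ?A)" using finite_tau_fix[of 2] by (intro finite_PiE) (auto simp: A_def)
  ultimately show ?thesis by (metis finite_imageD finite_subset)
qed

lemma card_unit_grp_pos: "0 < card (unit_grp n)"
  using finite_unit_grp[of n] unit_grp_one[of n] by (auto simp: card_gt_0_iff)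

text \<open>Every element of such a set lies on an orbit of some size m at most n, hence in the
  finite set \<open>tau_fix m\<close>.\<close>

lemma finite_stable_sets: "finite (stable_sets n)"
proof -
  have "w \<in> (\<Union>m\<in>{1..n}. tau_fix m)" if R: "R \<in> stable_sets n" "w \<in> R" for R w
  proof -
    have st: "tau_stable R" "card R = n" using R by (auto simp: stable_sets_def)
    note fin = tau_stable_finite_orb[OF st(1) R(2)]
    have "card (orb w) \<le> n"
      using card_mono[OF _ tau_stable_orb_subset[OF st(1) R(2)]] st by (auto simp: tau_stable_def)
    moreover have "w \<noteq> 0" using st R by (auto simp: tau_stable_def)
    ultimately show ?thesis
      using orb_period(1)[OF fin] funpow_card_orb[OF fin] by (intro UN_I[of "card (orb w)"]) (auto simp: tau_fix_def)
  qed
  then have "stable_sets n \<subseteq> Pow (\<Union>m\<in>{1..n}. tau_fix m)" by blast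
  moreover have "finite (\<Union>m\<in>{1..n}. tau_fix m)" by (intro finite_UN_I finite_tau_fix) auto
  ultimately show ?thesis by (meson finite_Pow_iff finite_subset)
qed

text \<open>Having n distinct roots is the form that separability takes over
  \<open>K\<close>.\<close>

definition power_elements :: "nat \<Rightarrow> nat \<Rightarrow> 'k mat set" where
  "power_elements M n = {g \<in> unit_grp n. card (mat_roots g) = n \<and> (\<exists>a\<in>unit_grp n. a ^\<^sub>m M = g)}"

lemma card_power_elements:
  "real (card (power_elements M n)) / real (card (unit_grp n)) = (\<Sum>R\<in>stable_sets n. weight M R)"
proof -
  let ?U = "unit_grp n"
  let ?A = "\<lambda>R. {g \<in> power_elements M n. mat_roots g = R}"
  have "power_elements M n = (\<Union>R\<in>stable_sets n. ?A R)"
    using tau_stable_mat_roots[of _ n] by (auto simp: power_elements_def stable_sets_def)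
  then have "card (power_elements M n) = (\<Sum>R\<in>stable_sets n. card (?A R))"
    using finite_unit_grp[of n] finite_stable_sets[of n]
    by (subst (1) \<open>power_elements M n = _\<close>, intro card_UN_disjoint)
      (auto simp: power_elements_def)
  also have "real \<dots> = (\<Sum>R\<in>stable_sets n. real (card ?U) * weight M R)"
    unfolding of_nat_sum
  proof (rule sum.cong[OF refl])
    fix R assume "R \<in> stable_sets n"
    then have R: "tau_stable R" "card R = n" by (auto simp: stable_sets_def)
    note cU = card_unit_grp_roots[OF R]
    \<comment> \<open>The group order is positive and has this cardinality as a factor, so the torus
      is seen to be finite and nonempty without a separate argument.\<close>
    have E: "card (equivariant R) > 0" using cU card_unit_grp_pos[of n] by (auto intro: gr0I)
    show "real (card (?A R)) = real (card ?U) * weight M R"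
    proof (cases "power_good M R")
      case True
      have "?A R = {g \<in> ?U. mat_roots g = R}"
        using power_iff_good[of _ n M] R True by (auto simp: power_elements_def)
      then show ?thesis using True cU E by (simp add: weight_def)
    next
      case False
      then have "?A R = {}" using power_iff_good[of _ n M] R by (auto simp: power_elements_def)
      then have "card (?A R) = 0" by (simp only: card.empty)
      then show ?thesis using False by (simp add: weight_def)
    qed
  qed
  also have "\<dots> = real (card ?U) * (\<Sum>R\<in>stable_sets n. weight M R)" by (simp add: sum_distrib_left)
  finally show ?thesis using card_unit_grp_pos[of n] by simp
qed

lemma equivariant_Un:
  assumes "tau_stable A" "tau_stable B" "A \<inter> B = {}"
  shows "bij_betw (\<lambda>e. (restrict e A, restrict e B)) (equivariant (A \<union> B)) (equivariant A \<times> equivariant B)"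
proof (rule bij_betw_byWitness[where f' = "\<lambda>(e, f) x. if x \<in> A then e x else f x"])
  have tA: "tau w \<in> A" if "w \<in> A" for w using tau_stable_funpow[OF assms(1) that, of 1] by simp
  have tB: "tau w \<in> B" if "w \<in> B" for w using tau_stable_funpow[OF assms(2) that, of 1] by simp
  have nA: "w \<notin> A" if "w \<in> B" for w using that assms(3) by blast
  show "\<forall>e\<in>equivariant (A \<union> B). (\<lambda>(e, f) x. if x \<in> A then e x else f x) (restrict e A, restrict e B) = e"
    by (auto simp: equivariant_def extensional_def fun_eq_iff)
  show "\<forall>p\<in>equivariant A \<times> equivariant B.
      (\<lambda>e. (restrict e A, restrict e B)) ((\<lambda>(e, f) x. if x \<in> A then e x else f x) p) = p"
    using assms(3) by (auto simp: equivariant_def extensional_def fun_eq_iff restrict_def)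
  show "(\<lambda>e. (restrict e A, restrict e B)) ` equivariant (A \<union> B) \<subseteq> equivariant A \<times> equivariant B"
    using tA tB by (auto simp: equivariant_def)
  show "(\<lambda>(e, f) x. if x \<in> A then e x else f x) ` (equivariant A \<times> equivariant B) \<subseteq> equivariant (A \<union> B)"
    using tA tB nA by (auto simp: equivariant_def extensional_def)
qed

text \<open>The torus of a disjoint union is the product of the tori, and the inclusion is an M-th
  power in a product exactly if it is one in each factor.\<close>

lemma weight_Un:
  assumes "tau_stable A" "tau_stable B" "A \<inter> B = {}"
  shows "weight M (A \<union> B) = weight M A * weight M B"
proof -
  note bij = equivariant_Un[OF assms]
  have "card (equivariant (A \<union> B)) = card (equivariant A) * card (equivariant B)"
    using bij_betw_same_card[OF bij] by (simp add: card_cartesian_product)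
  moreover have "power_good M (A \<union> B) \<longleftrightarrow> power_good M A \<and> power_good M B"
  proof
    assume "power_good M (A \<union> B)"
    then obtain e where e: "e \<in> equivariant (A \<union> B)" "\<forall>w\<in>A \<union> B. e w ^ M = w" by (auto simp: power_good_def)
    then have "(restrict e A, restrict e B) \<in> equivariant A \<times> equivariant B"
      using bij unfolding bij_betw_def by blast
    then have "restrict e A \<in> equivariant A" "restrict e B \<in> equivariant B" by simp_all
    moreover have "\<forall>w\<in>A. restrict e A w ^ M = w" "\<forall>w\<in>B. restrict e B w ^ M = w" using e(2) by simp_all
    ultimately show "power_good M A \<and> power_good M B" unfolding power_good_def by blast
  next
    assume "power_good M A \<and> power_good M B"
    then obtain e f where ef: "e \<in> equivariant A" "f \<in> equivariant B" "\<forall>w\<in>A. e w ^ M = w" "\<forall>w\<in>B. f w ^ M = w"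
      by (auto simp: power_good_def)
    then obtain g where g: "g \<in> equivariant (A \<union> B)" "(restrict g A, restrict g B) = (e, f)"
      using bij unfolding bij_betw_def by (metis (no_types, lifting) SigmaI imageE)
    have "g w ^ M = w" if "w \<in> A \<union> B" for w
      using that g(2) ef(3,4) by (metis Pair_inject Un_iff restrict_apply')
    then show "power_good M (A \<union> B)" using g(1) by (auto simp: power_good_def)
  qed
  ultimately show ?thesis by (simp add: weight_def)
qed

lemma weight_empty: "weight M {} = 1"
proof -
  have "equivariant {} = {\<lambda>_. undefined}" by (auto simp: equivariant_def)
  then show ?thesis by (simp add: weight_def power_good_def)
qed

section \<open>Decomposition of stable sets into orbits\<close>

definition orbits :: "'k set set" where
  "orbits = {orb w | w. w \<noteq> 0 \<and> finite (orb w)}"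

lemma orbits_stable: "Q \<in> orbits \<Longrightarrow> tau_stable Q"
  using tau_stable_orb by (auto simp: orbits_def)

lemma orbits_finite: "Q \<in> orbits \<Longrightarrow> finite Q"
  by (auto simp: orbits_def)

lemma orbits_orb: "Q \<in> orbits \<Longrightarrow> w \<in> Q \<Longrightarrow> orb w = Q"
  using orb_eqI by (auto simp: orbits_def)

lemma orbits_disjoint: "Q \<in> orbits \<Longrightarrow> Q' \<in> orbits \<Longrightarrow> Q \<noteq> Q' \<Longrightarrow> Q \<inter> Q' = {}"
  using orbits_orb by blast

lemma orbits_nonempty: "Q \<in> orbits \<Longrightarrow> Q \<noteq> {}"
proof -
  assume "Q \<in> orbits"
  then obtain w where "Q = orb w" by (auto simp: orbits_def)
  then show ?thesis using orb_refl[of w] by blast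
qed

lemma Union_orbits:
  assumes "finite B" "B \<subseteq> orbits"
  shows "tau_stable (\<Union>B)" "weight M (\<Union>B) = (\<Prod>Q\<in>B. weight M Q)"
proof -
  have "tau_stable (\<Union>B) \<and> weight M (\<Union>B) = (\<Prod>Q\<in>B. weight M Q)"
    using assms
  proof (induction B rule: finite_induct)
    case empty
    then show ?case by (simp add: tau_stable_def weight_empty)
  next
    case (insert Q B)
    have Q: "tau_stable Q" and IH: "tau_stable (\<Union>B)" "weight M (\<Union>B) = (\<Prod>Q\<in>B. weight M Q)"
      using insert orbits_stable by auto
    have "Q \<inter> \<Union>B = {}" using insert orbits_disjoint[of Q] by blast
    then have "weight M (\<Union>(insert Q B)) = (\<Prod>Q\<in>insert Q B. weight M Q)"
      using weight_Un[OF Q IH(1)] IH(2) insert by simp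
    moreover have "tau_stable (\<Union>(insert Q B))"
      using Q IH(1) by (auto simp: tau_stable_def image_Un)
    ultimately show ?case by simp
  qed
  then show "tau_stable (\<Union>B)" "weight M (\<Union>B) = (\<Prod>Q\<in>B. weight M Q)" by simp_all
qed

lemma card_Union_orbits: "finite B \<Longrightarrow> B \<subseteq> orbits \<Longrightarrow> card (\<Union>B) = (\<Sum>Q\<in>B. card Q)"
proof (rule card_Union_disjoint)
  assume B: "B \<subseteq> orbits"
  show "pairwise disjnt B" unfolding pairwise_def disjnt_def using B orbits_disjoint by blast
  show "finite Q" if "Q \<in> B" for Q using B that orbits_finite by blast
qed

text \<open>A stable set is the disjoint union of its orbits and its weight is the product of
  theirs, so the sum over sets is an expanded product over orbits. Orbits larger than n may belong
  to \<open>I\<close>; they do not reach the coefficient at n.\<close>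

lemma sum_weight_stable_sets:
  assumes "finite I" "I \<subseteq> orbits" "\<And>Q. Q \<in> orbits \<Longrightarrow> card Q \<le> n \<Longrightarrow> Q \<in> I"
  shows "(\<Sum>R\<in>stable_sets n. weight M R) =
    fps_nth (\<Prod>Q\<in>I. 1 + fps_const (weight M Q) * fps_X ^ card Q) n"
proof -
  let ?BB = "{B. B \<subseteq> I \<and> (\<Sum>Q\<in>B. card Q) = n}"
  have fin: "finite B" "B \<subseteq> orbits" if "B \<in> ?BB" for B using that assms finite_subset by auto
  have "bij_betw Union ?BB (stable_sets n)"
  proof (rule bij_betw_byWitness[where f' = "\<lambda>R. orb ` R"])
    show "\<forall>B\<in>?BB. orb ` \<Union>B = B"
    proof
      fix B assume B: "B \<in> ?BB"
      have "orb w \<in> B" if "w \<in> Q" "Q \<in> B" for w Q using orbits_orb[of Q w] fin(2)[OF B] that by auto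
      moreover have "Q \<in> orb ` \<Union>B" if Q: "Q \<in> B" for Q
      proof -
        obtain w where "w \<in> Q" using orbits_nonempty[of Q] fin(2)[OF B] Q by auto
        then show ?thesis using orbits_orb[of Q w] fin(2)[OF B] Q by force
      qed
      ultimately show "orb ` \<Union>B = B" by blast
    qed
    show "\<forall>R\<in>stable_sets n. \<Union>(orb ` R) = R"
    proof
      fix R assume "R \<in> stable_sets n"
      then have "orb w \<subseteq> R" if "w \<in> R" for w
        using tau_stable_orb_subset[OF _ that] by (simp add: stable_sets_def)
      then show "\<Union>(orb ` R) = R" using orb_refl by blast
    qed
    show "Union ` ?BB \<subseteq> stable_sets n"
    proof
      fix R assume "R \<in> Union ` ?BB"
      then obtain B where B: "B \<in> ?BB" "R = \<Union>B" by blast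
      then show "R \<in> stable_sets n"
        using Union_orbits(1)[OF fin[OF B(1)]] card_Union_orbits[OF fin[OF B(1)]] by (simp add: stable_sets_def)
    qed
    show "(\<lambda>R. orb ` R) ` stable_sets n \<subseteq> ?BB"
    proof
      fix B assume "B \<in> (\<lambda>R. orb ` R) ` stable_sets n"
      then obtain R where R: "tau_stable R" "card R = n" "B = orb ` R" by (auto simp: stable_sets_def)
      have sub: "orb w \<subseteq> R" if "w \<in> R" for w by (rule tau_stable_orb_subset[OF R(1) that])
      have finR: "finite R" and R0: "0 \<notin> R" using R(1) by (auto simp: tau_stable_def)
      have orbs: "B \<subseteq> orbits"
        using R(3) sub finR R0 finite_subset unfolding orbits_def by blast
      have "B \<subseteq> I"
      proof
        fix Q assume Q: "Q \<in> B"
        then have "Q \<subseteq> R" using R(3) sub by auto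
        then show "Q \<in> I" using assms(3) orbs Q card_mono[OF finR] R(2) by blast
      qed
      moreover have "\<Union>B = R" using R(3) sub orb_refl by blast
      moreover have "card (\<Union>B) = (\<Sum>Q\<in>B. card Q)" by (rule card_Union_orbits) (use finR R(3) orbs in auto)
      ultimately show "B \<in> ?BB" using R(2) by simp
    qed
  qed
  then have "(\<Sum>R\<in>stable_sets n. weight M R) = (\<Sum>B\<in>?BB. weight M (\<Union>B))"
    by (rule sum.reindex_bij_betw[symmetric])
  also have "\<dots> = (\<Sum>B\<in>?BB. \<Prod>Q\<in>B. weight M Q)"
    by (rule sum.cong[OF refl]) (rule Union_orbits(2)[OF fin])
  also have "\<dots> = fps_nth (\<Prod>Q\<in>I. 1 + fps_const (weight M Q) * fps_X ^ card Q) n"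
    by (rule fps_nth_prod_one_plus[OF assms(1), symmetric])
  finally show ?thesis .
qed

definition good_orbits :: "nat \<Rightarrow> nat \<Rightarrow> 'k set set" where
  "good_orbits M d = {Q \<in> orbits. card Q = d \<and> power_good M Q}"

lemma finite_orbits_card: "0 < d \<Longrightarrow> finite {Q \<in> orbits. card Q = d}"
proof -
  assume d: "0 < d"
  have "{Q \<in> orbits. card Q = d} \<subseteq> orb ` tau_fix d"
    using funpow_card_orb by (fastforce simp: orbits_def tau_fix_def)
  then show ?thesis using finite_tau_fix[OF d] by (meson finite_imageI finite_subset)
qed

lemma orbits_card_pos: "Q \<in> orbits \<Longrightarrow> 0 < card Q"
  using orbits_finite orbits_nonempty by (simp add: card_gt_0_iff)

text \<open>Good orbits of one size share their weight; any other orbit has weight 0 and contributes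
  the factor 1.\<close>

lemma prod_orbits_card:
  assumes "0 < d"
  shows "(\<Prod>Q\<in>{Q \<in> orbits. card Q = d}. 1 + fps_const (weight M Q) * fps_X ^ card Q) =
    (1 + fps_const (1 / real (tau_fix_card d)) * fps_X ^ d) ^ card (good_orbits M d)"
proof -
  have "(\<Prod>Q\<in>{Q \<in> orbits. card Q = d}. 1 + fps_const (weight M Q) * fps_X ^ card Q) =
      (\<Prod>Q\<in>good_orbits M d. 1 + fps_const (1 / real (tau_fix_card d)) * fps_X ^ d)"
  proof (rule prod.mono_neutral_cong_right[OF finite_orbits_card[OF assms]])
    show "\<forall>Q\<in>{Q \<in> orbits. card Q = d} - good_orbits M d. 1 + fps_const (weight M Q) * fps_X ^ card Q = 1"
      by (auto simp: good_orbits_def weight_def)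
  next
    fix Q assume Q: "Q \<in> good_orbits M d"
    then obtain w where "Q = orb w" "w \<noteq> 0" "finite (orb w)" by (auto simp: good_orbits_def orbits_def)
    then have "card (equivariant Q) = tau_fix_card d"
      using card_equivariant_orb[of w] Q by (simp add: good_orbits_def)
    then show "1 + fps_const (weight M Q) * fps_X ^ card Q = 1 + fps_const (1 / real (tau_fix_card d)) * fps_X ^ d"
      using Q by (simp add: good_orbits_def weight_def)
  qed (auto simp: good_orbits_def)
  then show ?thesis by simp
qed

theorem power_elements_generating_function:
  "real (card (power_elements M n)) / real (card (unit_grp n)) = fps_nth (
     (\<Prod>d\<in>{d \<in> {1..n}. odd d}. (1 + fps_const (1 / (real q ^ d + 1)) * fps_X ^ d) ^ card (good_orbits M d)) *
     (\<Prod>d\<in>{1..n}. (1 + fps_const (1 / (real q ^ (2 * d) - 1)) * fps_X ^ (2 * d)) ^ card (good_orbits M (2 * d)))) n"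
proof -
  define O' where "O' d = {Q \<in> orbits. card Q = d}" for d
  let ?f = "\<lambda>Q. 1 + fps_const (weight M Q) * fps_X ^ card Q"
  let ?odd = "{d \<in> {1..n}. odd d}"
  \<comment> \<open>\<open>?I2\<close> holds the even sizes up to 2 * n, as in
    \<open>rhs_trunc\<close>; those above n leave the coefficient at n unchanged.\<close>
  let ?I1 = "\<Union>d\<in>?odd. O' d" and ?I2 = "\<Union>d\<in>{1..n}. O' (2 * d)"
  have fin: "finite (O' d)" if "0 < d" for d using finite_orbits_card[OF that] by (simp add: O'_def)
  have fin1: "finite ?I1" and fin2: "finite ?I2" using fin by auto
  have disj: "?I1 \<inter> ?I2 = {}" by (auto simp: O'_def)
  have "Q \<in> ?I1 \<union> ?I2" if "Q \<in> orbits" "card Q \<le> n" for Q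
  proof (cases "odd (card Q)")
    case True
    then show ?thesis using that orbits_card_pos[OF that(1)] by (auto simp: O'_def)
  next
    case False
    then obtain d where "card Q = 2 * d" by (auto elim: evenE)
    then show ?thesis using that orbits_card_pos[OF that(1)] by (auto simp: O'_def)
  qed
  then have "real (card (power_elements M n)) / real (card (unit_grp n)) = fps_nth (\<Prod>Q\<in>?I1 \<union> ?I2. ?f Q) n"
    unfolding card_power_elements
    by (intro sum_weight_stable_sets) (use fin1 fin2 in \<open>auto simp: O'_def\<close>)
  also have "(\<Prod>Q\<in>?I1 \<union> ?I2. ?f Q) = (\<Prod>Q\<in>?I1. ?f Q) * (\<Prod>Q\<in>?I2. ?f Q)"
    by (rule prod.union_disjoint[OF fin1 fin2 disj])
  also have "(\<Prod>Q\<in>?I1. ?f Q) = (\<Prod>d\<in>?odd. \<Prod>Q\<in>O' d. ?f Q)"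
    by (rule prod.UNION_disjoint) (use fin in \<open>auto simp: O'_def\<close>)
  also have "\<dots> = (\<Prod>d\<in>?odd. (1 + fps_const (1 / (real q ^ d + 1)) * fps_X ^ d) ^ card (good_orbits M d))"
  proof (rule prod.cong[OF refl])
    fix d assume d: "d \<in> ?odd"
    then have "real (tau_fix_card d) = real q ^ d + 1" by (simp add: tau_fix_card_def)
    then show "(\<Prod>Q\<in>O' d. ?f Q) = (1 + fps_const (1 / (real q ^ d + 1)) * fps_X ^ d) ^ card (good_orbits M d)"
      using prod_orbits_card[of d M] d by (simp add: O'_def)
  qed
  also have "(\<Prod>Q\<in>?I2. ?f Q) = (\<Prod>d\<in>{1..n}. \<Prod>Q\<in>O' (2 * d). ?f Q)"
    by (rule prod.UNION_disjoint) (use fin in \<open>auto simp: O'_def\<close>)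
  also have "\<dots> = (\<Prod>d\<in>{1..n}. (1 + fps_const (1 / (real q ^ (2 * d) - 1)) * fps_X ^ (2 * d)) ^ card (good_orbits M (2 * d)))"
  proof (rule prod.cong[OF refl])
    fix d assume d: "d \<in> {1..n}"
    have "1 \<le> q ^ (2 * d)" using q_pos by (simp add: Suc_le_eq)
    then have "real (tau_fix_card (2 * d)) = real q ^ (2 * d) - 1"
      by (simp add: tau_fix_card_def of_nat_diff)
    then show "(\<Prod>Q\<in>O' (2 * d). ?f Q) =
        (1 + fps_const (1 / (real q ^ (2 * d) - 1)) * fps_X ^ (2 * d)) ^ card (good_orbits M (2 * d))"
      using prod_orbits_card[of "2 * d" M] d by (simp add: O'_def)
  qed
  finally show ?thesis .
qed

text \<open>Evaluation at \<open>w\<close> identifies the torus of one orbit with the values fixed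
  by a full turn. If the value \<open>y\<close> is an M-th root of \<open>w\<close>, the
  corresponding equation at the other points follows by applying \<open>tau\<close>, which commutes
  with powers.\<close>

lemma power_good_orb_iff:
  assumes "finite (orb w)" "w \<noteq> 0" "0 < M"
  shows "power_good M (orb w) \<longleftrightarrow> (\<exists>y. y ^ M = w \<and> (tau ^^ card (orb w)) y = y)"
proof
  assume "power_good M (orb w)"
  then obtain e where e: "e \<in> equivariant (orb w)" "\<forall>v\<in>orb w. e v ^ M = v" by (auto simp: power_good_def)
  have "e w \<in> tau_fix (card (orb w))" using bij_equivariant_orb[OF assms(1,2)] e(1) by (auto simp: bij_betw_def)
  then show "\<exists>y. y ^ M = w \<and> (tau ^^ card (orb w)) y = y"
    using e(2) by (intro exI[of _ "e w"]) (auto simp: tau_fix_def)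
next
  assume "\<exists>y. y ^ M = w \<and> (tau ^^ card (orb w)) y = y"
  then obtain y where y: "y ^ M = w" "(tau ^^ card (orb w)) y = y" by blast
  have "y \<noteq> 0" using y(1) assms(2,3) by (auto simp: zero_power)
  then have "y \<in> tau_fix (card (orb w))" using y(2) by (simp add: tau_fix_def)
  then have "y \<in> (\<lambda>e. e w) ` equivariant (orb w)"
    using bij_betw_imp_surj_on[OF bij_equivariant_orb[OF assms(1,2)]] by simp
  then obtain e where e: "e \<in> equivariant (orb w)" "e w = y" by auto
  have "e v ^ M = v" if v: "v \<in> orb w" for v
  proof -
    obtain k where v: "v = (tau ^^ k) w" using v by (auto simp: orb_def)
    have "e v = (tau ^^ k) y"
      unfolding v e(2)[symmetric] by (rule equivariant_funpow[OF e(1) tau_stable_orb[OF assms(1,2)] orb_refl])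
    then show ?thesis using tau_funpow_power[of k y M] by (simp add: v y(1))
  qed
  then show "power_good M (orb w)" using e(1) by (auto simp: power_good_def)
qed

end

section \<open>The field with \<open>q\<^sup>2\<close> elements inside its algebraic closure\<close>

context twisted_frobenius begin

text \<open>The conjugates of \<open>x\<close> over \<open>F\<close>, since \<open>tau\<close>
  applied twice is the Frobenius map; when finite, it is the root set of the minimal polynomial of
  \<open>x\<close>.\<close>

definition porb :: "'k \<Rightarrow> 'k set" where
  "porb x = range (\<lambda>k. (tau ^^ (2 * k)) x)"

lemma porb_refl [simp]: "x \<in> porb x"
  unfolding porb_def by (rule range_eqI[of _ _ 0]) simp

lemma orb_eq_porb_Un: "orb x = porb x \<union> tau ` porb x"
proof (intro equalityI subsetI)
  fix v assume "v \<in> orb x"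
  then obtain k where v: "v = (tau ^^ k) x" by (auto simp: orb_def)
  show "v \<in> porb x \<union> tau ` porb x"
  proof (cases "even k")
    case True
    then obtain j where "k = 2 * j" by (rule evenE)
    then show ?thesis using v by (auto simp: porb_def)
  next
    case False
    then obtain j where "k = Suc (2 * j)" by (auto elim: oddE)
    then show ?thesis using v by (auto simp: porb_def)
  qed
qed (auto simp: porb_def intro: tau_in_orb)

lemma finite_orb_iff_porb: "finite (porb x) \<longleftrightarrow> finite (orb x)"
  by (auto simp: orb_eq_porb_Un)

lemma porb_odd:
  assumes "finite (orb x)" "odd (card (orb x))" shows "porb x = orb x"
proof (intro equalityI subsetI)
  fix v assume "v \<in> orb x"
  then obtain k where v: "v = (tau ^^ k) x" by (auto simp: orb_def)
  obtain c where c: "card (orb x) = 2 * c + 1" using assms(2) by (auto elim: oddE)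
  \<comment> \<open>Modulo the odd period 2 * c + 1 the number \<open>c + 1\<close> is the inverse
    of 2, so every exponent k is congruent to an even one.\<close>
  have "(2 * (k * (c + 1))) mod card (orb x) = (k + k * card (orb x)) mod card (orb x)"
    by (simp add: c algebra_simps)
  also have "\<dots> = k mod card (orb x)" by simp
  finally have "v = (tau ^^ (2 * (k * (c + 1)))) x"
    unfolding v using orb_period(2)[OF assms(1), of k "2 * (k * (c + 1))"] by metis
  then show "v \<in> porb x" unfolding porb_def by (rule range_eqI)
qed (auto simp: porb_def)

text \<open>Modulo an even period the parity of an exponent is well defined, so even and odd
  iterates form two disjoint halves of the orbit.\<close>

lemma porb_even:
  assumes fin: "finite (orb x)" and card: "card (orb x) = 2 * d"
  shows "card (porb x) = d" "porb x \<inter> tau ` porb x = {}"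
proof -
  have iff: "(tau ^^ k) x = (tau ^^ l) x \<longleftrightarrow> k mod (2 * d) = l mod (2 * d)" for k l
    using orb_period(2)[OF fin] by (simp add: card)
  have d: "0 < d" using orb_period(1)[OF fin] card by simp
  have "porb x = (\<lambda>k. (tau ^^ (2 * k)) x) ` {..<d}"
  proof (intro equalityI subsetI)
    fix v assume "v \<in> porb x"
    then obtain k where "v = (tau ^^ (2 * k)) x" by (auto simp: porb_def)
    also have "\<dots> = (tau ^^ (2 * (k mod d))) x" unfolding iff by (simp flip: mult_mod_right)
    finally show "v \<in> (\<lambda>k. (tau ^^ (2 * k)) x) ` {..<d}" using d by (intro image_eqI[of _ _ "k mod d"]) auto
  qed (auto simp: porb_def)
  moreover have "inj_on (\<lambda>k. (tau ^^ (2 * k)) x) {..<d}"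
    by (auto simp: inj_on_def iff mult_mod_right[symmetric])
  ultimately show "card (porb x) = d" by (simp add: card_image)
  have ne: "(tau ^^ (2 * k)) x \<noteq> (tau ^^ Suc (2 * l)) x" for k l
  proof
    assume "(tau ^^ (2 * k)) x = (tau ^^ Suc (2 * l)) x"
    then have eq: "(2 * k) mod (2 * d) = Suc (2 * l) mod (2 * d)" unfolding iff .
    have "even ((2 * k) mod (2 * d))" by (simp add: mult_mod_right[symmetric])
    moreover have "odd (Suc (2 * l) mod (2 * d))" by (metis dvd_mod_iff dvd_triv_left even_Suc)
    ultimately show False using eq by simp
  qed
  show "porb x \<inter> tau ` porb x = {}"
  proof (rule ccontr)
    assume "porb x \<inter> tau ` porb x \<noteq> {}"
    then obtain u v where uv: "u \<in> porb x" "v \<in> porb x" "u = tau v" by blast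
    obtain k where k: "u = (tau ^^ (2 * k)) x" using uv(1) by (auto simp: porb_def)
    obtain l where l: "v = (tau ^^ (2 * l)) x" using uv(2) by (auto simp: porb_def)
    have "u = (tau ^^ Suc (2 * l)) x" unfolding uv(3) l by simp
    then show False using ne[of k l] k by simp
  qed
qed

end

section \<open>Interpretation in the algebraic closure of the finite field\<close>

locale square_order_field =
  fixes q :: nat and T :: "'a::{field,finite} itself"
  assumes prime_power: "\<exists>p k. prime p \<and> k \<ge> 1 \<and> q = p ^ k"
    and card_field: "card (UNIV :: 'a set) = q ^ 2"

lemma finite_field_power_card:
  fixes x :: "'a::{field,finite}"
  shows "x ^ card (UNIV :: 'a set) = x"
proof (cases "x = 0")
  case True
  then show ?thesis by (simp add: finite_UNIV_card_ge_0)
next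
  case False
  let ?S = "UNIV - {0 :: 'a}"
  have "bij_betw (\<lambda>y. x * y) ?S ?S"
    by (rule bij_betw_byWitness[where f' = "\<lambda>y. y / x"]) (use False in auto)
  then have "(\<Prod>y\<in>?S. x * y) = \<Prod>?S" by (rule prod.reindex_bij_betw)
  then have "x ^ card ?S * \<Prod>?S = \<Prod>?S" by (simp add: prod.distrib)
  moreover have "\<Prod>?S \<noteq> 0" by simp
  ultimately have "x ^ card ?S = 1" by simp
  moreover have "card (UNIV :: 'a set) = Suc (card ?S)"
    by (subst card_Suc_Diff1) auto
  ultimately show ?thesis by (simp only: power_Suc mult_1_right)
qed

text \<open>Translation by 1 permutes the ring and adds the cardinality to the sum of all its
  elements.\<close>

lemma of_nat_card_UNIV_eq_0: "of_nat (card (UNIV :: 'a set)) = (0 :: 'a::{ring_1,finite})"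
proof -
  have "bij (\<lambda>x :: 'a. x + 1)"
    by (rule bij_betw_byWitness[where f' = "\<lambda>x. x - 1"]) auto
  then have "(\<Sum>x\<in>UNIV. x + 1) = \<Sum>(UNIV :: 'a set)" by (rule sum.reindex_bij_betw)
  then show ?thesis by (simp add: sum.distrib)
qed

context square_order_field begin

text \<open>The characteristic divides q^2, a power of p, and so equals p. Additivity of the q-th
  power map rests on this.\<close>

lemma CHAR_power:
  obtains k where "1 \<le> k" "prime CHAR('a)" "q = CHAR('a) ^ k"
proof -
  obtain p k where pk: "prime p" "1 \<le> k" "q = p ^ k" using prime_power by blast
  have pc: "prime CHAR('a)" using prime_CHAR_semidom finite_imp_CHAR_pos[of, where 'a='a] by simp
  have "CHAR('a) dvd p ^ (k * 2)"
    using of_nat_card_UNIV_eq_0[where 'a='a] card_field pk(3) unfolding of_nat_eq_0_iff_char_dvd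
    by (simp add: power_mult)
  then have "CHAR('a) dvd p" using pc prime_dvd_power by blast
  then have "CHAR('a) = p" using pc pk(1) primes_dvd_imp_eq by blast
  then show ?thesis using that[of k] pk pc by simp
qed

end

sublocale square_order_field \<subseteq> twisted_frobenius q "TYPE('a alg_closure)"
proof
  obtain k where k: "1 \<le> k" "prime CHAR('a)" "q = CHAR('a) ^ k" by (rule CHAR_power)
  have "2 \<le> CHAR('a)" using k(2) by (rule prime_ge_2_nat)
  also have "\<dots> \<le> q" unfolding k(3) using k(1) prime_ge_1_nat[OF k(2)] by (intro self_le_power) auto
  finally show "2 \<le> q" .
  show "(x + y) ^ q = x ^ q + y ^ q" for x y :: "'a alg_closure"
    by (rule freshmans_dream'[of _ k]) (use k in simp_all)
  show "of_nat q = (0 :: 'a alg_closure)"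
    using k by (simp add: of_nat_eq_0_iff_char_dvd)
qed

context square_order_field begin

sublocale ac: field_hom "to_ac :: 'a \<Rightarrow> 'a alg_closure"
  by unfold_locales auto

sublocale acp: map_poly_idom_hom "to_ac :: 'a \<Rightarrow> 'a alg_closure"
  by unfold_locales

text \<open>Elements of the finite field satisfy the equation, and both sets have q^2
  elements.\<close>

lemma range_to_ac: "range (to_ac :: 'a \<Rightarrow> _) = {x. x ^ (q ^ 2) = x}"
proof (rule card_subset_eq)
  have eq: "{x :: 'a alg_closure. x ^ (q ^ 2) = x} = insert 0 (tau_fix 2)"
    using q_pos by (auto simp: tau_fix_def tau_funpow zero_power)
  show "finite {x :: 'a alg_closure. x ^ (q ^ 2) = x}" unfolding eq using finite_tau_fix[of 2] by simp
  show "range (to_ac :: 'a \<Rightarrow> _) \<subseteq> {x. x ^ (q ^ 2) = x}"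
    using finite_field_power_card[where 'a='a] by (auto simp: card_field simp flip: to_ac_power)
  have "card (tau_fix 2) = q ^ 2 - 1" using card_tau_fix[of 2] by (simp add: tau_fix_card_def)
  then have "card {x :: 'a alg_closure. x ^ (q ^ 2) = x} = q ^ 2"
    unfolding eq using finite_tau_fix[of 2] q_pos by (simp add: tau_fix_def)
  then show "card (range (to_ac :: 'a \<Rightarrow> _)) = card {x :: 'a alg_closure. x ^ (q ^ 2) = x}"
    by (simp add: card_image[OF inj_to_ac] card_field)
qed

subsection \<open>Unitary matrices\<close>

lemma to_ac_antidiag [simp]: "map_mat to_ac (antidiag n) = antidiag n"
  by (rule eq_matI) (auto simp: antidiag_def)

lemma star_to_ac: "star (map_mat to_ac A) = map_mat to_ac (transpose_mat (conj_mat q A))"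
  by (rule eq_matI) (auto simp: star_def conj_mat_def frob_def)

lemma map_mat_to_ac_inj: "map_mat to_ac A = map_mat to_ac B \<longleftrightarrow> A = (B :: 'a mat)"
  by (rule ac.mat_hom_inj[THEN iffI]) auto

lemma unitary_equation_to_ac:
  fixes A :: "'a mat"
  assumes "A \<in> carrier_mat n n"
  shows "map_mat to_ac A \<in> unit_grp n \<longleftrightarrow> A * antidiag n * transpose_mat (conj_mat q A) = antidiag n"
proof -
  have c: "A \<in> carrier_mat n n" "transpose_mat (conj_mat q A) \<in> carrier_mat n n"
    "A * antidiag n \<in> carrier_mat n n" using assms by (auto simp: conj_mat_def)
  have "map_mat to_ac A * antidiag n * star (map_mat to_ac A)
      = map_mat to_ac (A * antidiag n * transpose_mat (conj_mat q A))"
    using c by (simp add: star_to_ac ac.mat_hom_mult[of _ n n _ n])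
  then have "map_mat to_ac A \<in> unit_grp n \<longleftrightarrow>
      map_mat to_ac (A * antidiag n * transpose_mat (conj_mat q A)) = map_mat to_ac (antidiag n)"
    using assms by (simp add: unit_grp_def)
  then show ?thesis by (simp only: map_mat_to_ac_inj)
qed

lemma unitary_group_iff:
  fixes A :: "'a mat"
  shows "A \<in> unitary_group q n \<longleftrightarrow> A \<in> carrier_mat n n \<and> map_mat to_ac A \<in> unit_grp n"
proof -
  have "invertible_mat A" if A: "A \<in> carrier_mat n n" and eq: "A * antidiag n * transpose_mat (conj_mat q A) = antidiag n"
  proof -
    let ?B = "antidiag n * transpose_mat (conj_mat q A) * antidiag n"
    have c: "transpose_mat (conj_mat q A) \<in> carrier_mat n n" using A by (simp add: conj_mat_def)
    have "A * ?B = (A * antidiag n * transpose_mat (conj_mat q A)) * antidiag n"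
      using A c by (simp add: assoc_mult_mat[of _ n n _ n _ n])
    then have AB: "A * ?B = 1\<^sub>m n" unfolding eq antidiag_square .
    have B: "?B \<in> carrier_mat n n" using c by simp
    have BA: "?B * A = 1\<^sub>m n" by (rule mat_mult_left_right_inverse[OF A B AB])
    show ?thesis
      unfolding invertible_mat_def inverts_mat_def using A B AB BA by (auto intro!: exI[of _ ?B])
  qed
  then show ?thesis using unitary_equation_to_ac[of A n] by (auto simp: unitary_group_def)
qed

text \<open>Surjectivity rests on \<open>unit_grp_entry\<close>: the entries of a solution over the
  closure are fixed by the q^2-th power map and hence come from the finite field.\<close>

lemma bij_unitary_group: "bij_betw (map_mat to_ac) (unitary_group q n :: 'a mat set) (unit_grp n)"
  unfolding bij_betw_def
proof (intro conjI inj_onI equalityI subsetI)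
  fix g assume "g \<in> map_mat to_ac ` (unitary_group q n :: 'a mat set)"
  then show "g \<in> unit_grp n" using unitary_group_iff by blast
next
  fix g :: "'a alg_closure mat" assume g: "g \<in> unit_grp n"
  have c: "g \<in> carrier_mat n n" using g by (rule unit_grp_carrier)
  define A :: "'a mat" where "A = map_mat of_ac g"
  have "map_mat to_ac A = g"
  proof (rule eq_matI)
    fix i j assume "i < dim_row g" "j < dim_col g"
    then have ij: "i < n" "j < n" using c by auto
    have "g $$ (i, j) \<in> range (to_ac :: 'a \<Rightarrow> _)"
      unfolding range_to_ac using unit_grp_entry[OF g ij] by simp
    then show "map_mat to_ac A $$ (i, j) = g $$ (i, j)" using ij c by (simp add: A_def to_ac_of_ac)
  qed (use c in \<open>auto simp: A_def\<close>)
  moreover have "A \<in> carrier_mat n n" using c by (simp add: A_def)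
  ultimately have "A \<in> unitary_group q n" using g unitary_group_iff[of A n] by simp
  then show "g \<in> map_mat to_ac ` (unitary_group q n :: 'a mat set)" using \<open>map_mat to_ac A = g\<close> by blast
qed (simp add: map_mat_to_ac_inj)

subsection \<open>Roots in the algebraic closure\<close>

definition ac_roots :: "'a poly \<Rightarrow> 'a alg_closure set" where
  "ac_roots f = {x. poly (map_poly to_ac f) x = 0}"

lemma ac_roots_mult: "ac_roots (f * g) = ac_roots f \<union> ac_roots g"
  by (auto simp: ac_roots_def acp.hom_mult)

lemma ac_roots_mono: "f dvd g \<Longrightarrow> ac_roots f \<subseteq> ac_roots g"
  by (auto elim!: dvdE simp: ac_roots_mult)

lemma map_to_ac_eq_0 [simp]: "map_poly to_ac f = 0 \<longleftrightarrow> f = (0 :: 'a poly)"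
  by (simp add: poly_eq_iff coeff_map_poly)

lemma finite_ac_roots: "f \<noteq> 0 \<Longrightarrow> finite (ac_roots f)"
  unfolding ac_roots_def by (rule poly_roots_finite) simp

lemma card_ac_roots_le: "f \<noteq> 0 \<Longrightarrow> card (ac_roots f) \<le> degree f"
  unfolding ac_roots_def using card_poly_roots_bound[of "map_poly to_ac f"] by simp

lemma ac_roots_nonempty: "0 < degree f \<Longrightarrow> ac_roots f \<noteq> {}"
  unfolding ac_roots_def using alg_closed_imp_poly_has_root[of "map_poly to_ac f"] by auto

lemma ac_roots_unit: "is_unit f \<Longrightarrow> ac_roots f = {}"
proof -
  assume "is_unit f"
  then obtain c where c: "f = [:c:]" "c dvd 1" unfolding is_unit_poly_iff by blast
  then have "c \<noteq> 0" by auto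
  then show ?thesis by (simp add: c(1) ac_roots_def map_poly_pCons)
qed

lemma irreducible_degree_pos: "irreducible f \<Longrightarrow> 0 < degree (f :: 'a poly)"
  using is_unit_iff_degree[of f] irreducible_not_unit[of f] by (cases "f = 0") auto

lemma ac_roots_smult: "c \<noteq> 0 \<Longrightarrow> ac_roots (Polynomial.smult c f) = ac_roots f"
proof -
  assume c: "c \<noteq> 0"
  have "map_poly to_ac (Polynomial.smult c f) = Polynomial.smult (to_ac c) (map_poly to_ac f)"
    by (simp add: poly_eq_iff coeff_map_poly)
  then show ?thesis using c by (simp add: ac_roots_def)
qed

lemma minimal_polynomial:
  assumes "p \<noteq> 0" "x \<in> ac_roots p"
  obtains m where "monic m" "irreducible m" "\<And>p. x \<in> ac_roots p \<longleftrightarrow> m dvd p"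
proof -
  let ?P = "\<lambda>f. f \<noteq> 0 \<and> x \<in> ac_roots f"
  obtain m0 where m0: "m0 \<noteq> 0" "x \<in> ac_roots m0" "\<And>f. f \<noteq> 0 \<Longrightarrow> x \<in> ac_roots f \<Longrightarrow> degree m0 \<le> degree f"
    using ex_has_least_nat[of ?P p degree] assms by blast
  define m where "m = Polynomial.smult (inverse (lead_coeff m0)) m0"
  have m: "monic m" "degree m = degree m0" "m \<noteq> 0" "x \<in> ac_roots m"
    using m0(1,2) by (simp_all add: m_def ac_roots_smult)
  have dvd: "m dvd f" if f: "x \<in> ac_roots f" for f
  proof (rule ccontr)
    assume "\<not> m dvd f"
    then have nz: "f mod m \<noteq> 0" by (simp add: dvd_eq_mod_eq_0)
    have "map_poly to_ac (f mod m) = map_poly to_ac f - map_poly to_ac m * map_poly to_ac (f div m)"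
      unfolding minus_mult_div_eq_mod[symmetric, of f m]
      by (simp only: acp.hom_minus acp.hom_mult)
    then have "x \<in> ac_roots (f mod m)" using m(4) f by (simp add: ac_roots_def)
    then have "degree m0 \<le> degree (f mod m)" using m0(3) nz by blast
    moreover have "degree (f mod m) < degree m" using degree_mod_less'[OF m(3) nz] .
    ultimately show False using m(2) by simp
  qed
  have iff: "x \<in> ac_roots f \<longleftrightarrow> m dvd f" for f
    using dvd ac_roots_mono[of m f] m(4) by blast
  have "irreducible m"
  proof (rule Factorial_Ring.irreducibleI)
    show "m \<noteq> 0" by (rule m(3))
    show "\<not> m dvd 1" using ac_roots_unit m(4) by blast
    fix a b assume ab: "m = a * b"
    have nz: "a \<noteq> 0" "b \<noteq> 0" using ab m(3) by auto
    have deg: "degree m = degree a + degree b" using ab nz by (simp add: degree_mult_eq)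
    consider "x \<in> ac_roots a" | "x \<in> ac_roots b" using m(4) ab by (auto simp: ac_roots_mult)
    then show "a dvd 1 \<or> b dvd 1"
    proof cases
      case 1
      then have "degree m \<le> degree a" using iff nz by (simp add: dvd_imp_degree_le)
      then show ?thesis using deg nz by (simp add: is_unit_iff_degree)
    next
      case 2
      then have "degree m \<le> degree b" using iff nz by (simp add: dvd_imp_degree_le)
      then show ?thesis using deg nz by (simp add: is_unit_iff_degree)
    qed
  qed
  with m(1) show ?thesis by (rule that) (rule iff)
qed

lemma coprime_iff_no_common_root:
  assumes "p \<noteq> (0 :: 'a poly)"
  shows "coprime p r \<longleftrightarrow> ac_roots p \<inter> ac_roots r = {}"
proof
  assume c: "coprime p r"
  show "ac_roots p \<inter> ac_roots r = {}"
  proof (rule ccontr)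
    assume "ac_roots p \<inter> ac_roots r \<noteq> {}"
    then obtain x where x: "x \<in> ac_roots p" "x \<in> ac_roots r" by blast
    obtain m where m: "irreducible m" "\<And>p. x \<in> ac_roots p \<longleftrightarrow> m dvd p"
      using minimal_polynomial[OF assms x(1)] by metis
    then have "is_unit m" using c x coprime_common_divisor by blast
    then show False using m(1) irreducible_not_unit by blast
  qed
next
  assume disj: "ac_roots p \<inter> ac_roots r = {}"
  show "coprime p r"
  proof (rule coprimeI)
    fix d assume d: "d dvd p" "d dvd r"
    then have "ac_roots d = {}" using ac_roots_mono[OF d(1)] ac_roots_mono[OF d(2)] disj by blast
    then have "degree d = 0" using ac_roots_nonempty[of d] by blast
    moreover have "d \<noteq> 0" using d(1) assms by auto
    ultimately show "is_unit d" by (simp add: is_unit_iff_degree)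
  qed
qed

text \<open>Coprimality to the derivative becomes the absence of a common root in the closure, and
  \<open>card_roots_eq_degree_iff\<close> turns this into a count of roots.\<close>

lemma separable_mat_iff:
  fixes A :: "'a mat"
  assumes A: "A \<in> carrier_mat n n"
  shows "separable_mat A \<longleftrightarrow> card (mat_roots (map_mat to_ac A)) = n"
proof -
  have deg: "degree (char_poly A) = n" and nz: "char_poly A \<noteq> 0"
    using degree_monic_char_poly[OF A] by auto
  have roots: "mat_roots (map_mat to_ac A) = ac_roots (char_poly A)"
    using ac.char_poly_hom[OF A] by (simp add: mat_roots_def ac_roots_def)
  have "separable_mat A \<longleftrightarrow> ac_roots (char_poly A) \<inter> ac_roots (pderiv (char_poly A)) = {}"
    unfolding separable_mat_def by (rule coprime_iff_no_common_root[OF nz])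
  also have "\<dots> \<longleftrightarrow> (\<forall>x. poly (map_poly to_ac (char_poly A)) x = 0 \<longrightarrow>
      poly (pderiv (map_poly to_ac (char_poly A))) x \<noteq> 0)"
    by (auto simp: ac_roots_def ac.map_poly_pderiv)
  also have "\<dots> \<longleftrightarrow> card {x. poly (map_poly to_ac (char_poly A)) x = 0} = degree (map_poly to_ac (char_poly A))"
    by (rule card_roots_eq_degree_iff[symmetric]) (use nz in simp)
  also have "\<dots> \<longleftrightarrow> card (ac_roots (char_poly A)) = n" using deg by (simp add: ac_roots_def)
  finally show ?thesis by (simp add: roots)
qed

lemma is_Mth_power_iff:
  fixes A :: "'a mat"
  shows "is_Mth_power_U q n M A \<longleftrightarrow> (\<exists>a\<in>unit_grp n. a ^\<^sub>m M = map_mat to_ac A)"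
proof
  assume "is_Mth_power_U q n M A"
  then obtain B where B: "B \<in> unitary_group q n" "A = B ^\<^sub>m M" by (auto simp: is_Mth_power_U_def)
  then have "map_mat to_ac B ^\<^sub>m M = map_mat to_ac A"
    using ac.mat_hom_pow[of B n M] by (simp add: unitary_group_iff)
  then show "\<exists>a\<in>unit_grp n. a ^\<^sub>m M = map_mat to_ac A" using B(1) unitary_group_iff by blast
next
  assume "\<exists>a\<in>unit_grp n. a ^\<^sub>m M = map_mat to_ac A"
  then obtain a where a: "a \<in> unit_grp n" "a ^\<^sub>m M = map_mat to_ac A" by blast
  then obtain B :: "'a mat" where B: "B \<in> unitary_group q n" "a = map_mat to_ac B"
    using bij_betw_imp_surj_on[OF bij_unitary_group[of n]] by blast
  then have "map_mat to_ac (B ^\<^sub>m M) = map_mat to_ac A"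
    using ac.mat_hom_pow[of B n M] a(2) by (simp add: unitary_group_iff)
  then show "is_Mth_power_U q n M A" using B(1) by (auto simp: is_Mth_power_U_def map_mat_to_ac_inj)
qed

lemma card_unitary_group: "card (unitary_group q n :: 'a mat set) = card (unit_grp n)"
  by (rule bij_betw_same_card[OF bij_unitary_group])

lemma S_U_eq_card: "S_U M n q T = card (power_elements M n)"
proof -
  let ?A = "{A :: 'a mat. A \<in> unitary_group q n \<and> separable_mat A \<and> is_Mth_power_U q n M A}"
  have iff: "A \<in> ?A \<longleftrightarrow> map_mat to_ac A \<in> power_elements M n" if "A \<in> unitary_group q n" for A
    using that by (auto simp: unitary_group_iff separable_mat_iff is_Mth_power_iff power_elements_def)
  have "bij_betw (map_mat to_ac) ?A (power_elements M n)"
    unfolding bij_betw_def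
  proof (intro conjI inj_onI equalityI subsetI)
    fix g assume "g \<in> map_mat to_ac ` ?A"
    then show "g \<in> power_elements M n" using iff by auto
  next
    fix g assume g: "g \<in> power_elements M n"
    then have "g \<in> unit_grp n" by (simp add: power_elements_def)
    then obtain A :: "'a mat" where "A \<in> unitary_group q n" "g = map_mat to_ac A"
      using bij_betw_imp_surj_on[OF bij_unitary_group[of n]] by blast
    then show "g \<in> map_mat to_ac ` ?A" using iff g by blast
  qed (simp add: map_mat_to_ac_inj)
  then show ?thesis unfolding S_U_def by (rule bij_betw_same_card)
qed

end

section \<open>Irreducible polynomials and orbits\<close>

context twisted_frobenius begin

lemma porb_tau: "porb (tau x) = tau ` porb x"
  by (auto simp: porb_def image_image simp flip: funpow_swap1)

lemma tau_surj: obtains x where "y = tau x"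
proof -
  obtain x where "x ^ q = inverse y" using nth_root_exists[OF q_pos] by blast
  then have "y = tau x" by (simp add: tau_def)
  then show ?thesis by (rule that)
qed

text \<open>A period of \<open>w\<close> is also one of its M-th power. This bounds the orbit of an
  M-th root from below.\<close>

lemma card_orb_dvd_power:
  assumes "w ^ M = x" "finite (orb w)" "finite (orb x)"
  shows "card (orb x) dvd card (orb w)"
proof -
  have "(tau ^^ card (orb w)) x = x"
    using assms(1) tau_funpow_power[of "card (orb w)" w M] funpow_card_orb[OF assms(2)] by simp
  then show ?thesis using funpow_eq_self_iff[OF assms(3)] by simp
qed

end

context square_order_field begin

lemma poly_frobenius:
  "poly (map_poly to_ac f) x ^ (q ^ 2) = poly (map_poly to_ac f) (x ^ (q ^ 2))" for f :: "'a poly"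
proof -
  have fixed: "to_ac c ^ (q ^ 2) = to_ac c" for c :: 'a using range_to_ac by blast
  have "poly (map_poly to_ac f) x ^ (q ^ 2) = (\<Sum>i\<le>degree f. (to_ac (coeff f i) * x ^ i) ^ (q ^ 2))"
    by (simp add: poly_altdef coeff_map_poly power_q_sum_funpow)
  also have "\<dots> = (\<Sum>i\<le>degree f. to_ac (coeff f i) * (x ^ (q ^ 2)) ^ i)"
    by (rule sum.cong[OF refl]) (simp add: power_mult_distrib fixed power_mult[symmetric] mult.commute)
  finally show ?thesis by (simp add: poly_altdef coeff_map_poly)
qed

lemma ac_roots_frobenius: "x \<in> ac_roots f \<Longrightarrow> tau (tau x) \<in> ac_roots f"
  using poly_frobenius[of f x] q_pos by (simp add: ac_roots_def tau_tau zero_power)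

lemma porb_subset_ac_roots: "x \<in> ac_roots f \<Longrightarrow> porb x \<subseteq> ac_roots f"
proof -
  assume x: "x \<in> ac_roots f"
  have "(tau ^^ (2 * k)) x \<in> ac_roots f" for k
    by (induction k) (use x ac_roots_frobenius in auto)
  then show ?thesis by (auto simp: porb_def)
qed

text \<open>Galois descent: the Frobenius map of \<open>F\<close> permutes the factors of the
  product, so its coefficients are fixed and lie in the image of the finite field.\<close>

lemma porb_polynomial:
  assumes "finite (porb x)"
  obtains f :: "'a poly" where "map_poly to_ac f = (\<Prod>w\<in>porb x. [:-w, 1:])"
proof -
  define P where "P = (\<Prod>w\<in>porb x. [:-w, 1:])"
  interpret h: map_poly_idom_hom "\<lambda>c :: 'a alg_closure. c ^ (q ^ 2)"
    by unfold_locales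
      (simp_all add: power_mult_distrib power2_eq_square power_mult power_q_add)
  have closed: "tau (tau w) \<in> porb x" if w: "w \<in> porb x" for w
  proof -
    obtain k where "w = (tau ^^ (2 * k)) x" using w by (auto simp: porb_def)
    then have "tau (tau w) = (tau ^^ (2 * Suc k)) x" by simp
    then show ?thesis unfolding porb_def by (rule range_eqI)
  qed
  have "inj_on (\<lambda>w. tau (tau w)) (porb x)" by (auto simp: inj_on_def tau_inj)
  moreover from this have "(\<lambda>w. tau (tau w)) ` porb x = porb x"
    using assms closed by (intro endo_inj_surj) auto
  ultimately have bij: "bij_betw (\<lambda>w. tau (tau w)) (porb x) (porb x)" by (simp add: bij_betw_def)
  have "map_poly (\<lambda>c. c ^ (q ^ 2)) P = (\<Prod>w\<in>porb x. map_poly (\<lambda>c. c ^ (q ^ 2)) [:-w, 1:])"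
    unfolding P_def by (rule h.hom_prod)
  also have "\<dots> = (\<Prod>w\<in>porb x. [:- tau (tau w), 1:])"
  proof (rule prod.cong[OF refl])
    fix w :: "'a alg_closure"
    have "(- w) ^ (q ^ 2) = - (w ^ (q ^ 2))" by (rule h.base.hom_uminus)
    then show "map_poly (\<lambda>c. c ^ (q ^ 2)) [:-w, 1:] = [:- tau (tau w), 1:]"
      using q_pos by (simp add: map_poly_pCons tau_tau)
  qed
  also have "\<dots> = P" unfolding P_def by (rule prod.reindex_bij_betw[OF bij])
  finally have P: "map_poly (\<lambda>c. c ^ (q ^ 2)) P = P" .
  have "coeff P i \<in> range (to_ac :: 'a \<Rightarrow> _)" for i
    using arg_cong[OF P, of "\<lambda>p. coeff p i"] q_pos by (simp add: range_to_ac coeff_map_poly)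
  then have "map_poly to_ac (map_poly of_ac P :: 'a poly) = P"
    by (simp add: poly_eq_iff coeff_map_poly to_ac_of_ac)
  then show ?thesis using that unfolding P_def by blast
qed

lemma irreducible_root_iff:
  assumes "irreducible f" "x \<in> ac_roots f"
  shows "x \<in> ac_roots p \<longleftrightarrow> f dvd p"
proof -
  have f0: "f \<noteq> 0" using assms(1) by auto
  obtain m where m: "irreducible m" "\<And>p. x \<in> ac_roots p \<longleftrightarrow> m dvd p"
    using minimal_polynomial[OF f0 assms(2)] by metis
  then obtain c where c: "f = m * c" using assms(2) by (auto elim: dvdE)
  then have "m dvd 1 \<or> c dvd 1" using assms(1) Factorial_Ring.irreducibleD by blast
  then have "c dvd 1" using m(1) irreducible_not_unit by blast
  then have "f dvd p \<longleftrightarrow> m dvd p" unfolding c by (rule mult_unit_dvd_iff)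
  then show ?thesis using m(2) by simp
qed

text \<open>The product over the conjugates of \<open>x\<close> descends to a polynomial with root
  \<open>x\<close>, so \<open>f\<close> divides it. As all conjugates are roots of \<open>f\<close>,
  both have the same degree and the same roots, and those of \<open>f\<close> are simple.\<close>

lemma ac_roots_irreducible:
  assumes f: "irreducible f" and x: "x \<in> ac_roots f"
  shows "ac_roots f = porb x" "card (porb x) = degree f" "finite (orb x)"
proof -
  have f0: "f \<noteq> 0" using f by auto
  have sub: "porb x \<subseteq> ac_roots f" by (rule porb_subset_ac_roots[OF x])
  then have fin: "finite (porb x)" using finite_ac_roots[OF f0] finite_subset by blast
  then show "finite (orb x)" by (simp add: finite_orb_iff_porb)
  obtain g :: "'a poly" where g: "map_poly to_ac g = (\<Prod>w\<in>porb x. [:-w, 1:])"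
    by (rule porb_polynomial[OF fin])
  have groots: "ac_roots g = porb x"
    unfolding ac_roots_def g using fin by (auto simp: poly_prod)
  have "degree (map_poly to_ac g) = card (porb x)"
    unfolding g by (subst degree_prod_eq_sum_degree) auto
  then have deg: "degree g = card (porb x)" by simp
  have g0: "g \<noteq> 0" using g fin by auto
  have "f dvd g" using irreducible_root_iff[OF f x, of g] groots by simp
  then have "ac_roots f \<subseteq> porb x" "degree f \<le> card (porb x)"
    using ac_roots_mono[of f g] groots deg dvd_imp_degree_le[of f g] g0 by auto
  then show "ac_roots f = porb x" using sub by blast
  then show "card (porb x) = degree f"
    using card_ac_roots_le[OF f0] \<open>degree f \<le> card (porb x)\<close> by simp
qed

lemma monic_irreducible_eqI:
  assumes "monic f" "irreducible f" "monic g" "irreducible g" "x \<in> ac_roots f" "x \<in> ac_roots g"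
  shows "f = g"
proof (rule poly_dvd_antisym)
  show "f dvd g" using irreducible_root_iff[OF assms(2,5), of g] assms(6) by simp
  show "g dvd f" using irreducible_root_iff[OF assms(4,6), of f] assms(5) by simp
qed (use assms in simp)

lemma minimal_polynomial_of_finite_orb:
  assumes "finite (orb x)"
  obtains f :: "'a poly" where "monic f" "irreducible f" "x \<in> ac_roots f"
proof -
  have fin: "finite (porb x)" using assms by (simp add: finite_orb_iff_porb)
  obtain g :: "'a poly" where g: "map_poly to_ac g = (\<Prod>w\<in>porb x. [:-w, 1:])"
    by (rule porb_polynomial[OF fin])
  have g0: "g \<noteq> 0" using g fin by auto
  have "x \<in> ac_roots g" unfolding ac_roots_def g using fin by (auto simp: poly_prod)
  from minimal_polynomial[OF g0 this] show ?thesis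
    using that by (metis dvd_refl)
qed

lemma zero_in_ac_roots_iff: "0 \<in> ac_roots f \<longleftrightarrow> poly f 0 = 0"
proof -
  have "poly (map_poly to_ac f) 0 = to_ac (poly f 0)" by (simp add: poly_0_coeff_0 coeff_map_poly)
  then show ?thesis by (simp add: ac_roots_def)
qed

lemma ac_roots_nonempty_irreducible:
  assumes "irreducible f" obtains x where "x \<in> ac_roots f"
  using ac_roots_nonempty[OF irreducible_degree_pos[OF assms]] that by blast

subsection \<open>The involution on polynomials\<close>

lemma coeff_tilde:
  fixes f :: "'a poly"
  shows "coeff (tilde q f) j = inverse (poly f 0 ^ q) * (if j \<le> degree f then coeff f (degree f - j) ^ q else 0)"
proof -
  have "coeff (\<Sum>i\<le>degree f. Polynomial.monom (frob q (coeff f i)) (degree f - i)) j =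
      (\<Sum>i\<le>degree f. if degree f - i = j then coeff f i ^ q else 0)"
    by (simp add: coeff_sum frob_def)
  also have "\<dots> = (if j \<le> degree f then coeff f (degree f - j) ^ q else 0)"
  proof (cases "j \<le> degree f")
    case True
    have "(\<Sum>i\<le>degree f. if degree f - i = j then coeff f i ^ q else 0) =
        (\<Sum>i\<le>degree f. if i = degree f - j then coeff f (degree f - j) ^ q else 0)"
      by (rule sum.cong[OF refl]) (use True in auto)
    then show ?thesis using True by simp
  next
    case False
    then show ?thesis by (auto intro!: sum.neutral)
  qed
  finally show ?thesis by (simp add: tilde_def frob_def)
qed

lemma tilde_basic:
  fixes f :: "'a poly"
  assumes "monic f" "poly f 0 \<noteq> 0"
  shows "degree (tilde q f) = degree f" "monic (tilde q f)" "poly (tilde q f) 0 \<noteq> 0"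
proof -
  have c: "coeff (tilde q f) (degree f) = 1"
    using assms(2) by (simp add: coeff_tilde poly_0_coeff_0)
  have "degree (tilde q f) \<le> degree f" by (rule degree_le) (simp add: coeff_tilde)
  moreover have "degree f \<le> degree (tilde q f)" by (rule le_degree) (simp add: c)
  ultimately show deg: "degree (tilde q f) = degree f" by simp
  show "monic (tilde q f)" using c deg by simp
  show "poly (tilde q f) 0 \<noteq> 0" using assms by (simp add: poly_0_coeff_0 coeff_tilde)
qed

text \<open>Because \<open>tau x * x ^ q = 1\<close>, evaluating the reversed conjugate polynomial
  at \<open>tau x\<close> gives the q-th power of the value at x, up to nonzero factors.\<close>

lemma poly_tilde:
  fixes f :: "'a poly"
  assumes f: "monic f" "poly f 0 \<noteq> 0" and x: "x \<noteq> 0"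
  shows "poly (map_poly to_ac (tilde q f)) (tau x) =
    to_ac (inverse (poly f 0 ^ q)) * tau x ^ degree f * poly (map_poly to_ac f) x ^ q"
proof -
  let ?d = "degree f" and ?c = "to_ac (inverse (poly f 0 ^ q))"
  have tx: "tau x * x ^ q = 1" using x by (simp add: tau_def)
  have "poly (map_poly to_ac (tilde q f)) (tau x) = (\<Sum>j\<le>?d. to_ac (coeff (tilde q f) j) * tau x ^ j)"
    by (simp add: poly_altdef coeff_map_poly tilde_basic[OF f])
  also have "\<dots> = (\<Sum>j\<le>?d. ?c * to_ac (coeff f (?d - j)) ^ q * tau x ^ (?d - (?d - j)))"
    by (rule sum.cong[OF refl]) (simp add: coeff_tilde)
  also have "\<dots> = (\<Sum>i\<le>?d. ?c * to_ac (coeff f i) ^ q * tau x ^ (?d - i))"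
    by (rule sum.reindex_bij_witness[of _ "\<lambda>i. ?d - i" "\<lambda>j. ?d - j"]) auto
  also have "\<dots> = (\<Sum>i\<le>?d. ?c * tau x ^ ?d * (to_ac (coeff f i) * x ^ i) ^ q)"
  proof (rule sum.cong[OF refl])
    fix i assume "i \<in> {..?d}"
    then have "tau x ^ ?d = tau x ^ (?d - i) * tau x ^ i" by (simp flip: power_add)
    moreover have "tau x ^ i * (x ^ i) ^ q = (tau x * x ^ q) ^ i"
      by (simp add: power_mult_distrib power_mult[symmetric] mult.commute)
    then have "tau x ^ i * (x ^ i) ^ q = 1" by (simp add: tx)
    ultimately have "tau x ^ ?d * (x ^ i) ^ q = tau x ^ (?d - i)" by (simp add: mult.assoc)
    then show "?c * to_ac (coeff f i) ^ q * tau x ^ (?d - i) = ?c * tau x ^ ?d * (to_ac (coeff f i) * x ^ i) ^ q"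
      by (simp add: power_mult_distrib ac_simps)
  qed
  also have "\<dots> = ?c * tau x ^ ?d * (\<Sum>i\<le>?d. to_ac (coeff f i) * x ^ i) ^ q"
    by (simp add: sum_distrib_left power_q_sum)
  also have "(\<Sum>i\<le>?d. to_ac (coeff f i) * x ^ i) = poly (map_poly to_ac f) x"
    by (simp add: poly_altdef coeff_map_poly)
  finally show ?thesis .
qed

lemma ac_roots_tilde:
  assumes f: "monic f" "poly f 0 \<noteq> 0"
  shows "ac_roots (tilde q f) = tau ` ac_roots f"
proof -
  have iff: "tau x \<in> ac_roots (tilde q f) \<longleftrightarrow> x \<in> ac_roots f" if "x \<noteq> 0" for x
    using poly_tilde[OF f that] that f(2) q_pos by (simp add: ac_roots_def)
  have z: "0 \<notin> ac_roots f" "0 \<notin> ac_roots (tilde q f)"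
    using f tilde_basic(3)[OF f] by (simp_all add: zero_in_ac_roots_iff)
  show ?thesis
  proof (intro equalityI subsetI)
    fix y assume y: "y \<in> ac_roots (tilde q f)"
    obtain x where x: "y = tau x" by (rule tau_surj)
    have "x \<noteq> 0" using x y z(2) by auto
    then show "y \<in> tau ` ac_roots f" using iff y x by blast
  next
    fix y assume "y \<in> tau ` ac_roots f"
    then obtain x where x: "y = tau x" "x \<in> ac_roots f" by blast
    then have "x \<noteq> 0" using z(1) by auto
    then show "y \<in> ac_roots (tilde q f)" using iff x by blast
  qed
qed

text \<open>The minimal polynomial of \<open>tau x\<close> divides \<open>tilde q f\<close>. Its
  degree is the number of conjugates of \<open>tau x\<close>, equal to that of \<open>x\<close>,
  hence the degree of \<open>f\<close>; so the two agree.\<close>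

lemma irreducible_tilde:
  fixes f :: "'a poly"
  assumes f: "monic f" "irreducible f" "poly f 0 \<noteq> 0"
  shows "irreducible (tilde q f)"
proof -
  obtain x where x: "x \<in> ac_roots f" by (rule ac_roots_nonempty_irreducible[OF f(2)])
  note R = ac_roots_irreducible[OF f(2) x]
  note t = tilde_basic[OF f(1,3)]
  have tx: "tau x \<in> ac_roots (tilde q f)" using ac_roots_tilde[OF f(1,3)] x by blast
  have "tilde q f \<noteq> 0" using t(2) by auto
  then obtain m where m: "monic m" "irreducible m" "\<And>p. tau x \<in> ac_roots p \<longleftrightarrow> m dvd p"
    using minimal_polynomial[OF _ tx] by metis
  have mx: "tau x \<in> ac_roots m" using m(3) by simp
  have "degree m = card (porb (tau x))" using ac_roots_irreducible(2)[OF m(2) mx] by simp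
  also have "\<dots> = degree f" unfolding porb_tau using R(2) by (simp add: card_image inj_tau)
  finally have deg: "degree m = degree (tilde q f)" using t(1) by simp
  have "m dvd tilde q f" using m(3) tx by blast
  then obtain c where c: "tilde q f = m * c" unfolding dvd_def by blast
  have nz: "m \<noteq> 0" "c \<noteq> 0" using c \<open>tilde q f \<noteq> 0\<close> by auto
  then have "degree c = 0" using c deg by (simp add: degree_mult_eq)
  moreover have "lead_coeff c = 1" using c t(2) m(1) by (simp add: lead_coeff_mult)
  ultimately have "c = 1" using monic_degree_0 by blast
  then show ?thesis using c m(2) by simp
qed

lemma tilde_eq_iff:
  fixes f :: "'a poly"
  assumes f: "monic f" "irreducible f" "poly f 0 \<noteq> 0"
  shows "tilde q f = f \<longleftrightarrow> tau ` ac_roots f = ac_roots f"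
proof
  assume "tilde q f = f"
  then show "tau ` ac_roots f = ac_roots f" using ac_roots_tilde[OF f(1,3)] by simp
next
  assume eq: "tau ` ac_roots f = ac_roots f"
  obtain x where x: "x \<in> ac_roots f" by (rule ac_roots_nonempty_irreducible[OF f(2)])
  then have "x \<in> ac_roots (tilde q f)" using ac_roots_tilde[OF f(1,3)] eq by simp
  then show "tilde q f = f"
    using monic_irreducible_eqI[OF tilde_basic(2)[OF f(1,3)] irreducible_tilde[OF f] f(1,2) _ x] by simp
qed

lemma ac_roots_pcompose_monom:
  "y \<in> ac_roots (pcompose f (Polynomial.monom 1 M)) \<longleftrightarrow> y ^ M \<in> ac_roots f"
proof -
  have "map_poly to_ac (pcompose f (Polynomial.monom 1 M)) = pcompose (map_poly to_ac f) (Polynomial.monom 1 M)"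
    by (subst ac.map_poly_pcompose) simp
  then show ?thesis by (simp add: ac_roots_def poly_pcompose poly_monom)
qed

subsection \<open>Self-conjugate polynomials and orbits of odd size\<close>

lemma SCIM_roots:
  assumes "SCIM q f" "x \<in> ac_roots f"
  shows "ac_roots f = orb x" "finite (orb x)" "card (orb x) = degree f" "x \<noteq> 0"
proof -
  have f: "monic f" "irreducible f" "poly f 0 \<noteq> 0" "tilde q f = f" using assms(1) by (auto simp: SCIM_def)
  note R = ac_roots_irreducible[OF f(2) assms(2)]
  have "tau ` porb x = porb x" using tilde_eq_iff[OF f(1-3)] f(4) R(1) by simp
  then have "orb x = porb x" by (simp add: orb_eq_porb_Un)
  then show "ac_roots f = orb x" "finite (orb x)" "card (orb x) = degree f" using R by simp_all
  show "x \<noteq> 0" using f(3) assms(2) zero_in_ac_roots_iff by auto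
qed

lemma SCIM_of_odd_orb:
  assumes "finite (orb x)" "odd (card (orb x))" "x \<noteq> 0"
  obtains f :: "'a poly" where "SCIM q f" "x \<in> ac_roots f"
proof -
  obtain f :: "'a poly" where f: "monic f" "irreducible f" "x \<in> ac_roots f"
    by (rule minimal_polynomial_of_finite_orb[OF assms(1)])
  have roots: "ac_roots f = orb x"
    using ac_roots_irreducible(1)[OF f(2,3)] porb_odd[OF assms(1,2)] by simp
  have st: "tau_stable (orb x)" by (rule tau_stable_orb[OF assms(1,3)])
  have f0: "poly f 0 \<noteq> 0" using st zero_in_ac_roots_iff[of f] roots by (auto simp: tau_stable_def)
  have "tilde q f = f" using tilde_eq_iff[OF f(1,2) f0] st roots by (simp add: tau_stable_def)
  then have "SCIM q f" using f f0 by (simp add: SCIM_def)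
  then show ?thesis using f(3) by (rule that)
qed

text \<open>Taking roots maps SCIM polynomials of degree d to orbits of size d. A SCIM factor of
  f(x^M) of the same degree is the minimal polynomial of an M-th root \<open>y\<close> of a root of
  \<open>f\<close> whose orbit also has size d, which is the criterion of
  \<open>power_good_orb_iff\<close>.\<close>

lemma N_tilde_eq:
  assumes d: "odd d" and M: "0 < M"
  shows "N_tilde M q d T = card (good_orbits M d)"
proof -
  let ?F = "{f :: 'a poly. SCIM q f \<and> degree f = d \<and> tilde_M_power q M f}"
  have "bij_betw ac_roots ?F (good_orbits M d)"
    unfolding bij_betw_def
  proof (intro conjI inj_onI equalityI subsetI)
    fix f g assume fg: "f \<in> ?F" "g \<in> ?F" "ac_roots f = ac_roots g"
    then have f: "monic f" "irreducible f" and g: "monic g" "irreducible g" by (auto simp: SCIM_def)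
    obtain x where x: "x \<in> ac_roots f" by (rule ac_roots_nonempty_irreducible[OF f(2)])
    show "f = g" by (rule monic_irreducible_eqI[OF f g x]) (use x fg in simp)
  next
    fix Q assume "Q \<in> ac_roots ` ?F"
    then obtain f where f: "SCIM q f" "degree f = d" "tilde_M_power q M f" "Q = ac_roots f" by blast
    obtain g where g: "g dvd pcompose f (Polynomial.monom 1 M)" "SCIM q g" "degree g = d"
      using f(2,3) by (auto simp: tilde_M_power_def)
    have "irreducible g" using g(2) by (simp add: SCIM_def)
    then obtain y where y: "y \<in> ac_roots g" by (rule ac_roots_nonempty_irreducible)
    then have yM: "y ^ M \<in> ac_roots f" using ac_roots_mono[OF g(1)] ac_roots_pcompose_monom by blast
    note A = SCIM_roots[OF f(1) yM] and B = SCIM_roots[OF g(2) y]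
    have "(tau ^^ card (orb (y ^ M))) y = y" using funpow_card_orb[OF B(2)] A(3) B(3) f(2) g(3) by simp
    then have "power_good M (orb (y ^ M))" using power_good_orb_iff[OF A(2,4) M] by blast
    then show "Q \<in> good_orbits M d" using A f by (auto simp: good_orbits_def orbits_def)
  next
    fix Q assume "Q \<in> good_orbits M d"
    then obtain x where x: "Q = orb x" "x \<noteq> 0" "finite (orb x)" "card (orb x) = d" "power_good M (orb x)"
      by (auto simp: good_orbits_def orbits_def)
    obtain y where y: "y ^ M = x" "(tau ^^ d) y = y"
      using power_good_orb_iff[OF x(3,2) M] x(4,5) by auto
    have y0: "y \<noteq> 0" using y(1) x(2) M by (auto simp: zero_power)
    have dpos: "0 < d" using d by (auto intro: gr0I)
    have fy: "finite (orb y)" by (rule finite_orbI[OF dpos y(2)])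
    \<comment> \<open>d divides the orbit size of \<open>y\<close> because \<open>x\<close> is a
      power of \<open>y\<close>, and is a multiple of it because \<open>tau ^^ d\<close> fixes
      \<open>y\<close>.\<close>
    have cy: "card (orb y) = d"
      using card_orb_dvd_power[OF y(1) fy x(3)] funpow_eq_self_iff[OF fy, of d] y(2) x(4) dvd_antisym by blast
    obtain f :: "'a poly" where f: "SCIM q f" "x \<in> ac_roots f"
      using SCIM_of_odd_orb[OF x(3) _ x(2)] d x(4) by blast
    obtain g :: "'a poly" where g: "SCIM q g" "y \<in> ac_roots g"
      using SCIM_of_odd_orb[OF fy _ y0] d cy by blast
    note A = SCIM_roots[OF f] and B = SCIM_roots[OF g]
    have "irreducible g" using g(1) by (simp add: SCIM_def)
    then have "g dvd pcompose f (Polynomial.monom 1 M)"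
      using irreducible_root_iff[OF _ g(2), of "pcompose f (Polynomial.monom 1 M)"] ac_roots_pcompose_monom[of y f M] y(1) f(2) by simp
    then have "tilde_M_power q M f" unfolding tilde_M_power_def using g(1) A(3) B(3) cy x(4) by auto
    then show "Q \<in> ac_roots ` ?F" using f A x by (intro image_eqI[of _ _ f]) auto
  qed
  then show ?thesis unfolding N_tilde_def by (rule bij_betw_same_card)
qed

subsection \<open>Pairs of polynomials and orbits of even size\<close>

text \<open>On an orbit of odd size the conjugates of \<open>x\<close> would be the whole orbit; the
  roots of \<open>g\<close> would then be stable under \<open>tau\<close>, contradicting
  \<open>g \<noteq> tilde q g\<close>.\<close>

lemma pair_roots:
  fixes g :: "'a poly"
  assumes g: "monic g" "irreducible g" "poly g 0 \<noteq> 0" "g \<noteq> tilde q g" and x: "x \<in> ac_roots g"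
  shows "ac_roots g \<union> ac_roots (tilde q g) = orb x" "card (orb x) = 2 * degree g" "finite (orb x)" "x \<noteq> 0"
proof -
  note R = ac_roots_irreducible[OF g(2) x]
  show "ac_roots g \<union> ac_roots (tilde q g) = orb x"
    by (simp add: ac_roots_tilde[OF g(1,3)] R(1) orb_eq_porb_Un)
  show fin: "finite (orb x)" by (rule R(3))
  show "x \<noteq> 0" using g(3) x zero_in_ac_roots_iff by auto
  have "even (card (orb x))"
  proof (rule ccontr)
    assume "odd (card (orb x))"
    then have "porb x = orb x" by (rule porb_odd[OF fin])
    then have "tau ` ac_roots g = ac_roots g"
      using R(1) tau_stable_orb[OF fin \<open>x \<noteq> 0\<close>] by (simp add: tau_stable_def)
    then show False using tilde_eq_iff[OF g(1-3)] g(4) by simp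
  qed
  then obtain d where "card (orb x) = 2 * d" by (rule evenE)
  then show "card (orb x) = 2 * degree g" using porb_even(1)[OF fin] R(2) by simp
qed

lemma pair_of_even_orb:
  assumes x: "finite (orb x)" "card (orb x) = 2 * d" "x \<noteq> 0"
  obtains g :: "'a poly" where "monic g" "irreducible g" "poly g 0 \<noteq> 0" "g \<noteq> tilde q g" "degree g = d" "x \<in> ac_roots g"
proof -
  obtain g :: "'a poly" where g: "monic g" "irreducible g" "x \<in> ac_roots g"
    by (rule minimal_polynomial_of_finite_orb[OF x(1)])
  note R = ac_roots_irreducible[OF g(2,3)]
  have "0 \<notin> orb x" using tau_stable_orb[OF x(1,3)] by (simp add: tau_stable_def)
  then have g0: "poly g 0 \<noteq> 0" using zero_in_ac_roots_iff[of g] R(1) by (auto simp: orb_eq_porb_Un)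
  have "g \<noteq> tilde q g"
  proof
    assume "g = tilde q g"
    then have "tau ` porb x = porb x" using tilde_eq_iff[OF g(1,2) g0] R(1) by simp
    then show False using porb_even(2)[OF x(1,2)] porb_refl[of x] by blast
  qed
  moreover have "degree g = d" using R(2) porb_even(1)[OF x(1,2)] by simp
  ultimately show ?thesis using that g g0 by blast
qed

lemma M_power_poly_iff:
  fixes g :: "'a poly"
  assumes g: "monic g" "irreducible g" "poly g 0 \<noteq> 0" "g \<noteq> tilde q g" and x: "x \<in> ac_roots g" and M: "0 < M"
  shows "M_power_poly M g \<longleftrightarrow> power_good M (orb x)"
proof -
  note P = pair_roots[OF g x]
  have dpos: "0 < degree g" by (rule irreducible_degree_pos[OF g(2)])
  show ?thesis
  proof
    assume "M_power_poly M g"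
    then obtain h where h: "h dvd pcompose g (Polynomial.monom 1 M)" "irreducible h" "degree h = degree g"
      by (auto simp: M_power_poly_def)
    obtain y where y: "y \<in> ac_roots h" by (rule ac_roots_nonempty_irreducible[OF h(2)])
    then have yM: "y ^ M \<in> ac_roots g" using ac_roots_mono[OF h(1)] ac_roots_pcompose_monom by blast
    note A = pair_roots[OF g yM] and B = ac_roots_irreducible[OF h(2) y]
    \<comment> \<open>\<open>h\<close> may be self-conjugate or not. Its degree counts the
      conjugates of \<open>y\<close>, which are all of an odd orbit and half of an even one; the
      divisibility holds in both cases.\<close>
    have "card (orb y) dvd 2 * degree h"
    proof (cases "odd (card (orb y))")
      case True
      then show ?thesis using porb_odd[OF B(3)] B(2) by simp
    next
      case False
      then obtain c where "card (orb y) = 2 * c" by (auto elim: evenE)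
      then show ?thesis using porb_even(1)[OF B(3)] B(2) by simp
    qed
    then have "(tau ^^ card (orb (y ^ M))) y = y"
      using funpow_eq_self_iff[OF B(3)] A(2) h(3) by simp
    then have "power_good M (orb (y ^ M))" using power_good_orb_iff[OF A(3,4) M] by blast
    then show "power_good M (orb x)" using A(1) P(1) by simp
  next
    assume "power_good M (orb x)"
    then obtain y where y: "y ^ M = x" "(tau ^^ (2 * degree g)) y = y"
      using power_good_orb_iff[OF P(3,4) M] P(2) by auto
    have y0: "y \<noteq> 0" using y(1) P(4) M by (auto simp: zero_power)
    have fy: "finite (orb y)" by (rule finite_orbI[OF _ y(2)]) (use dpos in simp)
    have cy: "card (orb y) = 2 * degree g"
      using card_orb_dvd_power[OF y(1) fy P(3)] funpow_eq_self_iff[OF fy] y(2) P(2) dvd_antisym by metis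
    obtain h :: "'a poly" where h: "irreducible h" "degree h = degree g" "y \<in> ac_roots h"
      using pair_of_even_orb[OF fy cy y0] by metis
    have "h dvd pcompose g (Polynomial.monom 1 M)"
      using irreducible_root_iff[OF h(1,3), of "pcompose g (Polynomial.monom 1 M)"] ac_roots_pcompose_monom[of y g M] y(1) x by simp
    then show "M_power_poly M g" using h by (auto simp: M_power_poly_def)
  qed
qed

text \<open>Applying \<open>tau\<close> twice to a root gives a conjugate over \<open>F\<close>, so
  both monic irreducible polynomials share a root.\<close>

lemma tilde_tilde:
  fixes g :: "'a poly"
  assumes g: "monic g" "irreducible g" "poly g 0 \<noteq> 0"
  shows "tilde q (tilde q g) = g"
proof -
  obtain x where x: "x \<in> ac_roots g" by (rule ac_roots_nonempty_irreducible[OF g(2)])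
  note t = tilde_basic[OF g(1,3)] irreducible_tilde[OF g]
  have "tau (tau x) \<in> ac_roots (tilde q (tilde q g))"
    using ac_roots_tilde[OF t(2,3)] ac_roots_tilde[OF g(1,3)] x by simp
  then show ?thesis
    using monic_irreducible_eqI[OF tilde_basic(2)[OF t(2,3)] irreducible_tilde[OF t(2,4,3)] g(1,2)]
      ac_roots_frobenius[OF x] by blast
qed

text \<open>The roots of \<open>g\<close> and of \<open>tilde q g\<close> are the two halves of one
  orbit, so unordered pairs correspond to orbits; by \<open>M_power_poly_iff\<close> the power
  condition depends on the orbit alone.\<close>

lemma R_tilde_eq:
  assumes M: "0 < M"
  shows "R_tilde M q d T = card (good_orbits M (2 * d))"
proof -
  let ?P = "\<lambda>g :: 'a poly. monic g \<and> irreducible g \<and> degree g = d \<and> poly g 0 \<noteq> 0 \<and> g \<noteq> tilde q g \<and> M_power_poly M g"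
  let ?F = "{{g, tilde q g} | g :: 'a poly. ?P g}"
  let ?h = "\<lambda>S. \<Union>(ac_roots ` S)"
  have "bij_betw ?h ?F (good_orbits M (2 * d))"
    unfolding bij_betw_def
  proof (rule conjI; (rule inj_onI | (rule equalityI; rule subsetI)))
    fix S S' assume S: "S \<in> ?F" and S': "S' \<in> ?F" and eq: "?h S = ?h S'"
    obtain g where g: "S = {g, tilde q g}" "?P g" using S by blast
    obtain g' where g': "S' = {g', tilde q g'}" "?P g'" using S' by blast
    obtain x where x: "x \<in> ac_roots g" by (rule ac_roots_nonempty_irreducible) (use g in auto)
    have "x \<in> ac_roots g' \<or> x \<in> ac_roots (tilde q g')" using x eq g g' by auto
    then show "S = S'"
    proof
      assume "x \<in> ac_roots g'"
      then have "g = g'" using monic_irreducible_eqI[of g g' x] g g' x by blast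
      then show ?thesis using g g' by simp
    next
      \<comment> \<open>Here the two representatives are each other's \<open>tilde\<close>, and
        \<open>tilde_tilde\<close> shows that they span the same pair.\<close>
      assume "x \<in> ac_roots (tilde q g')"
      moreover have "monic (tilde q g')" "irreducible (tilde q g')"
        using g' tilde_basic(2) irreducible_tilde by blast+
      moreover have "monic g" "irreducible g" using g by blast+
      ultimately have "g = tilde q g'" using monic_irreducible_eqI x by blast
      then show ?thesis using g g' tilde_tilde[of g'] by auto
    qed
  next
    fix Q assume "Q \<in> ?h ` ?F"
    then obtain g where g: "?P g" "Q = ac_roots g \<union> ac_roots (tilde q g)" by auto
    have G: "monic g" "irreducible g" "poly g 0 \<noteq> 0" "g \<noteq> tilde q g" using g by auto
    obtain x where x: "x \<in> ac_roots g" by (rule ac_roots_nonempty_irreducible[OF G(2)])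
    show "Q \<in> good_orbits M (2 * d)"
      using pair_roots[OF G x] M_power_poly_iff[OF G x M] g by (auto simp: good_orbits_def orbits_def)
  next
    fix Q assume "Q \<in> good_orbits M (2 * d)"
    then obtain x where x: "Q = orb x" "x \<noteq> 0" "finite (orb x)" "card (orb x) = 2 * d" "power_good M (orb x)"
      by (auto simp: good_orbits_def orbits_def)
    obtain g :: "'a poly" where g: "monic g" "irreducible g" "poly g 0 \<noteq> 0" "g \<noteq> tilde q g" "degree g = d" "x \<in> ac_roots g"
      by (rule pair_of_even_orb[OF x(3,4,2)])
    have "?P g" using g M_power_poly_iff[OF g(1-4,6) M] x(5) by simp
    moreover have "Q = ?h {g, tilde q g}" using pair_roots(1)[OF g(1-4,6)] x(1) by simp
    ultimately show "Q \<in> ?h ` ?F" by blast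
  qed
  then show ?thesis unfolding R_tilde_def by (rule bij_betw_same_card)
qed

theorem separable_powers_generating_function:
  assumes "0 < M"
  shows "real (S_U M n q T) / real (card (unitary_group q n :: 'a mat set)) = fps_nth (rhs_trunc M q T n) n"
  unfolding S_U_eq_card card_unitary_group power_elements_generating_function rhs_trunc_def
  by (simp add: N_tilde_eq[OF _ assms] R_tilde_eq[OF assms])

end

theorem theorem4p4:
  fixes q M :: nat and T :: "'a::{field,finite} itself"
  assumes "\<exists>p k. prime p \<and> k \<ge> 1 \<and> q = p ^ k"
    and "card (UNIV :: 'a set) = q ^ 2"
    and "M \<ge> 2"
  shows "\<forall>n \<ge> 1. real (S_U M n q T) / real (card (unitary_group q n :: 'a mat set))
                   = fps_nth (rhs_trunc M q T n) n"
proof -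
  interpret square_order_field q T
    using assms(1,2) by unfold_locales
  show ?thesis
    using separable_powers_generating_function[of M] assms(3) by simp
qed

end
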